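(* Let $k$ be a positive integer. For $\mu\in\mathcal{G}_k$ let $\chi_\mu:\mathcal{Y}^{(k)}\to\mathbb{C}$ be the character of $\mathcal{Y}^{(k)}$ (unital algebra homomorphism to $\mathbb{C}$) uniquely determined by the requirement that $\chi_\mu(Y_w)=\mathrm{Cf}_w(R_\mu)$ for every word $w\in[k]^*$ with $|w|\ge 2$, where $R_\mu$ is the $R$-transform of $\mu$. Then the map $\mu\mapsto\chi_\mu$ is a group isomorphism from $(\mathcal{G}_k,\boxtimes)$ onto the group $\mathbb{X}(\mathcal{Y}^{(k)})$ of characters of $\mathcal{Y}^{(k)}$, endowed with the operation of convolution.
   Context: Distributions. A non-commutative probability space is a pair $(\mathcal{A},\varphi)$ with $\mathcal{A}$ a unital algebra over $\mathbb{C}$ and $\varphi:\mathcal{A}\to\mathbb{C}$ linear with $\varphi(1_{\mathcal{A}})=1$. The distribution of $(a_1,\dots,a_k)\in\mathcal{A}^k$ is the linear functional $\mu$ on $\mathbb{C}\langle X_1,\dots,X_k\rangle$ (non-commutative polynomials) with $\mu(X_{i_1}\cdots X_{i_n})=\varphi(a_{i_1}\cdots a_{i_n})$ for all $n\ge 0$ and all indices. $\mathcal{D}_{\mathrm{alg}}(k)$ is the set of all linear functionals $\mu$ on $\mathbb{C}\langle X_1,\dots,X_k\rangle$ with $\mu(1)=1$ (each is the distribution of some $k$-tuple). Unital subalgebras $\mathcal{A}_1,\mathcal{A}_2$ of $\mathcal{A}$ are freely independent if $\varphi(c_1\cdots c_n)=0$ whenever $c_j\in\mathcal{A}_{i_j}$,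 $\varphi(c_j)=0$ and $i_j\ne i_{j+1}$; sets are freely independent if the unital subalgebras they generate are. Free multiplicative convolution $\boxtimes$ on $\mathcal{D}_{\mathrm{alg}}(k)$ is the well-defined operation such that if $(a_1,\dots,a_k)$ has distribution $\mu$, $(b_1,\dots,b_k)$ has distribution $\nu$, and $\{a_1,\dots,a_k\}$ is freely independent from $\{b_1,\dots,b_k\}$, then $(a_1b_1,\dots,a_kb_k)$ has distribution $\mu\boxtimes\nu$. The set $\mathcal{G}_k=\{\mu\in\mathcal{D}_{\mathrm{alg}}(k)\mid\mu(X_i)=1,\ 1\le i\le k\}$ is a group under $\boxtimes$, with unit the functional taking value $1$ on every monomial. Words and non-crossing partitions. $[k]^*$ is the set of finite words over $\{1,\dots,k\}$, $|w|$ is the length of $w$. For $w=(i_1,\dots,i_n)$ and $B=\{b_1<\dots<b_m\}\subseteq\{1,\dots,n\}$, $w|B:=(i_{b_1},\dots,i_{b_m})$. $NC(n)$ is the lattice of non-crossing partitions of $\{1,\dots,n\}$ ordered by reversed refinement ($\pi\le\rho$ iff every block of $\rho$ is a union of blocks of $\pi$), with minimum $0_n$ (all blocks singletons) and maximum $1_n$ (one block). For $\pi\in NC(n)$, $P_\pi$ is the permutation of $\{1,\dots,n\}$ which maps cyclically $b_1\mapsto b_2\mapsto\cdots\mapsto b_m\mapsto b_1$ on every block $\{b_1<\dots<b_m\}$ of $\pi$. The Kreweras complement $K(\pi)\in NC(n)$ is determined by $P_{K(\pi)}=P_\pi^{-1}P_{1_n}$ (composition of maps). $R$-transform. For a power series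 $f$ with vanishing constant term in non-commuting indeterminates $z_1,\dots,z_k$, $\mathrm{Cf}_w(f)$ is the coefficient of $z_w:=z_{i_1}\cdots z_{i_n}$ in $f$ ($w=(i_1,\dots,i_n)$, $n\ge1$), and $\mathrm{Cf}_{w;\pi}(f):=\prod_{B\text{ block of }\pi}\mathrm{Cf}_{w|B}(f)$ for $\pi\in NC(n)$. $R_\mu$ is the unique such series with $\mu(X_{i_1}\cdots X_{i_n})=\sum_{\pi\in NC(n)}\mathrm{Cf}_{(i_1,\dots,i_n);\pi}(R_\mu)$ for all $n\ge1$ and all indices. The Hopf algebra $\mathcal{Y}^{(k)}$. As an algebra, $\mathcal{Y}^{(k)}=\mathbb{C}[Y_w\mid w\in[k]^*,|w|\ge2]$ (commutative polynomials). Put $Y_w:=1$ if $|w|=1$, and $Y_{w;\pi}:=\prod_{A\text{ block of }\pi}Y_{w|A}$ for $|w|=n$, $\pi\in NC(n)$. The comultiplication $\Delta$ is the unital algebra homomorphism with $\Delta(Y_w)=\sum_{\pi\in NC(n)}Y_{w;\pi}\otimes Y_{w;K(\pi)}$ for $|w|=n\ge2$, and the counit $\varepsilon$ is the unital algebra homomorphism with $\varepsilon(Y_w)=0$ for $|w|\ge2$. With these, $\mathcal{Y}^{(k)}$ is a graded connected Hopf algebra, $Y_w$ being homogeneous of degree $|w|-1$. The convolution of linear functionals $\xi,\eta$ on $\mathcal{Y}^{(k)}$ is $\xi\eta:=(\xi\otimes\eta)\circ\Delta$ (with $\mathbb{C}\otimes\mathbb{C}=\mathbb{C}$); $\mathbb{X}(\mathcal{Y}^{(k)})$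 is the set of unital algebra homomorphisms $\mathcal{Y}^{(k)}\to\mathbb{C}$, a group under convolution with unit $\varepsilon$. *)

theory Defs
  imports
    Complex_Main
    "HOL-Library.Poly_Mapping"
    "HOL-Library.Product_Plus"
    "HOL-Library.Disjoint_Sets"
    "HOL-Algebra.Group"
begin

section \<open>Complex algebras\<close>

text \<open>
  A unital algebra over the complex numbers is a type of class \<open>ring_1\<close> together with an
  explicit scalar multiplication.  The index set $\{1,\dots,k\}$ is a finite type \<open>'k\<close>, so that
  words over it are values of type \<open>'k list\<close>.
\<close>

locale complex_algebra = vector_space scale
  for scale :: "complex \<Rightarrow> 'a::ring_1 \<Rightarrow> 'a" +
  assumes scale_mult_left: "scale c x * y = scale c (x * y)"
    and scale_mult_right: "x * scale c y = scale c (x * y)"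

definition unital_alg_hom ::
  "(complex \<Rightarrow> 'a::ring_1 \<Rightarrow> 'a) \<Rightarrow> (complex \<Rightarrow> 'b::ring_1 \<Rightarrow> 'b) \<Rightarrow> ('a \<Rightarrow> 'b) \<Rightarrow> bool"
  where
  "unital_alg_hom s1 s2 f \<longleftrightarrow>
     Vector_Spaces.linear s1 s2 f \<and> f 1 = 1 \<and> (\<forall>x y. f (x * y) = f x * f y)"

definition unital_subalgebra :: "(complex \<Rightarrow> 'a::ring_1 \<Rightarrow> 'a) \<Rightarrow> 'a set \<Rightarrow> bool" where
  "unital_subalgebra scale B \<longleftrightarrow>
     module.subspace scale B \<and> 1 \<in> B \<and> (\<forall>x\<in>B. \<forall>y\<in>B. x * y \<in> B)"

definition pm_scale :: "complex \<Rightarrow> ('m \<Rightarrow>\<^sub>0 complex) \<Rightarrow> 'm \<Rightarrow>\<^sub>0 complex" where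
  "pm_scale c p = Poly_Mapping.map ((*) c) p"


section \<open>Distributions, freeness and free multiplicative convolution\<close>

text \<open>
  With concatenation as addition, words form a monoid, and the convolution product of
  \<^theory>\<open>HOL-Library.Poly_Mapping\<close> makes \<open>'k list \<Rightarrow>\<^sub>0 complex\<close> the free algebra.
\<close>

instantiation list :: (type) monoid_add
begin
definition zero_list :: "'a list" where "zero_list = []"
definition plus_list :: "'a list \<Rightarrow> 'a list \<Rightarrow> 'a list" where "plus_list = (@)"
instance by standard (simp_all add: zero_list_def plus_list_def)
end

type_synonym 'k ncpoly = "'k list \<Rightarrow>\<^sub>0 complex"

definition ncX :: "'k \<Rightarrow> 'k ncpoly" where
  "ncX i = Poly_Mapping.single [i] 1"

definition ncmon :: "'k list \<Rightarrow> 'k ncpoly" where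
  "ncmon w = prod_list (map ncX w)"

definition D_alg :: "('k ncpoly \<Rightarrow> complex) set" where
  "D_alg = {\<mu>. Vector_Spaces.linear pm_scale (*) \<mu> \<and> \<mu> 1 = 1}"

locale nc_prob_space = complex_algebra scale
  for scale :: "complex \<Rightarrow> 'a::ring_1 \<Rightarrow> 'a" +
  fixes \<phi> :: "'a \<Rightarrow> complex"
  assumes linear_phi: "Vector_Spaces.linear scale (*) \<phi>"
    and phi_one: "\<phi> 1 = 1"

definition has_distribution ::
  "('a::ring_1 \<Rightarrow> complex) \<Rightarrow> ('k \<Rightarrow> 'a) \<Rightarrow> ('k ncpoly \<Rightarrow> complex) \<Rightarrow> bool" where
  "has_distribution \<phi> a \<mu> \<longleftrightarrow>
     Vector_Spaces.linear pm_scale (*) \<mu> \<and> (\<forall>w. \<mu> (ncmon w) = \<phi> (prod_list (map a w)))"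

text \<open>Only non-empty products are considered, since the empty one is 1 and \<open>\<phi> 1 = 1\<close>.\<close>

definition freely_independent_subalgebras ::
  "('a::ring_1 \<Rightarrow> complex) \<Rightarrow> 'a set \<Rightarrow> 'a set \<Rightarrow> bool" where
  "freely_independent_subalgebras \<phi> A1 A2 \<longleftrightarrow>
     (\<forall>n\<ge>1. \<forall>(c :: nat \<Rightarrow> 'a) (i :: nat \<Rightarrow> bool).
        (\<forall>j<n. c j \<in> (if i j then A1 else A2) \<and> \<phi> (c j) = 0) \<longrightarrow>
        (\<forall>j. Suc j < n \<longrightarrow> i j \<noteq> i (Suc j)) \<longrightarrow>
        \<phi> (prod_list (map c [0..<n])) = 0)"

definition freely_independent ::
  "(complex \<Rightarrow> 'a::ring_1 \<Rightarrow> 'a) \<Rightarrow> ('a \<Rightarrow> complex) \<Rightarrow> 'a set \<Rightarrow> 'a set \<Rightarrow> bool" where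
  "freely_independent scale \<phi> S T \<longleftrightarrow>
     freely_independent_subalgebras \<phi>
       (unital_subalgebra scale hull S) (unital_subalgebra scale hull T)"

text \<open>
  \<open>free_product_distribution scale \<phi> a b \<mu> \<nu> \<sigma>\<close>: in the space given by \<open>scale\<close> and \<open>\<phi>\<close>, the
  tuples \<open>a\<close> and \<open>b\<close> have distributions \<open>\<mu>\<close> and \<open>\<nu>\<close>, are freely independent, and the tuple of
  products \<open>a\<^sub>i b\<^sub>i\<close> has distribution \<open>\<sigma>\<close>.
\<close>

definition free_product_distribution ::
  "(complex \<Rightarrow> 'a::ring_1 \<Rightarrow> 'a) \<Rightarrow> ('a \<Rightarrow> complex) \<Rightarrow> ('k \<Rightarrow> 'a) \<Rightarrow> ('k \<Rightarrow> 'a) \<Rightarrow>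
   ('k ncpoly \<Rightarrow> complex) \<Rightarrow> ('k ncpoly \<Rightarrow> complex) \<Rightarrow> ('k ncpoly \<Rightarrow> complex) \<Rightarrow> bool" where
  "free_product_distribution scale \<phi> a b \<mu> \<nu> \<sigma> \<longleftrightarrow>
     nc_prob_space scale \<phi> \<and> has_distribution \<phi> a \<mu> \<and> has_distribution \<phi> b \<nu> \<and>
     freely_independent scale \<phi> (range a) (range b) \<and>
     has_distribution \<phi> (\<lambda>i. a i * b i) \<sigma>"

text \<open>
  A definition cannot quantify over all types, so the probability spaces are taken on the free
  algebra in $2k$ indeterminates.  This is no restriction: a pair of free \<open>k\<close>-tuples in an
  arbitrary space can be pulled back along the evaluation homomorphism (see
  \<open>free_mult_conv_eqI\<close> below).
\<close>

definition free_mult_conv ::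
  "('k ncpoly \<Rightarrow> complex) \<Rightarrow> ('k ncpoly \<Rightarrow> complex) \<Rightarrow> ('k ncpoly \<Rightarrow> complex)"
  (infixl \<open>\<boxtimes>\<close> 70) where
  "\<mu> \<boxtimes> \<nu> = (THE \<sigma>. \<exists>(\<phi> :: ('k + 'k) ncpoly \<Rightarrow> complex) a b.
     free_product_distribution pm_scale \<phi> a b \<mu> \<nu> \<sigma>)"

text \<open>The unit is the linear functional with value 1 on every monomial.\<close>

definition G_unit :: "'k ncpoly \<Rightarrow> complex" where
  "G_unit p = (\<Sum>w\<in>Poly_Mapping.keys p. Poly_Mapping.lookup p w)"

definition G_group :: "('k ncpoly \<Rightarrow> complex) monoid" where
  "G_group = \<lparr>carrier = {\<mu> \<in> D_alg. \<forall>i. \<mu> (ncX i) = 1}, mult = (\<boxtimes>), one = G_unit\<rparr>"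


section \<open>Non-crossing partitions and the R-transform\<close>

text \<open>
  Positions in a word are counted from 0, so the partitions are partitions of \<open>{..<n}\<close>, and
  the restriction $w|B$ of a word is \<^term>\<open>nths w B\<close>.
\<close>

definition NC :: "nat \<Rightarrow> nat set set set" where
  "NC n = {\<pi>. partition_on {..<n} \<pi> \<and>
     (\<forall>B\<in>\<pi>. \<forall>C\<in>\<pi>. \<forall>a b c d. a < b \<and> b < c \<and> c < d \<and> a \<in> B \<and> c \<in> B \<and> b \<in> C \<and> d \<in> C \<longrightarrow> B = C)}"

definition block_perm :: "nat set set \<Rightarrow> nat \<Rightarrow> nat" where
  "block_perm \<pi> i =
     (if \<exists>B\<in>\<pi>. i \<in> B
      then let B = (THE B. B \<in> \<pi> \<and> i \<in> B) in if i = Max B then Min B else Min {j \<in> B. i < j}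
      else i)"

definition kreweras :: "nat \<Rightarrow> nat set set \<Rightarrow> nat set set" where
  "kreweras n \<pi> = (THE \<rho>. \<rho> \<in> NC n \<and>
     block_perm \<rho> = inv_into UNIV (block_perm \<pi>) \<circ> block_perm {{..<n}})"

text \<open>
  A power series in non-commuting indeterminates is its family of coefficients, indexed by
  words.
\<close>

definition R_transform :: "('k ncpoly \<Rightarrow> complex) \<Rightarrow> 'k list \<Rightarrow> complex" where
  "R_transform \<mu> = (THE f. f [] = 0 \<and>
     (\<forall>w. w \<noteq> [] \<longrightarrow> \<mu> (ncmon w) = (\<Sum>\<pi>\<in>NC (length w). \<Prod>B\<in>\<pi>. f (nths w B))))"


section \<open>The Hopf algebra and its characters\<close>

typedef 'k word2 = "{w :: 'k list. length w \<ge> 2}"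
  by (rule exI[of _ "[undefined, undefined]"]) simp

text \<open>
  Commutative polynomials in variables indexed by \<open>'v\<close> are the functions
  \<open>('v \<Rightarrow>\<^sub>0 nat) \<Rightarrow>\<^sub>0 complex\<close> of finite support on the (multiplicative) monomials.
\<close>

type_synonym 'k ymon = "'k word2 \<Rightarrow>\<^sub>0 nat"
type_synonym 'k yalg = "'k ymon \<Rightarrow>\<^sub>0 complex"

definition Y :: "'k list \<Rightarrow> 'k yalg" where
  "Y w = (if length w \<ge> 2 then Poly_Mapping.single (Poly_Mapping.single (Abs_word2 w) 1) 1 else 1)"

definition Y_part :: "'k list \<Rightarrow> nat set set \<Rightarrow> 'k yalg" where
  "Y_part w \<pi> = (\<Prod>A\<in>\<pi>. Y (nths w A))"

text \<open>
  The monomials form a basis of \<open>'k yalg\<close>, so the pairs \<open>(m, n)\<close> of monomials, standing for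
  $m \otimes n$, form a basis of its tensor square.  The product induced by the addition of
  pairs of exponents is that of the tensor product of algebras.
\<close>

type_synonym 'k yalg2 = "('k ymon \<times> 'k ymon) \<Rightarrow>\<^sub>0 complex"

definition tensor :: "'k yalg \<Rightarrow> 'k yalg \<Rightarrow> 'k yalg2" (infixl \<open>\<otimes>\<^sub>Y\<close> 70) where
  "p \<otimes>\<^sub>Y q = (\<Sum>m\<in>Poly_Mapping.keys p. \<Sum>n\<in>Poly_Mapping.keys q.
     Poly_Mapping.single (m, n) (Poly_Mapping.lookup p m * Poly_Mapping.lookup q n))"

definition tensor_functional ::
  "('k yalg \<Rightarrow> complex) \<Rightarrow> ('k yalg \<Rightarrow> complex) \<Rightarrow> 'k yalg2 \<Rightarrow> complex" where
  "tensor_functional \<xi> \<eta> t = (\<Sum>(m, n)\<in>Poly_Mapping.keys t.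
     Poly_Mapping.lookup t (m, n) * (\<xi> (Poly_Mapping.single m 1) * \<eta> (Poly_Mapping.single n 1)))"

definition comult :: "'k yalg \<Rightarrow> 'k yalg2" where
  "comult = (THE D. unital_alg_hom pm_scale pm_scale D \<and>
     (\<forall>w. length w \<ge> 2 \<longrightarrow>
        D (Y w) = (\<Sum>\<pi>\<in>NC (length w). Y_part w \<pi> \<otimes>\<^sub>Y Y_part w (kreweras (length w) \<pi>))))"

definition counit :: "'k yalg \<Rightarrow> complex" where
  "counit = (THE e. unital_alg_hom pm_scale (*) e \<and> (\<forall>w. length w \<ge> 2 \<longrightarrow> e (Y w) = 0))"

definition conv :: "('k yalg \<Rightarrow> complex) \<Rightarrow> ('k yalg \<Rightarrow> complex) \<Rightarrow> 'k yalg \<Rightarrow> complex" where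
  "conv \<xi> \<eta> = tensor_functional \<xi> \<eta> \<circ> comult"

definition character_group :: "('k yalg \<Rightarrow> complex) monoid" where
  "character_group =
     \<lparr>carrier = {\<chi>. unital_alg_hom pm_scale (*) \<chi>}, mult = conv, one = counit\<rparr>"

definition chi :: "('k ncpoly \<Rightarrow> complex) \<Rightarrow> 'k yalg \<Rightarrow> complex" where
  "chi \<mu> = (THE \<chi>. unital_alg_hom pm_scale (*) \<chi> \<and>
     (\<forall>w. length w \<ge> 2 \<longrightarrow> \<chi> (Y w) = R_transform \<mu> w))"


section \<open>Well-definedness of the notions above\<close>

subsection \<open>Linear and multiplicative extension\<close>


lemma lookup_pm_scale [simp]: "Poly_Mapping.lookup (pm_scale c p) m = c * Poly_Mapping.lookup p m"
  unfolding pm_scale_def by (simp add: Poly_Mapping.map.rep_eq when_def)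

lemma vector_space_pm_scale: "vector_space pm_scale"
  by unfold_locales (auto intro!: poly_mapping_eqI simp: lookup_add algebra_simps)

lemma pm_scale_conv_mult: "pm_scale c p = Poly_Mapping.single 0 c * p"
  unfolding pm_scale_def by (rule mult_map_scale_conv_mult)

lemma pm_scale_single: "pm_scale c (Poly_Mapping.single m d) = Poly_Mapping.single m (c * d)"
  by (rule poly_mapping_eqI) (simp add: lookup_single when_def)

lemma pm_sum_singles:
  "(\<Sum>m\<in>Poly_Mapping.keys p. Poly_Mapping.single m (Poly_Mapping.lookup p m)) = p"
proof (rule poly_mapping_eqI)
  fix k
  show "Poly_Mapping.lookup (\<Sum>m\<in>Poly_Mapping.keys p. Poly_Mapping.single m (Poly_Mapping.lookup p m)) k
      = Poly_Mapping.lookup p k"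
    by (cases "k \<in> Poly_Mapping.keys p")
      (auto simp: lookup_sum lookup_single when_def in_keys_iff sum.delta')
qed

lemma complex_algebra_complex: "complex_algebra ((*) :: complex \<Rightarrow> _)"
  by unfold_locales (simp_all add: algebra_simps)

lemma complex_algebra_pm_scale:
  "complex_algebra (pm_scale :: complex \<Rightarrow> ('m::monoid_add \<Rightarrow>\<^sub>0 complex) \<Rightarrow> _)"
proof -
  interpret vector_space "pm_scale :: complex \<Rightarrow> ('m \<Rightarrow>\<^sub>0 complex) \<Rightarrow> _"
    by (rule vector_space_pm_scale)
  have comm: "Poly_Mapping.single 0 c * p = p * Poly_Mapping.single 0 c"
    for c :: complex and p :: "'m \<Rightarrow>\<^sub>0 complex"
  proof -
    have "Poly_Mapping.single 0 c * p =
        (\<Sum>m\<in>Poly_Mapping.keys p. Poly_Mapping.single 0 c * Poly_Mapping.single m (Poly_Mapping.lookup p m))"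
      by (subst (1) pm_sum_singles[of p, symmetric], rule sum_distrib_left)
    also have "\<dots> =
        (\<Sum>m\<in>Poly_Mapping.keys p. Poly_Mapping.single m (Poly_Mapping.lookup p m) * Poly_Mapping.single 0 c)"
      by (simp add: mult_single mult.commute)
    also have "\<dots> = p * Poly_Mapping.single 0 c"
      by (subst (3) pm_sum_singles[of p, symmetric], rule sum_distrib_right[symmetric])
    finally show ?thesis .
  qed
  show ?thesis
  proof
    fix c and x y :: "'m \<Rightarrow>\<^sub>0 complex"
    show "pm_scale c x * y = pm_scale c (x * y)"
      by (simp add: pm_scale_conv_mult mult.assoc)
    show "x * pm_scale c y = pm_scale c (x * y)"
      unfolding pm_scale_conv_mult by (metis comm mult.assoc)
  qed
qed

definition lin_ext ::
  "(complex \<Rightarrow> 'b::ab_group_add \<Rightarrow> 'b) \<Rightarrow> ('m \<Rightarrow> 'b) \<Rightarrow> ('m \<Rightarrow>\<^sub>0 complex) \<Rightarrow> 'b" where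
  "lin_ext s g p = (\<Sum>m\<in>Poly_Mapping.keys p. s (Poly_Mapping.lookup p m) (g m))"

lemma linear_lin_ext:
  fixes g :: "'m \<Rightarrow> 'b::ab_group_add"
  assumes "vector_space s"
  shows "Vector_Spaces.linear pm_scale s (lin_ext s g)"
proof -
  interpret V: vector_space s by fact
  have superset: "lin_ext s g p = (\<Sum>m\<in>S. s (Poly_Mapping.lookup p m) (g m))"
    if "finite S" "Poly_Mapping.keys p \<subseteq> S" for p S
    unfolding lin_ext_def using that
    by (intro sum.mono_neutral_left) (auto simp: in_keys_iff)
  show ?thesis
    unfolding Vector_Spaces.linear_def module_hom_def module_hom_axioms_def
  proof (intro conjI allI)
    show "vector_space pm_scale" "module pm_scale"
      using vector_space_pm_scale by (auto simp: module_iff_vector_space)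
    show "vector_space s" "module s"
      using assms by (auto simp: module_iff_vector_space)
    fix p q :: "'m \<Rightarrow>\<^sub>0 complex" and c
    let ?S = "Poly_Mapping.keys p \<union> Poly_Mapping.keys q"
    have "Poly_Mapping.keys (p + q) \<subseteq> ?S" by (rule keys_add)
    then show "lin_ext s g (p + q) = lin_ext s g p + lin_ext s g q"
      by (simp add: superset[of ?S] lookup_add V.scale_left_distrib sum.distrib)
    have "Poly_Mapping.keys (pm_scale c p) \<subseteq> Poly_Mapping.keys p"
      by (auto simp: in_keys_iff)
    then show "lin_ext s g (pm_scale c p) = s c (lin_ext s g p)"
      by (simp add: superset[of "Poly_Mapping.keys p"] V.scale_sum_right)
  qed
qed

lemma lin_ext_single [simp]:
  assumes "vector_space s"
  shows "lin_ext s g (Poly_Mapping.single m c) = s c (g m)"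
proof -
  interpret V: vector_space s by fact
  show ?thesis by (cases "c = 0") (simp_all add: lin_ext_def)
qed

lemma linear_pm_eqI:
  fixes f g :: "('m \<Rightarrow>\<^sub>0 complex) \<Rightarrow> 'b::ab_group_add"
  assumes "Vector_Spaces.linear pm_scale s f" "Vector_Spaces.linear pm_scale s g"
    and eq: "\<And>m. f (Poly_Mapping.single m 1) = g (Poly_Mapping.single m 1)"
  shows "f = g"
proof
  fix p :: "'m \<Rightarrow>\<^sub>0 complex"
  interpret F: Vector_Spaces.linear pm_scale s f by fact
  interpret G: Vector_Spaces.linear pm_scale s g by fact
  have p: "p = (\<Sum>m\<in>Poly_Mapping.keys p. pm_scale (Poly_Mapping.lookup p m) (Poly_Mapping.single m 1))"
    by (simp add: pm_scale_single pm_sum_singles)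
  show "f p = g p"
    by (subst (1 2) p) (simp add: F.sum G.sum F.scale G.scale eq)
qed

lemma unital_alg_hom_lin_ext:
  fixes s :: "complex \<Rightarrow> 'b::ring_1 \<Rightarrow> 'b" and g :: "'m::monoid_add \<Rightarrow> 'b"
  assumes "complex_algebra s" and g0: "g 0 = 1" and g_add: "\<And>m n. g (m + n) = g m * g n"
  shows "unital_alg_hom pm_scale s (lin_ext s g)"
proof -
  interpret A: complex_algebra s by fact
  interpret L: Vector_Spaces.linear pm_scale s "lin_ext s g"
    by (rule linear_lin_ext) unfold_locales
  note single = lin_ext_single[OF A.vector_space_axioms, of g]
  have 1: "lin_ext s g (p * q) = lin_ext s g p * lin_ext s g q" for p q
  proof -
    have "p * q = (\<Sum>m\<in>Poly_Mapping.keys p. \<Sum>n\<in>Poly_Mapping.keys q.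
        Poly_Mapping.single (m + n) (Poly_Mapping.lookup p m * Poly_Mapping.lookup q n))"
      by (subst (1) pm_sum_singles[of p, symmetric], subst (1) pm_sum_singles[of q, symmetric])
        (simp add: sum_product mult_single)
    then have "lin_ext s g (p * q) = (\<Sum>m\<in>Poly_Mapping.keys p. \<Sum>n\<in>Poly_Mapping.keys q.
        s (Poly_Mapping.lookup p m * Poly_Mapping.lookup q n) (g m * g n))"
      by (simp add: L.sum single g_add)
    also have "\<dots> = lin_ext s g p * lin_ext s g q"
      by (simp add: lin_ext_def sum_product A.scale_mult_left A.scale_mult_right mult.commute)
    finally show ?thesis .
  qed
  have 2: "lin_ext s g 1 = 1"
    using single[of 0 1] g0 by simp
  show ?thesis
    unfolding unital_alg_hom_def using 1 2 L.linear_axioms by blast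
qed

subsection \<open>The algebra homomorphisms defined on generators\<close>

lemma single_mult_power:
  "Poly_Mapping.single (m::'m::comm_monoid_add) (1::complex) ^ n = Poly_Mapping.single (\<Sum>i<n. m) 1"
  by (induction n) (simp_all add: mult_single add.commute)

lemma single_nat_sum: "(\<Sum>i<n. Poly_Mapping.single v (1::nat)) = Poly_Mapping.single v n"
  by (induction n) (simp_all add: single_add[symmetric])

lemma pm_sum_singles_nat:
  "(\<Sum>v\<in>Poly_Mapping.keys m. Poly_Mapping.single v (Poly_Mapping.lookup m v)) = (m :: 'v \<Rightarrow>\<^sub>0 nat)"
proof (rule poly_mapping_eqI)
  fix k
  show "Poly_Mapping.lookup (\<Sum>v\<in>Poly_Mapping.keys m. Poly_Mapping.single v (Poly_Mapping.lookup m v)) k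
      = Poly_Mapping.lookup m k"
    by (cases "k \<in> Poly_Mapping.keys m")
      (auto simp: lookup_sum lookup_single when_def in_keys_iff sum.delta')
qed

lemma single_sum_prod:
  "finite S \<Longrightarrow> Poly_Mapping.single (\<Sum>v\<in>S. h v :: 'm::comm_monoid_add) (1::complex) =
    (\<Prod>v\<in>S. Poly_Mapping.single (h v) 1)"
proof (induction S rule: finite_induct)
  case (insert x F)
  have "Poly_Mapping.single (h x + sum h F) (1::complex) =
      Poly_Mapping.single (h x) 1 * Poly_Mapping.single (sum h F) 1"
    by (simp add: mult_single)
  with insert show ?case by simp
qed simp

lemma ymonomial:
  "Poly_Mapping.single m (1::complex) =
    (\<Prod>v\<in>Poly_Mapping.keys m. Poly_Mapping.single (Poly_Mapping.single v 1) 1 ^ Poly_Mapping.lookup m v)"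
proof -
  have "Poly_Mapping.single m (1::complex) =
      Poly_Mapping.single (\<Sum>v\<in>Poly_Mapping.keys m. Poly_Mapping.single v (Poly_Mapping.lookup m v)) 1"
    by (simp add: pm_sum_singles_nat)
  also have "\<dots> = (\<Prod>v\<in>Poly_Mapping.keys m. Poly_Mapping.single (Poly_Mapping.single v (Poly_Mapping.lookup m v)) 1)"
    by (simp add: single_sum_prod)
  finally show ?thesis by (simp only: single_mult_power single_nat_sum)
qed

lemma Y_Rep: "Y (Rep_word2 v) = Poly_Mapping.single (Poly_Mapping.single v 1) 1"
  using Rep_word2[of v] by (simp add: Y_def Rep_word2_inverse)

lemma ex1_unital_alg_hom_Y:
  fixes s :: "complex \<Rightarrow> 'b::comm_ring_1 \<Rightarrow> 'b" and g :: "'k list \<Rightarrow> 'b"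
  assumes "complex_algebra s"
  shows "\<exists>!f. unital_alg_hom pm_scale s f \<and> (\<forall>w. length w \<ge> 2 \<longrightarrow> f (Y w) = g w)"
proof -
  interpret A: complex_algebra s by fact
  define h :: "'k ymon \<Rightarrow> 'b" where
    "h m = (\<Prod>v\<in>Poly_Mapping.keys m. g (Rep_word2 v) ^ Poly_Mapping.lookup m v)" for m
  have superset: "h m = (\<Prod>v\<in>S. g (Rep_word2 v) ^ Poly_Mapping.lookup m v)"
    if "finite S" "Poly_Mapping.keys m \<subseteq> S" for m S
    unfolding h_def using that by (intro prod.mono_neutral_left) (auto simp: in_keys_iff)
  have h_add: "h (m + n) = h m * h n" for m n
  proof -
    have "Poly_Mapping.keys (m + n) \<subseteq> Poly_Mapping.keys m \<union> Poly_Mapping.keys n" by (rule keys_add)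
    then show ?thesis
      by (simp add: superset[of "Poly_Mapping.keys m \<union> Poly_Mapping.keys n"]
          lookup_add power_add prod.distrib)
  qed
  let ?f = "lin_ext s h"
  show ?thesis
  proof (rule ex1I[of _ ?f], intro conjI allI impI)
    show "unital_alg_hom pm_scale s ?f"
      by (rule unital_alg_hom_lin_ext[OF assms _ h_add]) (simp add: h_def)
    fix w :: "'k list" assume "length w \<ge> 2"
    then show "?f (Y w) = g w"
      by (simp add: Y_def lin_ext_single[OF A.vector_space_axioms] h_def Abs_word2_inverse)
  next
    fix f
    assume f: "unital_alg_hom pm_scale s f \<and> (\<forall>w. length w \<ge> 2 \<longrightarrow> f (Y w) = g w)"
    have f1: "f 1 = 1" and fm: "\<And>x y. f (x * y) = f x * f y"
      using f by (auto simp: unital_alg_hom_def)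
    have pow: "f (x ^ n) = f x ^ n" for x n
      by (induction n) (simp_all add: f1 fm)
    have prod: "finite S \<Longrightarrow> f (\<Prod>v\<in>S. k v) = (\<Prod>v\<in>S. f (k v))" for S and k :: "'k word2 \<Rightarrow> _"
      by (induction S rule: finite_induct) (simp_all add: f1 fm)
    have var: "f (Poly_Mapping.single (Poly_Mapping.single v 1) 1) = g (Rep_word2 v)" for v
      using f Rep_word2[of v] by (simp add: Y_Rep[symmetric] del: One_nat_def)
    show "f = ?f"
    proof (rule linear_pm_eqI)
      show "Vector_Spaces.linear pm_scale s f" using f by (simp add: unital_alg_hom_def)
      show "Vector_Spaces.linear pm_scale s ?f" by (rule linear_lin_ext) unfold_locales
      fix m
      have "f (Poly_Mapping.single m 1) = h m"
        by (subst ymonomial) (simp only: prod finite_keys pow var h_def)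
      then show "f (Poly_Mapping.single m 1) = ?f (Poly_Mapping.single m 1)"
        by (simp add: lin_ext_single[OF A.vector_space_axioms])
    qed
  qed
qed

lemma comult_hom: "unital_alg_hom pm_scale pm_scale comult"
  and comult_Y: "length w \<ge> 2 \<Longrightarrow>
    comult (Y w) = (\<Sum>\<pi>\<in>NC (length w). Y_part w \<pi> \<otimes>\<^sub>Y Y_part w (kreweras (length w) \<pi>))"
  using theI'[OF ex1_unital_alg_hom_Y[OF complex_algebra_pm_scale,
        of "\<lambda>w. \<Sum>\<pi>\<in>NC (length w). Y_part w \<pi> \<otimes>\<^sub>Y Y_part w (kreweras (length w) \<pi>)"]]
  unfolding comult_def by auto

lemma counit_hom: "unital_alg_hom pm_scale (*) counit"
  and counit_Y: "length w \<ge> 2 \<Longrightarrow> counit (Y w) = 0"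
  using theI'[OF ex1_unital_alg_hom_Y[OF complex_algebra_complex, of "\<lambda>_. 0"]]
  unfolding counit_def by auto

lemma chi_hom: "unital_alg_hom pm_scale (*) (chi \<mu>)"
  and chi_Y: "length w \<ge> 2 \<Longrightarrow> chi \<mu> (Y w) = R_transform \<mu> w"
  using theI'[OF ex1_unital_alg_hom_Y[OF complex_algebra_complex, of "R_transform \<mu>"]]
  unfolding chi_def by auto

subsection \<open>Universal properties of the tensor square\<close>

lemma tensor_functional_conv: 
  "tensor_functional \<xi> \<eta> =
    lin_ext (*) (\<lambda>(m, n). \<xi> (Poly_Mapping.single m 1) * \<eta> (Poly_Mapping.single n 1))"
  by (rule ext, unfold tensor_functional_def lin_ext_def) (auto intro!: sum.cong)

lemma linear_tensor_functional: "Vector_Spaces.linear pm_scale (*) (tensor_functional \<xi> \<eta>)"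
  unfolding tensor_functional_conv
  by (rule linear_lin_ext) (use complex_algebra_complex in \<open>simp add: complex_algebra_def\<close>)

lemma lookup_tensor:
  "Poly_Mapping.lookup (p \<otimes>\<^sub>Y q) (m, n) = Poly_Mapping.lookup p m * Poly_Mapping.lookup q n"
proof -
  have "Poly_Mapping.lookup (p \<otimes>\<^sub>Y q) (m, n) =
     (\<Sum>m'\<in>Poly_Mapping.keys p. \<Sum>n'\<in>Poly_Mapping.keys q.
       if m' = m then if n' = n then Poly_Mapping.lookup p m' * Poly_Mapping.lookup q n' else 0 else 0)"
    unfolding tensor_def lookup_sum by (intro sum.cong refl) (auto simp: lookup_single when_def)
  also have "\<dots> = (\<Sum>m'\<in>Poly_Mapping.keys p. if m' = m then \<Sum>n'\<in>Poly_Mapping.keys q.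
       if n' = n then Poly_Mapping.lookup p m' * Poly_Mapping.lookup q n' else 0 else 0)"
    by (intro sum.cong) auto
  finally show ?thesis by (auto simp: in_keys_iff)
qed

lemma tensor_functional_tensor:
  assumes "Vector_Spaces.linear pm_scale (*) \<xi>" "Vector_Spaces.linear pm_scale (*) \<eta>"
  shows "tensor_functional \<xi> \<eta> (p \<otimes>\<^sub>Y q) = \<xi> p * \<eta> q"
proof -
  interpret X: Vector_Spaces.linear pm_scale "(*)" \<xi> by fact
  interpret H: Vector_Spaces.linear pm_scale "(*)" \<eta> by fact
  interpret T: Vector_Spaces.linear pm_scale "(*)" "tensor_functional \<xi> \<eta>"
    by (rule linear_tensor_functional)
  have exp: "f p = (\<Sum>m\<in>Poly_Mapping.keys p. Poly_Mapping.lookup p m * f (Poly_Mapping.single m 1))"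
    if "Vector_Spaces.linear pm_scale (*) f" for f :: "'a yalg \<Rightarrow> complex" and p
  proof -
    interpret F: Vector_Spaces.linear pm_scale "(*)" f by fact
    show ?thesis
      by (subst (1) pm_sum_singles[of p, symmetric])
        (simp add: F.sum F.scale[symmetric] pm_scale_single)
  qed
  have "tensor_functional \<xi> \<eta> (p \<otimes>\<^sub>Y q) = (\<Sum>m\<in>Poly_Mapping.keys p. \<Sum>n\<in>Poly_Mapping.keys q.
      (Poly_Mapping.lookup p m * Poly_Mapping.lookup q n) *
      (\<xi> (Poly_Mapping.single m 1) * \<eta> (Poly_Mapping.single n 1)))"
    unfolding tensor_def T.sum
    by (simp add: tensor_functional_conv lin_ext_single[OF complex_algebra.axioms(1)[OF complex_algebra_complex]])
  also have "\<dots> = \<xi> p * \<eta> q"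
    by (subst exp[OF assms(1), of p], subst exp[OF assms(2), of q])
      (unfold sum_product, intro sum.cong refl, simp only: mult_ac)
  finally show ?thesis .
qed

lemma tensor_single:
  "Poly_Mapping.single m a \<otimes>\<^sub>Y Poly_Mapping.single n b = Poly_Mapping.single (m, n) (a * b)"
  by (rule poly_mapping_eqI, case_tac k) (auto simp: lookup_tensor lookup_single when_def)

lemma tensor_sum_left: "sum f A \<otimes>\<^sub>Y q = (\<Sum>i\<in>A. f i \<otimes>\<^sub>Y q)"
  by (rule poly_mapping_eqI, case_tac k) (simp add: lookup_tensor lookup_sum sum_distrib_right)

lemma tensor_sum_right: "p \<otimes>\<^sub>Y sum f A = (\<Sum>i\<in>A. p \<otimes>\<^sub>Y f i)"
  by (rule poly_mapping_eqI, case_tac k) (simp add: lookup_tensor lookup_sum sum_distrib_left)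

lemma tensor_mult: "(p \<otimes>\<^sub>Y q) * (p' \<otimes>\<^sub>Y q') = (p * p') \<otimes>\<^sub>Y (q * q')"
proof -
  have base: "(Poly_Mapping.single m a \<otimes>\<^sub>Y Poly_Mapping.single n b) *
      (Poly_Mapping.single m' a' \<otimes>\<^sub>Y Poly_Mapping.single n' b') =
      (Poly_Mapping.single m a * Poly_Mapping.single m' a') \<otimes>\<^sub>Y
      (Poly_Mapping.single n b * Poly_Mapping.single n' b')" for m n m' n' :: "'a ymon" and a b a' b'
    by (simp add: tensor_single mult_single mult_ac)
  have 1: "(Poly_Mapping.single m a \<otimes>\<^sub>Y Poly_Mapping.single n b) *
      (Poly_Mapping.single m' a' \<otimes>\<^sub>Y q') =
      (Poly_Mapping.single m a * Poly_Mapping.single m' a') \<otimes>\<^sub>Y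
      (Poly_Mapping.single n b * q')" for m n m' :: "'a ymon" and a b a'
    by (subst (1 2) pm_sum_singles[of q', symmetric])
      (simp only: tensor_sum_right sum_distrib_left base)
  have 2: "(Poly_Mapping.single m a \<otimes>\<^sub>Y Poly_Mapping.single n b) * (p' \<otimes>\<^sub>Y q') =
      (Poly_Mapping.single m a * p') \<otimes>\<^sub>Y (Poly_Mapping.single n b * q')" for m n :: "'a ymon" and a b
    by (subst (1 2) pm_sum_singles[of p', symmetric])
      (simp only: tensor_sum_left sum_distrib_left 1)
  have 3: "(Poly_Mapping.single m a \<otimes>\<^sub>Y q) * (p' \<otimes>\<^sub>Y q') =
      (Poly_Mapping.single m a * p') \<otimes>\<^sub>Y (q * q')" for m :: "'a ymon" and a
    by (subst (1 2) pm_sum_singles[of q, symmetric])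
      (simp only: tensor_sum_right sum_distrib_right 2)
  show ?thesis
    by (subst (1 2) pm_sum_singles[of p, symmetric])
      (simp only: tensor_sum_left sum_distrib_right 3)
qed

subsection \<open>Free multiplicative convolution\<close>

definition nc_eval :: "(complex \<Rightarrow> 'a::ring_1 \<Rightarrow> 'a) \<Rightarrow> ('k \<Rightarrow> 'a) \<Rightarrow> 'k ncpoly \<Rightarrow> 'a" where
  "nc_eval s a = lin_ext s (\<lambda>w. prod_list (map a w))"

lemma ncmon_single: "ncmon w = Poly_Mapping.single w 1"
  by (induction w) (simp_all add: ncmon_def ncX_def mult_single plus_list_def zero_list_def
      flip: single_one)

lemma unital_alg_hom_nc_eval:
  assumes "complex_algebra s" shows "unital_alg_hom pm_scale s (nc_eval s a)"
  unfolding nc_eval_def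
  by (rule unital_alg_hom_lin_ext[OF assms]) (simp_all add: zero_list_def plus_list_def)

lemma nc_eval_ncX:
  assumes "complex_algebra s" shows "nc_eval s a (ncX i) = a i"
proof -
  interpret complex_algebra s by fact
  show ?thesis by (simp add: nc_eval_def ncX_def lin_ext_single[OF vector_space_axioms])
qed

lemma unital_alg_hom_prod_list:
  "unital_alg_hom s1 s2 f \<Longrightarrow> f (prod_list xs) = prod_list (map f xs)"
  by (induction xs) (auto simp: unital_alg_hom_def)

lemma unital_alg_hom_hull:
  assumes f: "unital_alg_hom s1 s2 f" and x: "x \<in> unital_subalgebra s1 hull S"
  shows "f x \<in> unital_subalgebra s2 hull (f ` S)"
proof -
  interpret L: Vector_Spaces.linear s1 s2 f using f by (simp add: unital_alg_hom_def)
  have "f x \<in> B" if B: "unital_subalgebra s2 B" "f ` S \<subseteq> B" for B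
  proof -
    have "unital_subalgebra s1 (f -` B)"
      using B(1) f unfolding unital_subalgebra_def unital_alg_hom_def
      by (auto intro!: L.subspace_vimage)
    then have "unital_subalgebra s1 hull S \<subseteq> f -` B"
      using B(2) by (intro hull_minimal) auto
    with x show ?thesis by auto
  qed
  then show ?thesis by (auto simp: hull_def)
qed

lemma unital_alg_hom_linear: "unital_alg_hom s1 s2 f \<Longrightarrow> Vector_Spaces.linear s1 s2 f"
  by (simp add: unital_alg_hom_def)

lemma hull_subset_range_nc_eval:
  assumes "complex_algebra s" and x: "x \<in> unital_subalgebra s hull (range a)"
  obtains p where "x = nc_eval s a p"
proof -
  have hom: "unital_alg_hom pm_scale s (nc_eval s a)" by (rule unital_alg_hom_nc_eval) fact
  interpret L: Vector_Spaces.linear pm_scale s "nc_eval s a"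
    by (rule unital_alg_hom_linear) fact
  have "unital_subalgebra s (range (nc_eval s a))"
    unfolding unital_subalgebra_def
  proof (intro conjI ballI)
    show "L.vs2.subspace (range (nc_eval s a))" using L.subspace_image[OF L.vs1.subspace_UNIV] .
    show "1 \<in> range (nc_eval s a)"
      using hom by (metis rangeI unital_alg_hom_def)
    show "x * y \<in> range (nc_eval s a)" if "x \<in> range (nc_eval s a)" "y \<in> range (nc_eval s a)" for x y
      using hom that by (auto simp: unital_alg_hom_def) (metis rangeI)
  qed
  moreover have "range a \<subseteq> range (nc_eval s a)"
    using nc_eval_ncX[OF assms(1), of a] by (metis image_subsetI rangeI)
  ultimately have "unital_subalgebra s hull (range a) \<subseteq> range (nc_eval s a)"
    by (intro hull_minimal)
  with x that show ?thesis by auto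
qed

lemma has_distribution_nc_eval:
  assumes "complex_algebra s" "Vector_Spaces.linear s (*) \<phi>" "has_distribution \<phi> a \<mu>"
  shows "\<phi> (nc_eval s a p) = \<mu> p"
proof -
  interpret A: complex_algebra s by fact
  have "Vector_Spaces.linear pm_scale (*) (\<phi> \<circ> nc_eval s a)"
    using unital_alg_hom_linear[OF unital_alg_hom_nc_eval[OF assms(1)]] assms(2)
    by (rule Vector_Spaces.linear_compose)
  moreover have "(\<phi> \<circ> nc_eval s a) (Poly_Mapping.single w 1) = \<mu> (Poly_Mapping.single w 1)" for w
    using assms(3) by (simp add: has_distribution_def ncmon_single nc_eval_def
        lin_ext_single[OF A.vector_space_axioms])
  ultimately have "\<phi> \<circ> nc_eval s a = \<mu>"
    using assms(3) by (intro linear_pm_eqI) (auto simp: has_distribution_def)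
  then show ?thesis by (auto simp: fun_eq_iff)
qed

lemma freely_independent_subalgebras_list:
  assumes "freely_independent_subalgebras \<phi> A1 A2" "ps \<noteq> []" "distinct_adj (map fst ps)"
    and "\<And>b c. (b, c) \<in> set ps \<Longrightarrow> c \<in> (if b then A1 else A2) \<and> \<phi> c = 0"
  shows "\<phi> (prod_list (map snd ps)) = 0"
proof -
  have "\<phi> (prod_list (map (\<lambda>j. snd (ps ! j)) [0..<length ps])) = 0"
    using assms(1)[unfolded freely_independent_subalgebras_def, rule_format,
        of "length ps" "\<lambda>j. snd (ps ! j)" "\<lambda>j. fst (ps ! j)"]
      assms(2-4) by (auto simp: distinct_adj_conv_nth Suc_le_eq) (metis nth_mem prod.collapse)
  also have "map (\<lambda>j. snd (ps ! j)) [0..<length ps] = map snd ps"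
    by (rule nth_equalityI) auto
  finally show ?thesis .
qed

lemma free_joint_moments_unique:
  fixes s :: "complex \<Rightarrow> 'a::ring_1 \<Rightarrow> 'a"
  assumes "nc_prob_space s \<phi>" "nc_prob_space s \<psi>"
    and sub: "unital_subalgebra s A1" "unital_subalgebra s A2"
    and free: "freely_independent_subalgebras \<phi> A1 A2" "freely_independent_subalgebras \<psi> A1 A2"
    and eq: "\<And>x. x \<in> A1 \<union> A2 \<Longrightarrow> \<phi> x = \<psi> x"
    and ps: "\<And>b c. (b, c) \<in> set ps \<Longrightarrow> c \<in> (if b then A1 else A2)"
  shows "\<phi> (prod_list (map snd ps)) = \<psi> (prod_list (map snd ps))"
  using ps
proof (induction "length ps" arbitrary: ps rule: less_induct)
  case less
  interpret P: nc_prob_space s \<phi> by fact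
  interpret Q: nc_prob_space s \<psi> by fact
  interpret PL: Vector_Spaces.linear s "(*)" \<phi> by (rule P.linear_phi)
  interpret QL: Vector_Spaces.linear s "(*)" \<psi> by (rule Q.linear_phi)
  define A where "A b = (if b then A1 else A2)" for b :: bool
  have A: "P.subspace (A b)" "1 \<in> A b" "x \<in> A b \<Longrightarrow> y \<in> A b \<Longrightarrow> x * y \<in> A b" for b x y
    using sub by (auto simp: A_def unital_subalgebra_def)
  have eqA: "x \<in> A b \<Longrightarrow> \<psi> x = \<phi> x" for x b
    using eq[of x] by (auto simp: A_def split: if_splits)
  have IH: "\<phi> (prod_list (map snd qs)) = \<psi> (prod_list (map snd qs))"
    if "length qs < length ps" "\<And>b c. (b, c) \<in> set qs \<Longrightarrow> c \<in> A b" for qs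
    using less.hyps[OF that(1)] that(2) by (simp add: A_def)
  have ps: "(b, c) \<in> set ps \<Longrightarrow> c \<in> A b" for b c
    using less.prems by (simp add: A_def)
  show ?case
  proof (cases "distinct_adj (map fst ps)")
    case False
    then obtain j where j: "Suc j < length ps" "fst (ps ! j) = fst (ps ! Suc j)"
      by (auto simp: distinct_adj_conv_nth)
    obtain b x y where xy: "ps ! j = (b, x)" "ps ! Suc j = (b, y)"
      using j(2) by (cases "ps ! j", cases "ps ! Suc j") auto
    define us where "us = take j ps"
    define vs where "vs = drop (Suc (Suc j)) ps"
    have ps_eq: "ps = us @ (b, x) # (b, y) # vs"
      using j(1) unfolding us_def vs_def xy[symmetric]
      by (metis Cons_nth_drop_Suc Suc_lessD append_take_drop_id)
    have "\<phi> (prod_list (map snd (us @ (b, x * y) # vs))) = \<psi> (prod_list (map snd (us @ (b, x * y) # vs)))"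
    proof (rule IH)
      show "length (us @ (b, x * y) # vs) < length ps" by (simp add: ps_eq)
      have "x * y \<in> A b" using ps by (intro A) (auto simp: ps_eq)
      then show "c \<in> A b'" if "(b', c) \<in> set (us @ (b, x * y) # vs)" for b' c
        using that ps by (auto simp: ps_eq)
    qed
    then show ?thesis by (simp add: ps_eq mult.assoc)
  next
    case True
    have "\<phi> (prod_list (map snd (us @ vs))) = \<psi> (prod_list (map snd (us @ vs)))"
      if "length (us @ vs) = length ps" "distinct_adj (map fst (us @ vs))"
        "\<And>b c. (b, c) \<in> set (us @ vs) \<Longrightarrow> c \<in> A b" "\<And>b c. (b, c) \<in> set us \<Longrightarrow> \<phi> c = 0" for us vs
      using that
    proof (induction vs arbitrary: us)
      case Nil
      show ?case
      proof (cases "us = []")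
        case True
        then show ?thesis by (simp add: P.phi_one Q.phi_one)
      next
        case False
        have "\<phi> (prod_list (map snd us)) = 0"
          using Nil by (intro freely_independent_subalgebras_list[OF free(1) False]) (auto simp: A_def)
        moreover have "\<psi> (prod_list (map snd us)) = 0"
          using Nil eqA by (intro freely_independent_subalgebras_list[OF free(2) False]) (fastforce simp: A_def)+
        ultimately show ?thesis by simp
      qed
    next
      case (Cons p vs)
      obtain b x where p: "p = (b, x)" by force
      define x' where "x' = x - s (\<phi> x) 1"
      have x: "x \<in> A b" using Cons.prems(3) by (simp add: p)
      have x': "x' \<in> A b"
        unfolding x'_def by (intro P.subspace_diff P.subspace_scale A x)
      have \<phi>x': "\<phi> x' = 0"
        unfolding x'_def by (simp add: PL.diff PL.scale P.phi_one)
      have split: "prod_list (map snd (us @ p # vs)) =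
          prod_list (map snd ((us @ [(b, x')]) @ vs)) + s (\<phi> x) (prod_list (map snd (us @ vs)))"
      proof -
        have "x = x' + s (\<phi> x) 1" by (simp add: x'_def)
        then have "prod_list (map snd (us @ p # vs)) =
            prod_list (map snd us) * (x' + s (\<phi> x) 1) * prod_list (map snd vs)"
          by (simp add: p mult.assoc)
        then show ?thesis
          by (simp add: algebra_simps P.scale_mult_left P.scale_mult_right)
      qed
      have 1: "\<phi> (prod_list (map snd ((us @ [(b, x')]) @ vs))) =
          \<psi> (prod_list (map snd ((us @ [(b, x')]) @ vs)))"
        using Cons.prems x' \<phi>x' by (intro Cons.IH) (auto simp: p)
      have 2: "\<phi> (prod_list (map snd (us @ vs))) = \<psi> (prod_list (map snd (us @ vs)))"
        using Cons.prems by (intro IH) auto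
      show ?case
        unfolding split PL.add QL.add PL.scale QL.scale 1 2 ..
    qed
    from this[of "[]" ps] True ps show ?thesis by simp
  qed
qed

lemma unital_subalgebra_hull:
  assumes "vector_space s" shows "unital_subalgebra s (unital_subalgebra s hull S)"
proof -
  interpret vector_space s by fact
  show ?thesis
    by (rule hull_in) (auto simp: unital_subalgebra_def intro!: subspace_Inter)
qed

lemma free_product_distribution_pullback:
  fixes a b :: "'k \<Rightarrow> 'a::ring_1"
  assumes "free_product_distribution s \<phi> a b \<mu> \<nu> \<sigma>"
  shows "free_product_distribution pm_scale (\<phi> \<circ> nc_eval s (case_sum a b))
    (\<lambda>i. ncX (Inl i)) (\<lambda>i. ncX (Inr i)) \<mu> \<nu> \<sigma>"
proof -
  interpret N: nc_prob_space s \<phi> using assms by (simp add: free_product_distribution_def)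
  define e where "e = nc_eval s (case_sum a b)"
  have hom: "unital_alg_hom pm_scale s e"
    unfolding e_def by (rule unital_alg_hom_nc_eval) unfold_locales
  have lin: "Vector_Spaces.linear pm_scale (*) (\<phi> \<circ> e)"
    using unital_alg_hom_linear[OF hom] N.linear_phi by (rule Vector_Spaces.linear_compose)
  have X: "e (ncX (Inl i)) = a i" "e (ncX (Inr i)) = b i" for i
    unfolding e_def by (simp_all add: nc_eval_ncX[OF N.complex_algebra_axioms])
  have mult: "e (x * y) = e x * e y" for x y using hom by (simp add: unital_alg_hom_def)
  note prod = unital_alg_hom_prod_list[OF hom]
  have fr: "freely_independent_subalgebras \<phi> (unital_subalgebra s hull range a)
      (unital_subalgebra s hull range b)"
    using assms by (simp add: free_product_distribution_def freely_independent_def)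
  have free: "freely_independent_subalgebras (\<phi> \<circ> e)
      (unital_subalgebra pm_scale hull range (\<lambda>i. ncX (Inl i)))
      (unital_subalgebra pm_scale hull range (\<lambda>i. ncX (Inr i)))"
    unfolding freely_independent_subalgebras_def
  proof (intro allI impI)
    fix n :: nat and c :: "nat \<Rightarrow> ('k + 'k) ncpoly" and i :: "nat \<Rightarrow> bool"
    assume n: "1 \<le> n" and c: "\<forall>j<n. c j \<in> (if i j then unital_subalgebra pm_scale hull range (\<lambda>i. ncX (Inl i))
        else unital_subalgebra pm_scale hull range (\<lambda>i. ncX (Inr i))) \<and> (\<phi> \<circ> e) (c j) = 0"
      and i: "\<forall>j. Suc j < n \<longrightarrow> i j \<noteq> i (Suc j)"
    have "e ` range (\<lambda>i. ncX (Inl i)) = range a" "e ` range (\<lambda>i. ncX (Inr i)) = range b"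
      by (simp_all add: image_image X)
    then have "\<forall>j<n. e (c j) \<in> (if i j then unital_subalgebra s hull range a
        else unital_subalgebra s hull range b) \<and> \<phi> (e (c j)) = 0"
      using c unital_alg_hom_hull[OF hom] by (metis (no_types, lifting) comp_apply)
    then have "\<phi> (prod_list (map (\<lambda>j. e (c j)) [0..<n])) = 0"
      using fr[unfolded freely_independent_subalgebras_def, rule_format, of n "\<lambda>j. e (c j)" i] n i
      by simp
    then show "(\<phi> \<circ> e) (prod_list (map c [0..<n])) = 0"
      by (simp add: prod comp_def)
  qed
  have "nc_prob_space pm_scale (\<phi> \<circ> e)"
    unfolding nc_prob_space_def nc_prob_space_axioms_def
    using lin hom by (simp add: complex_algebra_pm_scale unital_alg_hom_def N.phi_one)
  with free show ?thesis
    using assms unfolding free_product_distribution_def freely_independent_def e_def[symmetric]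
      has_distribution_def
    by (simp add: prod comp_def X mult)
qed

lemma free_product_distribution_unique:
  assumes 1: "free_product_distribution s \<phi> a b \<mu> \<nu> \<sigma>"
    and 2: "free_product_distribution s' \<phi>' a' b' \<mu> \<nu> \<sigma>'"
  shows "\<sigma> = \<sigma>'"
proof -
  define X1 X2 :: "'b \<Rightarrow> ('b + 'b) ncpoly" where "X1 i = ncX (Inl i)" and "X2 i = ncX (Inr i)" for i
  define \<Phi> where "\<Phi> = \<phi> \<circ> nc_eval s (case_sum a b)"
  define \<Phi>' where "\<Phi>' = \<phi>' \<circ> nc_eval s' (case_sum a' b')"
  define H1 H2 where "H1 = unital_subalgebra pm_scale hull (range X1)"
    and "H2 = unital_subalgebra pm_scale hull (range X2)"
  have F: "free_product_distribution pm_scale \<Phi> X1 X2 \<mu> \<nu> \<sigma>"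
    using free_product_distribution_pullback[OF 1] by (simp add: \<Phi>_def X1_def[abs_def] X2_def[abs_def])
  have F': "free_product_distribution pm_scale \<Phi>' X1 X2 \<mu> \<nu> \<sigma>'"
    using free_product_distribution_pullback[OF 2] by (simp add: \<Phi>'_def X1_def[abs_def] X2_def[abs_def])
  interpret N: nc_prob_space pm_scale \<Phi> using F by (simp add: free_product_distribution_def)
  interpret N': nc_prob_space pm_scale \<Phi>' using F' by (simp add: free_product_distribution_def)
  have eq: "\<Phi> x = \<Phi>' x" if "x \<in> H1 \<union> H2" for x
    using that
  proof
    assume "x \<in> H1"
    then obtain p where "x = nc_eval pm_scale X1 p"
      unfolding H1_def by (rule hull_subset_range_nc_eval[OF complex_algebra_pm_scale])
    then show ?thesis
      using F F' has_distribution_nc_eval[OF complex_algebra_pm_scale N.linear_phi, of X1 \<mu> p]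
        has_distribution_nc_eval[OF complex_algebra_pm_scale N'.linear_phi, of X1 \<mu> p]
      by (simp add: free_product_distribution_def)
  next
    assume "x \<in> H2"
    then obtain p where "x = nc_eval pm_scale X2 p"
      unfolding H2_def by (rule hull_subset_range_nc_eval[OF complex_algebra_pm_scale])
    then show ?thesis
      using F F' has_distribution_nc_eval[OF complex_algebra_pm_scale N.linear_phi, of X2 \<nu> p]
        has_distribution_nc_eval[OF complex_algebra_pm_scale N'.linear_phi, of X2 \<nu> p]
      by (simp add: free_product_distribution_def)
  qed
  have moments: "\<sigma> (ncmon w) = \<sigma>' (ncmon w)" for w
  proof -
    define ps where "ps = concat (map (\<lambda>i. [(True, X1 i), (False, X2 i)]) w)"
    have prod: "prod_list (map (\<lambda>i. X1 i * X2 i) w) = prod_list (map snd ps)"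
      unfolding ps_def by (induction w) (simp_all add: mult.assoc)
    have "X1 i \<in> H1" "X2 i \<in> H2" for i
      unfolding H1_def H2_def by (meson hull_subset rangeI subsetD)+
    then have ps: "c \<in> (if b then H1 else H2)" if "(b, c) \<in> set ps" for b c
      using that by (auto simp: ps_def)
    have "\<Phi> (prod_list (map snd ps)) = \<Phi>' (prod_list (map snd ps))"
    proof (rule free_joint_moments_unique[OF N.nc_prob_space_axioms N'.nc_prob_space_axioms])
      show "unital_subalgebra pm_scale H1" "unital_subalgebra pm_scale H2"
        unfolding H1_def H2_def by (rule unital_subalgebra_hull[OF vector_space_pm_scale])+
      show "freely_independent_subalgebras \<Phi> H1 H2" "freely_independent_subalgebras \<Phi>' H1 H2"
        using F F' unfolding H1_def H2_def
        by (simp_all add: free_product_distribution_def freely_independent_def)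
    qed (fact eq ps)+
    then show ?thesis
      using F F' by (simp add: free_product_distribution_def has_distribution_def prod)
  qed
  show ?thesis
    using F F' moments
    by (intro linear_pm_eqI)
      (auto simp: free_product_distribution_def has_distribution_def ncmon_single)
qed

text \<open>
  Well-definedness: in any probability space, the products of free tuples have the distribution
  given by \<open>\<boxtimes>\<close>.
\<close>

lemma free_mult_conv_eqI:
  assumes "free_product_distribution s \<phi> a b \<mu> \<nu> \<sigma>"
  shows "\<mu> \<boxtimes> \<nu> = \<sigma>"
  unfolding free_mult_conv_def
proof (rule the_equality)
  show "\<exists>\<phi> a b. free_product_distribution pm_scale (\<phi> :: ('b + 'b) ncpoly \<Rightarrow> complex) a b \<mu> \<nu> \<sigma>"
    using free_product_distribution_pullback[OF assms] by blast
  show "\<sigma>' = \<sigma>"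
    if "\<exists>\<phi> a b. free_product_distribution pm_scale (\<phi> :: ('b + 'b) ncpoly \<Rightarrow> complex) a b \<mu> \<nu> \<sigma>'" for \<sigma>'
    using that free_product_distribution_unique[OF _ assms] by blast
qed

end

theory Submission
  imports Defs
begin

text \<open>
  A character is determined by its values on the generators \<open>Y w\<close>, which are arbitrary, and a
  distribution is determined by its free cumulants, which are arbitrary because the
  moment-cumulant formula is triangular.  So \<open>chi\<close> is bijective.  Evaluated on generators, the
  convolution of two characters with values \<open>f\<close> and \<open>g\<close> is the sum of \<open>f\<^sub>\<pi> g\<^sub>K\<^sub>(\<^sub>\<pi>\<^sub>)\<close> over the
  non-crossing partitions \<open>\<pi>\<close>, written \<open>boxed f g\<close>.  It remains to see that the cumulants of
  \<open>\<mu> \<boxtimes> \<nu>\<close> are \<open>boxed (R_transform \<mu>) (R_transform \<nu>)\<close>, and that \<open>\<boxtimes>\<close> satisfies the group laws.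

  Free tuples with prescribed cumulants are realised on the full Fock space: the letter \<open>x\<close> either
  creates \<open>x\<close> in front of a word, or removes an initial segment \<open>v\<close> of it at the price
  \<open>\<kappa> (x v)\<close>.  If mixed cumulants vanish, an operator of one colour only sees the initial segment of
  its own colour, whence freeness (\<open>fock_free\<close>).  Following the creation and annihilation of letters
  shows that the series of the vacuum moments satisfies \<open>M = 1 + \<kappa>(z M)\<close>, where \<open>z M\<close> means that
  each \<open>z\<^sub>x\<close> is replaced by \<open>z\<^sub>x M\<close>.  This equation has only one solution, the series of the sums of products
  of \<open>\<kappa>\<close> over the non-crossing partitions; so the cumulants are as prescribed (\<open>fock_moment\<close>).

  For the product formula, let \<open>A\<close> be the moment series of the products \<open>a\<^sub>i b\<^sub>i\<close>, and let \<open>P\<^sub>i\<close> and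
  \<open>Q\<^sub>j\<close> collect the moments of the words \<open>b\<^sub>i (a b) (a b) \<dots>\<close> and \<open>\<dots> (a b) (a b) a\<^sub>j\<close>.  Sorting
  non-crossing partitions by the block of the first or last letter gives
  \<open>P\<^sub>i = z\<^sub>i g\<^sub>i(Q) A\<close>, \<open>Q\<^sub>j = A f\<^sub>j(P) z\<^sub>j\<close> and \<open>A = 1 + f(P)\<close>, with \<open>g\<^sub>i\<close> and \<open>f\<^sub>j\<close> obtained from \<open>g\<close>
  and \<open>f\<close> by removing a first letter \<open>i\<close> and a last letter \<open>j\<close>.  The sums over pairs
  \<open>(\<pi>, K(\<pi>))\<close> satisfy the same equations without \<open>A\<close>: \<open>p\<^sub>i = z\<^sub>i g\<^sub>i(q)\<close>, \<open>q\<^sub>j = f\<^sub>j(p) z\<^sub>j\<close> and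
  \<open>boxed f g = f(p) = g(q)\<close>.  Substituting \<open>z\<^sub>i A\<close> for \<open>z\<^sub>i\<close> turns the second system into the first
  one, up to conjugation of \<open>Q\<close> by \<open>A\<close>, and solutions are unique; so \<open>A = 1 + h(z A)\<close> with
  \<open>h = boxed f g\<close>, which says that \<open>h\<close> is the family of cumulants of the products
  (\<open>product_cumulants\<close>).

  The second system is combinatorial.  On the positions \<open>1, 1', 2, 2', \<dots>, n, n'\<close> the union of
  \<open>\<pi>\<close> and its Kreweras complement is a non-crossing partition, and cutting it at the second element
  of the block of the first position leaves two smaller partitions of the same kind, one of them
  with exchanged roles of \<open>\<pi>\<close> and \<open>K(\<pi>)\<close> (\<open>cpl\<close>).  With \<open>g\<close> constant, this also yields
  \<open>M = 1 + \<kappa>(z M)\<close> for the sums over non-crossing partitions that define moments.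

  For associativity, three free tuples are realised in one Fock space, where \<open>(a b) c = a (b c)\<close>.  The equation for the cumulants of a left
  inverse is again triangular, because the complement of the partition with a single block consists
  of singletons.  Finally, the group structure is transported to the characters along \<open>chi\<close>.
\<close>

section \<open>Power series in non-commuting indeterminates\<close>

typedef 'k ncseries = "UNIV :: ('k list \<Rightarrow> complex) set"
  morphisms cf Series ..

lemma cf_Series [simp]: "cf (Series f) = f"
  by (rule Series_inverse) simp

lemma ncseries_eqI: "(\<And>w. cf F w = cf G w) \<Longrightarrow> F = G"
  by (metis cf_inject ext)

instantiation ncseries :: (type) ring_1
begin
definition "0 = Series (\<lambda>w. 0)"
definition "1 = Series (\<lambda>w. if w = [] then 1 else 0)"
definition "F + G = Series (\<lambda>w. cf F w + cf G w)"
definition "F - G = Series (\<lambda>w. cf F w - cf G w)"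
definition "- F = Series (\<lambda>w. - cf F w)"
definition "F * G = Series (\<lambda>w. \<Sum>i\<le>length w. cf F (take i w) * cf G (drop i w))"

lemma cf_zero [simp]: "cf 0 w = 0" by (simp add: zero_ncseries_def)
lemma cf_one: "cf 1 w = (if w = [] then 1 else 0)" by (simp add: one_ncseries_def)
lemma cf_add [simp]: "cf (F + G) w = cf F w + cf G w" by (simp add: plus_ncseries_def)
lemma cf_diff [simp]: "cf (F - G) w = cf F w - cf G w" by (simp add: minus_ncseries_def)
lemma cf_uminus [simp]: "cf (- F) w = - cf F w" by (simp add: uminus_ncseries_def)

lemma cf_mult: "cf (F * G) w = (\<Sum>i\<le>length w. cf F (take i w) * cf G (drop i w))"
  by (simp add: times_ncseries_def)

text \<open>
  Splitting off the first letter satisfies a Leibniz rule, which turns statements about products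
  into inductions along a word.
\<close>

definition lder :: "'k \<Rightarrow> 'k ncseries \<Rightarrow> 'k ncseries" where
  "lder x F = Series (\<lambda>w. cf F (x # w))"

lemma cf_lder [simp]: "cf (lder x F) w = cf F (x # w)" by (simp add: lder_def)

lemma cf_mult_Nil [simp]: "cf (F * G) [] = cf F [] * cf G []"
  by (simp add: cf_mult)

lemma cf_mult_Cons: "cf (F * G) (x # w) = cf F [] * cf G (x # w) + cf (lder x F * G) w"
  by (simp add: cf_mult sum.atMost_Suc_shift del: sum.atMost_Suc)

instance
proof
  fix F G H :: "'a ncseries"
  have distr: "cf ((F + G) * H) w = cf (F * H) w + cf (G * H) w" for F G H :: "'a ncseries" and w
    by (simp add: cf_mult sum.distrib algebra_simps)
  have const: "cf (Series (\<lambda>w. c * cf F (a # w)) * G) w = c * cf (lder a F * G) w"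
    for F G :: "'a ncseries" and a c w
    by (simp add: cf_mult sum_distrib_left algebra_simps)
  have lder_mult: "lder x (F * G) = Series (\<lambda>w. cf F [] * cf (lder x G) w) + lder x F * G"
    for F G :: "'a ncseries" and x
    by (rule ncseries_eqI) (simp add: cf_mult_Cons)
  have "cf (F * G * H) w = cf (F * (G * H)) w" for F G H :: "'a ncseries" and w
    by (induction w arbitrary: F G H)
      (simp_all add: cf_mult_Cons lder_mult distr const algebra_simps)
  then show "F * G * H = F * (G * H)" by (rule ncseries_eqI)
  show "(F + G) * H = F * H + G * H" by (rule ncseries_eqI) (simp add: distr)
  show "F * (G + H) = F * G + F * H"
    by (rule ncseries_eqI) (simp add: cf_mult sum.distrib algebra_simps)
  show "1 * F = F"
  proof (rule ncseries_eqI)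
    fix w
    have "cf (1 * F) w = (\<Sum>i\<le>length w. if i = 0 then cf F w else 0)"
      unfolding cf_mult by (intro sum.cong) (auto simp: cf_one)
    then show "cf (1 * F) w = cf F w" by simp
  qed
  show "F * 1 = F"
  proof (rule ncseries_eqI)
    fix w
    have "cf (F * 1) w = (\<Sum>i\<le>length w. if i = length w then cf F w else 0)"
      unfolding cf_mult by (intro sum.cong) (auto simp: cf_one)
    then show "cf (F * 1) w = cf F w" by simp
  qed
  show "(0 :: 'a ncseries) \<noteq> 1"
    by (metis cf_one cf_zero zero_neq_one)
qed (rule ncseries_eqI; simp add: algebra_simps)+

end

lemma cf_sum [simp]: "cf (sum h A) w = (\<Sum>x\<in>A. cf (h x) w)"
  by (induction A rule: infinite_finite_induct) simp_all

definition zvar :: "'k \<Rightarrow> 'k ncseries" where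
  "zvar x = Series (\<lambda>w. if w = [x] then 1 else 0)"

lemma cf_zvar: "cf (zvar x) w = (if w = [x] then 1 else 0)"
  by (simp add: zvar_def)

lemma cf_zvar_Nil [simp]: "cf (zvar x) [] = 0"
  by (simp add: cf_zvar)

lemma lder_zvar: "lder x (zvar y) = (if x = y then 1 else 0)"
  by (rule ncseries_eqI) (simp add: cf_zvar cf_one)

lemma cf_zvar_mult_Cons [simp]: "cf (zvar x * F) (y # w) = (if x = y then cf F w else 0)"
  by (simp add: cf_mult_Cons cf_zvar lder_zvar)

lemma cf_zvar_mult_Nil [simp]: "cf (zvar x * F) [] = 0" "cf (F * zvar x) [] = 0"
  by (simp_all add: cf_zvar)

lemma cf_mult_zvar_snoc [simp]: "cf (F * zvar x) (w @ [y]) = (if x = y then cf F w else 0)"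
proof -
  have "cf (F * zvar x) (w @ [y]) =
      (\<Sum>i\<le>Suc (length w). if i = length w then (if x = y then cf F w else 0) else 0)"
    unfolding cf_mult by (intro sum.cong) (auto simp: cf_zvar Cons_eq_append_conv le_Suc_eq
        append_eq_Cons_conv)
  then show ?thesis by simp
qed

definition const :: "complex \<Rightarrow> 'k ncseries" where
  "const c = Series (\<lambda>w. if w = [] then c else 0)"

lemma cf_const_mult [simp]: "cf (const c * F) w = c * cf F w"
proof -
  have "cf (const c * F) w = (\<Sum>i\<le>length w. if i = 0 then c * cf F w else 0)"
    unfolding cf_mult by (intro sum.cong) (auto simp: const_def)
  then show ?thesis by simp
qed

lemma const_mult_comm: "F * const c = const c * F"
proof (rule ncseries_eqI)
  fix w
  have "cf (F * const c) w = (\<Sum>i\<le>length w. if i = length w then c * cf F w else 0)"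
    unfolding cf_mult by (intro sum.cong) (auto simp: const_def)
  then show "cf (F * const c) w = cf (const c * F) w" by simp
qed

lemma cf_const [simp]: "cf (const c) w = (if w = [] then c else 0)"
  by (simp add: const_def)

text \<open>
  Equations for series are solved degree by degree: multiplication by a series without constant
  term raises by one the degree up to which two series are known to agree.
\<close>

definition agree :: "nat \<Rightarrow> 'k ncseries \<Rightarrow> 'k ncseries \<Rightarrow> bool" where
  "agree n F G \<longleftrightarrow> (\<forall>w. length w < n \<longrightarrow> cf F w = cf G w)"

lemma agree_0 [simp]: "agree 0 F G" by (simp add: agree_def)

lemma agree_refl [simp]: "agree n F F" by (simp add: agree_def)

lemma eq_if_agree: "(\<And>n. agree n F G) \<Longrightarrow> F = G"
  by (rule ncseries_eqI) (auto simp: agree_def)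

lemma agree_add: "agree n F F' \<Longrightarrow> agree n G G' \<Longrightarrow> agree n (F + G) (F' + G')"
  by (simp add: agree_def)

lemma agree_sum: "(\<And>x. x \<in> A \<Longrightarrow> agree n (h x) (h' x)) \<Longrightarrow> agree n (sum h A) (sum h' A)"
  by (simp add: agree_def)

lemma agree_mult: "agree n F F' \<Longrightarrow> agree n G G' \<Longrightarrow> agree n (F * G) (F' * G')"
  unfolding agree_def cf_mult by (auto intro!: sum.cong)

lemma agree_mult_Suc_left:
  assumes "cf S [] = 0" "agree n F F'"
  shows "agree (Suc n) (S * F) (S * F')"
  unfolding agree_def
proof (intro allI impI)
  fix w :: "'a list" assume "length w < Suc n"
  then show "cf (S * F) w = cf (S * F') w"
    using assms agree_mult[OF agree_refl, of n F F'] by (cases w) (auto simp: cf_mult_Cons agree_def)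
qed

lemma agree_mult_Suc_right:
  assumes "cf S [] = 0" "agree n F F'"
  shows "agree (Suc n) (F * S) (F' * S)"
  unfolding agree_def cf_mult
proof (intro allI impI sum.cong refl)
  fix w :: "'a list" and i assume *: "length w < Suc n" "i \<in> {..length w}"
  show "cf F (take i w) * cf S (drop i w) = cf F' (take i w) * cf S (drop i w)"
    using assms * by (cases "i = length w") (auto simp: agree_def)
qed

text \<open>
  The coefficients of \<open>F\<close> vanish by induction on the degree, since the constant term of \<open>M\<close> is a
  unit.
\<close>

lemma ncseries_cancel_right:
  assumes "F * M = 0" "cf M [] \<noteq> 0"
  shows "F = 0"
proof (rule eq_if_agree)
  fix n show "agree n F 0"
  proof (induction n)
    case (Suc n)
    have "cf F w = 0" if w: "length w = n" for w
    proof -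
      have "0 = cf (F * M) w" using assms by simp
      also have "\<dots> = (\<Sum>i\<le>length w. if i = length w then cf F w * cf M [] else 0)"
        unfolding cf_mult using Suc w by (intro sum.cong) (auto simp: agree_def)
      finally show ?thesis using assms by simp
    qed
    with Suc show ?case by (auto simp: agree_def less_Suc_eq)
  qed simp
qed

section \<open>Substitution\<close>

abbreviation smon :: "('i \<Rightarrow> 'k ncseries) \<Rightarrow> 'i list \<Rightarrow> 'k ncseries" where
  "smon S u \<equiv> prod_list (map S u)"

text \<open>
  The substitution $\sum_u f(u)\, S_{u_1} \cdots S_{u_m}$.  The sum over \<open>u\<close> is cut off at the length
  of \<open>w\<close>, which loses nothing if no \<open>S i\<close> has a constant term.  The coefficients \<open>f\<close> form a bare
  function so that letters can be removed from its argument.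
\<close>

definition ssub :: "('i::finite list \<Rightarrow> complex) \<Rightarrow> ('i \<Rightarrow> 'k ncseries) \<Rightarrow> 'k ncseries" where
  "ssub f S = Series (\<lambda>w. \<Sum>u | length u \<le> length w. f u * cf (smon S u) w)"

lemma finite_words: "finite {u :: 'i::finite list. length u \<le> n}"
  using finite_lists_length_le[of "UNIV :: 'i set" n] by simp

lemma smon_low_degree:
  assumes "\<And>i. cf (S i) [] = 0" "length w < length u"
  shows "cf (smon S u) w = 0"
  using assms(2)
proof (induction u arbitrary: w)
  case (Cons i u)
  have "agree (length u) (smon S u) 0"
    using Cons.IH by (simp add: agree_def)
  then have "agree (Suc (length u)) (S i * smon S u) (S i * 0)"
    by (intro agree_mult_Suc_left assms)
  with Cons.prems show ?case by (simp add: agree_def)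
qed simp

lemma cf_ssub:
  assumes "\<And>i. cf (S i) [] = 0" "length w \<le> n"
  shows "cf (ssub f S) w = (\<Sum>u | length u \<le> n. f u * cf (smon S u) w)"
  unfolding ssub_def cf_Series
  using assms by (intro sum.mono_neutral_left finite_words) (auto intro: smon_low_degree)

lemma cf_ssub_Nil [simp]: "cf (ssub f S) [] = f []"
  by (simp add: ssub_def cf_one)

lemma words_le_Suc:
  "{u :: 'i list. length u \<le> Suc n} = insert [] ((\<lambda>(i, u). i # u) ` (UNIV \<times> {u. length u \<le> n}))"
  (is "?A = ?B")
proof
  show "?A \<subseteq> ?B"
  proof
    fix u :: "'i list" assume "u \<in> ?A"
    then show "u \<in> ?B" by (cases u) auto
  qed
qed auto

lemma words_le_Suc_snoc:
  "{u :: 'i list. length u \<le> Suc n} = insert [] ((\<lambda>(i, u). u @ [i]) ` (UNIV \<times> {u. length u \<le> n}))"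
  (is "?A = ?B")
proof
  show "?A \<subseteq> ?B"
  proof
    fix u :: "'i list" assume "u \<in> ?A"
    then show "u \<in> ?B" by (cases u rule: rev_cases) force+
  qed
qed auto

lemma sum_words_Suc:
  fixes g :: "'i::finite list \<Rightarrow> complex"
  shows "(\<Sum>u | length u \<le> Suc n. g u) = g [] + (\<Sum>i\<in>UNIV. \<Sum>u | length u \<le> n. g (i # u))"
    and "(\<Sum>u | length u \<le> Suc n. g u) = g [] + (\<Sum>i\<in>UNIV. \<Sum>u | length u \<le> n. g (u @ [i]))"
  unfolding words_le_Suc[of n] sum.cartesian_product
   apply (subst sum.insert)
     apply (auto simp: finite_words inj_on_def case_prod_unfold sum.reindex)[3]
  unfolding words_le_Suc[of n, symmetric] words_le_Suc_snoc[of n]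
  apply (subst sum.insert)
    apply (auto simp: finite_words inj_on_def case_prod_unfold sum.reindex)[3]
  done

lemma cf_sum_mult_words:
  "cf (F * ssub f S) w = (\<Sum>u | length u \<le> length w. f u * cf (F * smon S u) w)"
  if S: "\<And>i. cf (S i) [] = 0"
proof -
  have "cf (F * ssub f S) w = (\<Sum>i\<le>length w. \<Sum>u | length u \<le> length w.
      cf F (take i w) * (f u * cf (smon S u) (drop i w)))"
    unfolding cf_mult by (intro sum.cong refl) (simp add: cf_ssub[OF S, of _ "length w"] sum_distrib_left)
  also have "\<dots> = (\<Sum>u | length u \<le> length w. f u * cf (F * smon S u) w)"
    by (subst sum.swap) (simp add: cf_mult sum_distrib_left mult_ac)
  finally show ?thesis .
qed

lemma cf_sum_mult_words_right:
  "cf (ssub f S * F) w = (\<Sum>u | length u \<le> length w. f u * cf (smon S u * F) w)"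
  if S: "\<And>i. cf (S i) [] = 0"
proof -
  have "cf (ssub f S * F) w = (\<Sum>i\<le>length w. \<Sum>u | length u \<le> length w.
      (f u * cf (smon S u) (take i w)) * cf F (drop i w))"
    unfolding cf_mult by (intro sum.cong refl) (simp add: cf_ssub[OF S, of _ "length w"] sum_distrib_right)
  also have "\<dots> = (\<Sum>u | length u \<le> length w. f u * cf (smon S u * F) w)"
    by (subst sum.swap) (simp add: cf_mult sum_distrib_left mult_ac)
  finally show ?thesis .
qed

lemma ssub_left:
  assumes S: "\<And>i. cf (S i) [] = 0"
  shows "ssub f S = const (f []) + (\<Sum>i\<in>UNIV. S i * ssub (\<lambda>u. f (i # u)) S)"
proof (rule ncseries_eqI)
  fix w
  show "cf (ssub f S) w = cf (const (f []) + (\<Sum>i\<in>UNIV. S i * ssub (\<lambda>u. f (i # u)) S)) w"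
    by (simp add: cf_ssub[OF S, of w "Suc (length w)"] sum_words_Suc(1) cf_sum_mult_words[OF S] cf_one)
qed

lemma ssub_right:
  assumes S: "\<And>i. cf (S i) [] = 0"
  shows "ssub f S = const (f []) + (\<Sum>i\<in>UNIV. ssub (\<lambda>u. f (u @ [i])) S * S i)"
proof (rule ncseries_eqI)
  fix w
  show "cf (ssub f S) w = cf (const (f []) + (\<Sum>i\<in>UNIV. ssub (\<lambda>u. f (u @ [i])) S * S i)) w"
    by (simp add: cf_ssub[OF S, of w "Suc (length w)"] sum_words_Suc(2) cf_sum_mult_words_right[OF S] cf_one)
qed

lemma ssub_add: "ssub (\<lambda>u. f u + g u) S = ssub f S + ssub g S"
  by (rule ncseries_eqI) (simp add: ssub_def sum.distrib algebra_simps)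

lemma ssub_const_mult: "ssub (\<lambda>u. c * f u) S = const c * ssub f S"
  by (rule ncseries_eqI) (simp add: ssub_def sum_distrib_left algebra_simps)

lemma ssub_zero [simp]: "ssub (\<lambda>u. 0) S = 0"
  by (rule ncseries_eqI) (simp add: ssub_def)

lemma ssub_one: "(\<And>i. cf (S i) [] = 0) \<Longrightarrow> ssub (cf 1) S = 1"
  by (subst ssub_left) (simp_all add: cf_one, rule ncseries_eqI, simp add: cf_one)

lemma ssub_zvar: "(\<And>i. cf (S i) [] = 0) \<Longrightarrow> ssub (cf (zvar j)) S = S j"
proof -
  assume S: "\<And>i. cf (S i) [] = 0"
  have "(\<lambda>u. cf (zvar j) (i # u)) = (if i = j then cf 1 else (\<lambda>u. 0))" for i
    by (auto simp: cf_zvar cf_one)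
  then have "ssub (cf (zvar j)) S = const 0 + (\<Sum>i\<in>UNIV. S i * ssub (if i = j then cf 1 else (\<lambda>u. 0)) S)"
    using ssub_left[OF S, of "cf (zvar j)"] by (simp add: cf_zvar)
  also have "(\<Sum>i\<in>UNIV. S i * ssub (if i = j then cf 1 else (\<lambda>u. 0)) S) =
      (\<Sum>i\<in>UNIV. if i = j then S i else 0)"
    by (intro sum.cong) (auto simp: ssub_one S)
  also have "const 0 = (0 :: 'b ncseries)" by (rule ncseries_eqI) simp
  finally show ?thesis by simp
qed

text \<open>
  Both sides satisfy the same recursion with respect to the first letter, which determines them
  degree by degree.
\<close>

lemma ssub_mult:
  assumes S: "\<And>i. cf (S i) [] = 0"
  shows "ssub (cf (F * G)) S = ssub (cf F) S * ssub (cf G) S"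
proof (rule eq_if_agree)
  fix n
  show "agree n (ssub (cf (F * G)) S) (ssub (cf F) S * ssub (cf G) S)"
  proof (induction n arbitrary: F G)
    case (Suc n)
    define L where "L H i = ssub (cf (lder i H)) S" for H i
    have left: "ssub (cf H) S = const (cf H []) + (\<Sum>i\<in>UNIV. S i * L H i)" for H
      using ssub_left[OF S, of "cf H"] by (simp add: L_def lder_def)
    have der: "cf (lder i (F * G)) = (\<lambda>u. cf F [] * cf (lder i G) u + cf (lder i F * G) u)" for i
      by (rule ext) (simp add: cf_mult_Cons)
    have "ssub (cf (F * G)) S = const (cf F [] * cf G []) +
        (\<Sum>i\<in>UNIV. S i * (const (cf F []) * L G i + ssub (cf (lder i F * G)) S))"
      by (simp add: left[of "F * G"] L_def[of "F * G"] der ssub_add ssub_const_mult del: cf_lder)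
        (simp add: L_def del: cf_lder)
    moreover have "agree (Suc n) \<dots> (const (cf F [] * cf G []) +
        (\<Sum>i\<in>UNIV. S i * (const (cf F []) * L G i + L F i * ssub (cf G) S)))"
      unfolding L_def by (intro agree_add agree_sum agree_mult_Suc_left S agree_refl Suc.IH)
    moreover have "const (cf F [] * cf G []) +
        (\<Sum>i\<in>UNIV. S i * (const (cf F []) * L G i + L F i * ssub (cf G) S)) =
        const (cf F []) * (const (cf G []) + (\<Sum>i\<in>UNIV. S i * L G i)) +
        (\<Sum>i\<in>UNIV. S i * L F i) * ssub (cf G) S"
    proof -
      have "const (cf F [] * cf G []) = const (cf F []) * const (cf G [])"
        by (rule ncseries_eqI) simp
      moreover have "S i * (const (cf F []) * L G i) = const (cf F []) * (S i * L G i)" for i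
        by (metis const_mult_comm mult.assoc)
      ultimately show ?thesis
        by (simp add: distrib_left sum.distrib sum_distrib_left sum_distrib_right mult.assoc)
    qed
    moreover have "\<dots> = ssub (cf F) S * ssub (cf G) S"
      unfolding left[of G, symmetric] unfolding left[of F] by (simp add: distrib_right)
    ultimately show ?case by simp
  qed simp
qed

lemma ssub_smon:
  assumes S: "\<And>i. cf (S i) [] = 0"
  shows "ssub (cf (smon q v)) S = smon (\<lambda>j. ssub (cf (q j)) S) v"
  by (induction v) (simp_all add: ssub_one ssub_mult S)

lemma ssub_ssub:
  assumes S: "\<And>i. cf (S i) [] = 0" and q: "\<And>j. cf (q j) [] = 0"
  shows "ssub (cf (ssub g q)) S = ssub g (\<lambda>j. ssub (cf (q j)) S)"
proof (rule ncseries_eqI)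
  fix w
  have "cf (ssub (cf (ssub g q)) S) w =
      (\<Sum>u | length u \<le> length w. \<Sum>v | length v \<le> length w. g v * cf (smon q v) u * cf (smon S u) w)"
    unfolding cf_ssub[OF S order_refl]
    by (intro sum.cong refl) (simp add: cf_ssub[OF q, of _ "length w"] sum_distrib_right)
  also have "\<dots> = (\<Sum>v | length v \<le> length w. g v * cf (ssub (cf (smon q v)) S) w)"
    by (subst sum.swap) (simp add: cf_ssub[OF S order_refl] sum_distrib_left mult_ac)
  also have "\<dots> = cf (ssub g (\<lambda>j. ssub (cf (q j)) S)) w"
    by (simp add: ssub_smon[OF S] cf_ssub[of "\<lambda>j. ssub (cf (q j)) S", OF _ order_refl] q)
  finally show "cf (ssub (cf (ssub g q)) S) w = cf (ssub g (\<lambda>j. ssub (cf (q j)) S)) w" .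
qed

lemma agree_smon: "(\<And>i. agree n (S i) (T i)) \<Longrightarrow> agree n (smon S u) (smon T u)"
  by (induction u) (simp_all add: agree_mult)

lemma agree_ssub: "(\<And>i. agree n (S i) (T i)) \<Longrightarrow> agree n (ssub f S) (ssub f T)"
  using agree_smon[of n S T] by (auto simp: agree_def ssub_def intro!: sum.cong)

lemma smon_conj: "(\<And>i. S i * A = A * T i) \<Longrightarrow> smon S u * A = A * smon T u"
  by (induction u) (simp, metis list.simps(9) mult.assoc prod_list.Cons)

text \<open>
  Conjugation by \<open>A\<close> respects sums and products; here it is stated without an inverse of \<open>A\<close>.
\<close>

lemma ssub_conj:
  assumes S: "\<And>i. cf (S i) [] = 0" and T: "\<And>i. cf (T i) [] = 0" and "\<And>i. S i * A = A * T i"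
  shows "ssub f S * A = A * ssub f T"
  by (rule ncseries_eqI)
    (simp add: cf_sum_mult_words[OF T] cf_sum_mult_words_right[OF S] smon_conj[OF assms(3)])

text \<open>
  The coefficients of degree \<open>n\<close> on the right-hand side of the equation only involve those of \<open>M\<close> of
  smaller degree, because \<open>zvar x * M\<close> has no constant term.
\<close>

lemma moment_series_unique:
  fixes M M' :: "'k::finite ncseries"
  assumes "M = 1 + ssub f (\<lambda>x. zvar x * M)" "M' = 1 + ssub f (\<lambda>x. zvar x * M')"
  shows "M = M'"
proof (rule eq_if_agree)
  fix n show "agree n M M'"
  proof (induction n)
    case (Suc n)
    then show ?case
      by (subst assms(1), subst assms(2))
        (intro agree_add agree_refl agree_ssub agree_mult_Suc_left; simp add: cf_zvar)
  qed simp
qed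

text \<open>
  The algebraic reason for the product formula.  Conjugated by \<open>A\<close>, the equations for \<open>P\<close> and \<open>Q\<close>
  become those for \<open>p\<close> and \<open>q\<close> with \<open>zvar i\<close> replaced by \<open>zvar i * A\<close>; since these have a single
  solution, \<open>P\<close> arises from \<open>p\<close> by that substitution.
\<close>

theorem product_cumulants:
  fixes A :: "'k::finite ncseries"
  assumes P: "\<And>i. P i = zvar i * ssub (\<lambda>r. g (i # r)) Q * A"
    and Q: "\<And>j. Q j = A * ssub (\<lambda>r. f (r @ [j])) P * zvar j"
    and A: "A = 1 + ssub f P"
    and p: "\<And>i. p i = zvar i * ssub (\<lambda>r. g (i # r)) q"
    and q: "\<And>j. q j = ssub (\<lambda>r. f (r @ [j])) p * zvar j"
    and h: "h = cf (ssub f p)"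
  shows "A = 1 + ssub h (\<lambda>i. zvar i * A)"
proof -
  define S where "S i = zvar i * A" for i
  \<comment> \<open>\<open>Q'\<close> is the conjugate of \<open>Q\<close> by \<open>A\<close>.\<close>
  define Q' where "Q' j = ssub (\<lambda>r. f (r @ [j])) P * S j" for j
  define p' where "p' i = ssub (cf (p i)) S" for i
  define q' where "q' i = ssub (cf (q i)) S" for i
  have S0: "cf (S i) [] = 0" for i by (simp add: S_def cf_zvar)
  have P0: "cf (P i) [] = 0" and Q0: "cf (Q i) [] = 0" and p0: "cf (p i) [] = 0"
    and q0: "cf (q i) [] = 0" for i
    by (simp_all add: P[of i] Q[of i] p[of i] q[of i] cf_zvar mult.assoc)
  have Q'0: "cf (Q' i) [] = 0" for i by (simp add: Q'_def S0)
  have "Q j * A = A * Q' j" for j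
    by (simp add: Q[of j] Q'_def S_def mult.assoc)
  then have "ssub f' Q * A = A * ssub f' Q'" for f'
    by (intro ssub_conj Q0 Q'0)
  then have P': "P i = S i * ssub (\<lambda>r. g (i # r)) Q'" for i
    by (simp add: P[of i] S_def mult.assoc)
  have pS: "p' i = S i * ssub (\<lambda>r. g (i # r)) q'" for i
    unfolding p'_def q'_def by (simp add: p[of i] ssub_mult ssub_ssub ssub_zvar S0 q0)
  have qS: "q' j = ssub (\<lambda>r. f (r @ [j])) p' * S j" for j
    unfolding p'_def q'_def by (simp add: q[of j] ssub_mult ssub_ssub ssub_zvar S0 p0)
  have "agree n (P i) (p' i) \<and> agree n (Q' i) (q' i)" for n i
  proof (induction n arbitrary: i)
    case (Suc n)
    have "agree (Suc n) (P i) (p' i)"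
      unfolding P'[of i] pS[of i] using Suc by (intro agree_mult_Suc_left S0 agree_ssub) blast
    moreover have "agree (Suc n) (Q' i) (q' i)"
      unfolding Q'_def[of i] qS[of i] using Suc by (intro agree_mult_Suc_right S0 agree_ssub) blast
    ultimately show ?case ..
  qed simp
  then have "P = p'" by (intro ext eq_if_agree) simp
  then have "ssub f P = ssub h S"
    unfolding h p'_def by (simp add: ssub_ssub S0 p0)
  then have "A = 1 + ssub h S" using A by (rule subst)
  then show ?thesis unfolding S_def[abs_def] .
qed

section \<open>Words that alternate between two tuples\<close>

text \<open>
  The cumulants of the union of two free tuples: mixed cumulants vanish.
\<close>

definition joint :: "('a list \<Rightarrow> complex) \<Rightarrow> ('b list \<Rightarrow> complex) \<Rightarrow> ('a + 'b) list \<Rightarrow> complex" where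
  "joint f g W = (if list_all isl W then f (map projl W)
     else if list_all (\<lambda>x. \<not> isl x) W then g (map projr W) else 0)"

lemma joint_Inl [simp]: "joint f g (map Inl u) = f u"
  by (simp add: joint_def list_all_iff comp_def)

lemma joint_Inr [simp]: "f [] = g [] \<Longrightarrow> joint f g (map Inr u) = g u"
  by (cases u) (simp_all add: joint_def list_all_iff comp_def)

lemma joint_mixed: "x \<in> set W \<Longrightarrow> y \<in> set W \<Longrightarrow> isl x \<noteq> isl y \<Longrightarrow> joint f g W = 0"
  by (auto simp: joint_def list_all_iff)

lemma list_all_Inl: "list_all isl W \<longleftrightarrow> (\<exists>u. W = map Inl u)"
  by (induction W) (auto simp: isl_def Cons_eq_map_conv)

lemma list_all_Inr: "list_all (\<lambda>x. \<not> isl x) W \<longleftrightarrow> (\<exists>u. W = map Inr u)"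
proof (induction W)
  case (Cons x W)
  then show ?case by (cases x) (auto simp: Cons_eq_map_conv)
qed simp

lemma joint_nonzero: "joint f g W \<noteq> 0 \<Longrightarrow> (\<exists>u. W = map Inl u) \<or> (\<exists>u. W = map Inr u)"
  by (auto simp: joint_def list_all_Inl list_all_Inr split: if_splits)

text \<open>
  With \<open>Inl\<close> marking the letters of the first tuple and \<open>Inr\<close> those of the second one, \<open>dbl w\<close> is the
  word \<open>a b a b \<dots>\<close> that the products \<open>a\<^sub>i b\<^sub>i\<close> along \<open>w\<close> spell.
\<close>

primrec dbl :: "'k list \<Rightarrow> ('k + 'k) list" where
  "dbl [] = []"
| "dbl (i # w) = Inl i # Inr i # dbl w"

lemma dbl_append: "dbl (v @ w) = dbl v @ dbl w"
  by (induction v) simp_all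

lemma length_dbl [simp]: "length (dbl w) = 2 * length w"
  by (induction w) simp_all

lemma dbl_eq_Nil [simp]: "dbl w = [] \<longleftrightarrow> w = []" "[] = dbl w \<longleftrightarrow> w = []"
  by (cases w; simp)+

definition pull :: "('k + 'k) ncseries \<Rightarrow> 'k ncseries" where
  "pull F = Series (\<lambda>w. cf F (dbl w))"

lemma cf_pull [simp]: "cf (pull F) w = cf F (dbl w)"
  by (simp add: pull_def)

lemma pull_add: "pull (F + G) = pull F + pull G"
  by (rule ncseries_eqI) simp

lemma pull_one [simp]: "pull 1 = 1"
  by (rule ncseries_eqI) (simp add: cf_one)

text \<open>
  A cut of a doubled word either lies between two pairs, or separates \<open>Inl j\<close> from its partner
  \<open>Inr j\<close>; the hypothesis says that the cuts of the second kind contribute nothing.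
\<close>

lemma pull_mult:
  assumes "\<And>v j w. cf F (dbl v @ [Inl j]) = 0 \<or> cf G (Inr j # dbl w) = 0"
  shows "pull (F * G) = pull F * pull G"
proof (rule ncseries_eqI)
  fix w
  show "cf (pull (F * G)) w = cf (pull F * pull G) w"
    using assms
  proof (induction w arbitrary: F)
    case (Cons i w)
    let ?F = "lder (Inr i) (lder (Inl i) F)"
    have "cf ?F (dbl v @ [Inl j]) = 0 \<or> cf G (Inr j # dbl w) = 0" for v j w
      using Cons.prems[of "i # v" j w] by simp
    then have "cf (?F * G) (dbl w) = cf (pull ?F * pull G) w"
      using Cons.IH[of ?F] by simp
    moreover have "pull ?F = lder i (pull F)"
      by (rule ncseries_eqI) simp
    moreover have "cf F [Inl i] * cf G (Inr i # dbl w) = 0"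
      using Cons.prems[of "[]" i w] by simp
    ultimately show ?case by (simp add: cf_mult_Cons)
  qed simp
qed

lemma dbl_snoc_cases:
  obtains "w = []" | v j where "w = v @ [j]" "dbl w = (dbl v @ [Inl j]) @ [Inr j]"
  by (cases w rule: rev_cases) (auto simp: dbl_append)

lemma sum_words_map:
  fixes F :: "'l::finite list \<Rightarrow> complex" and \<iota> :: "'k::finite \<Rightarrow> 'l"
  assumes "inj \<iota>" and "\<And>r. (\<And>u. r \<noteq> map \<iota> u) \<Longrightarrow> F r = 0"
  shows "(\<Sum>r | length r \<le> n. F r) = (\<Sum>u | length u \<le> n. F (map \<iota> u))"
proof -
  have "(\<Sum>r | length r \<le> n. F r) = sum F (map \<iota> ` {u. length u \<le> n})"
    using assms(2) by (intro sum.mono_neutral_right finite_words) (auto, metis image_eqI length_map mem_Collect_eq)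
  also have "\<dots> = (\<Sum>u | length u \<le> n. F (map \<iota> u))"
    using assms(1) by (simp add: sum.reindex inj_on_def inj_map_eq_map)
  finally show ?thesis .
qed

text \<open>
  In a product of factors \<open>zvar y * \<Lambda>\<close> each factor starts with its letter \<open>y\<close>.  If all these
  letters are of the form \<open>Inl i\<close>, the doubled word is cut between pairs only.
\<close>

lemma pull_ssub_Inl:
  fixes \<Lambda> :: "('k::finite + 'k) ncseries"
  assumes f: "\<And>u. F (map Inl u) = f u"
    and F: "\<And>r. F r \<noteq> 0 \<Longrightarrow> (\<exists>u. r = map Inl u) \<or> (\<exists>i r'. r = Inr i # r')"
  shows "pull (ssub F (\<lambda>y. zvar y * \<Lambda>)) = ssub f (\<lambda>i. pull (zvar (Inl i) * \<Lambda>))"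
proof -
  let ?S = "\<lambda>y. zvar y * \<Lambda>"
  have smon: "pull (smon ?S (map Inl u)) = smon (\<lambda>i. pull (zvar (Inl i) * \<Lambda>)) u" for u
  proof (induction u)
    case (Cons i u)
    have "cf (smon ?S (map Inl u)) (Inr j # W) = 0" for j W
      by (cases u) (simp_all add: cf_one mult.assoc)
    with Cons show ?case by (simp add: pull_mult)
  qed simp
  show ?thesis
  proof (rule ncseries_eqI)
    fix w
    have zero: "F r * cf (smon ?S r) (dbl w) = 0" if no: "\<And>u. r \<noteq> map Inl u" for r
    proof (cases "F r = 0")
      case False
      then obtain i r' where "r = Inr i # r'" using F no by blast
      then show ?thesis by (cases w) (simp_all add: mult.assoc)
    qed simp
    have "cf (pull (ssub F ?S)) w = (\<Sum>r | length r \<le> 2 * length w. F r * cf (smon ?S r) (dbl w))"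
      by (simp add: ssub_def)
    also have "\<dots> = (\<Sum>u | length u \<le> 2 * length w. f u * cf (pull (smon ?S (map Inl u))) w)"
      by (subst sum_words_map[of Inl]) (simp_all add: zero f)
    also have "\<dots> = cf (ssub f (\<lambda>i. pull (zvar (Inl i) * \<Lambda>))) w"
      by (subst cf_ssub[of _ w "2 * length w"]) (simp_all add: smon[symmetric])
    finally show "cf (pull (ssub F ?S)) w = cf (ssub f (\<lambda>i. pull (zvar (Inl i) * \<Lambda>))) w" .
  qed
qed

lemma pull_ssub_Inr:
  fixes \<Lambda> :: "('k::finite + 'k) ncseries"
  assumes g: "\<And>u. F (map Inr u) = g u"
    and F: "\<And>r. F r \<noteq> 0 \<Longrightarrow> (\<exists>u. r = map Inr u) \<or> (\<exists>i r'. r = r' @ [Inl i])"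
  shows "pull (ssub F (\<lambda>y. \<Lambda> * zvar y)) = ssub g (\<lambda>j. pull (\<Lambda> * zvar (Inr j)))"
proof -
  let ?S = "\<lambda>y. \<Lambda> * zvar y"
  have smon: "pull (smon ?S (map Inr u)) = smon (\<lambda>j. pull (\<Lambda> * zvar (Inr j))) u" for u
    by (induction u) (simp_all add: pull_mult)
  show ?thesis
  proof (rule ncseries_eqI)
    fix w
    have zero: "F r * cf (smon ?S r) (dbl w) = 0" if no: "\<And>u. r \<noteq> map Inr u" for r
    proof (cases "F r = 0")
      case False
      then obtain i r' where "r = r' @ [Inl i]" using F no by blast
      then have "smon ?S r = (smon ?S r' * \<Lambda>) * zvar (Inl i)" by (simp add: mult.assoc)
      then have "cf (smon ?S r) (dbl w) = 0"
        by (cases w rule: dbl_snoc_cases) (simp_all only: cf_mult_zvar_snoc cf_zvar_mult_Nil dbl.simps, simp)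
      then show ?thesis by simp
    qed simp
    have "cf (pull (ssub F ?S)) w = (\<Sum>r | length r \<le> 2 * length w. F r * cf (smon ?S r) (dbl w))"
      by (simp add: ssub_def)
    also have "\<dots> = (\<Sum>u | length u \<le> 2 * length w. g u * cf (pull (smon ?S (map Inr u))) w)"
      by (subst sum_words_map[of Inr]) (simp_all add: zero g)
    also have "\<dots> = cf (ssub g (\<lambda>j. pull (\<Lambda> * zvar (Inr j)))) w"
      by (subst cf_ssub[of _ w "2 * length w"]) (simp_all add: smon[symmetric])
    finally show "cf (pull (ssub F ?S)) w = cf (ssub g (\<lambda>j. pull (\<Lambda> * zvar (Inr j)))) w" .
  qed
qed

text \<open>
  The series $\sum_u \kappa(u)\, z_{u_1} \Lambda z_{u_2} \Lambda \cdots \Lambda z_{u_m}$ over the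
  non-empty words \<open>u\<close>, sorted by the first letter of \<open>u\<close>.  It describes one block with word \<open>u\<close> whose
  gaps are filled in all ways counted by \<open>\<Lambda>\<close>.
\<close>

definition sandwich :: "('l::finite list \<Rightarrow> complex) \<Rightarrow> 'l ncseries \<Rightarrow> 'l ncseries" where
  "sandwich \<kappa> \<Lambda> = (\<Sum>x\<in>UNIV. zvar x * ssub (\<lambda>r. \<kappa> (x # r)) (\<lambda>y. \<Lambda> * zvar y))"

text \<open>
  The same series sorted by the last letter; this is what makes the two ends of a block play
  symmetric roles.
\<close>

lemma sandwich_right:
  "sandwich \<kappa> \<Lambda> = (\<Sum>x\<in>UNIV. ssub (\<lambda>r. \<kappa> (r @ [x])) (\<lambda>y. zvar y * \<Lambda>) * zvar x)"
proof (rule ncseries_eqI)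
  fix w
  let ?S = "\<lambda>y. zvar y * \<Lambda>" and ?T = "\<lambda>y. \<Lambda> * zvar y"
  define G where "G u = (if u = [] then 0 else \<kappa> u * cf (zvar (hd u) * smon ?T (tl u)) w)" for u
  have shift: "zvar x * smon ?T r = smon ?S (butlast (x # r)) * zvar (last (x # r))" for x r
  proof (induction r arbitrary: x)
    case (Cons y r)
    have "zvar x * smon ?T (y # r) = zvar x * \<Lambda> * (zvar y * smon ?T r)" by (simp add: mult.assoc)
    also note Cons.IH[of y]
    finally show ?case by (simp add: mult.assoc)
  qed simp
  have G: "G (r @ [x]) = \<kappa> (r @ [x]) * cf (smon ?S r * zvar x) w" for r x
    using shift[of "hd (r @ [x])" "tl (r @ [x])"] by (simp add: G_def)
  have "cf (sandwich \<kappa> \<Lambda>) w = (\<Sum>u | length u \<le> Suc (length w). G u)"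
    by (simp add: sandwich_def sum_words_Suc(1) cf_sum_mult_words cf_zvar G_def)
  also have "\<dots> = cf (\<Sum>x\<in>UNIV. ssub (\<lambda>r. \<kappa> (r @ [x])) (\<lambda>y. zvar y * \<Lambda>) * zvar x) w"
    unfolding sum_words_Suc(2) G by (simp add: G_def cf_sum_mult_words_right cf_zvar)
  finally show "cf (sandwich \<kappa> \<Lambda>) w = cf (\<Sum>x\<in>UNIV. ssub (\<lambda>r. \<kappa> (r @ [x])) (\<lambda>y. zvar y * \<Lambda>) * zvar x) w" .
qed

lemma cf_sandwich_Nil [simp]: "cf (sandwich \<kappa> \<Lambda>) [] = 0"
  by (simp add: sandwich_def cf_zvar)

lemma cf_sandwich_Cons: "cf (sandwich \<kappa> \<Lambda>) (x # w) = cf (ssub (\<lambda>r. \<kappa> (x # r)) (\<lambda>y. \<Lambda> * zvar y)) w"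
  by (simp add: sandwich_def)

lemma cf_sandwich_snoc: "cf (sandwich \<kappa> \<Lambda>) (w @ [x]) = cf (ssub (\<lambda>r. \<kappa> (r @ [x])) (\<lambda>y. zvar y * \<Lambda>)) w"
  by (simp add: sandwich_right)

text \<open>
  The first and the last letter of a word counted by \<open>sandwich\<close> belong to the same block.
\<close>

lemma cf_sandwich_ends:
  assumes "\<And>r. \<kappa> (x # r @ [y]) = 0"
  shows "cf (sandwich \<kappa> \<Lambda>) (x # w @ [y]) = 0"
proof -
  have "cf (sandwich \<kappa> \<Lambda>) (x # w @ [y]) = cf (ssub (\<lambda>r. \<kappa> (x # r @ [y])) (\<lambda>y. \<Lambda> * zvar y) * \<Lambda>) w"
    unfolding cf_sandwich_Cons
    by (subst ssub_right) (simp_all add: cf_zvar mult.assoc[symmetric] sum.delta)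
  then show ?thesis by (simp add: assms)
qed

lemma ssub_sandwich:
  "ssub \<kappa> (\<lambda>x. zvar x * \<Lambda>) = const (\<kappa> []) + sandwich \<kappa> \<Lambda> * \<Lambda>"
  "ssub \<kappa> (\<lambda>x. \<Lambda> * zvar x) = const (\<kappa> []) + \<Lambda> * sandwich \<kappa> \<Lambda>"
  subgoal by (subst ssub_right) (simp_all add: cf_zvar sandwich_right sum_distrib_right mult.assoc)
  subgoal by (subst ssub_left) (simp_all add: cf_zvar sandwich_def sum_distrib_left mult.assoc)
  done

text \<open>
  The block of the first letter may be exchanged for that of the last one: after multiplication by
  \<open>M\<close> from the right, which can be undone, the claim is that \<open>M\<close> commutes with \<open>M - 1\<close>.
\<close>

lemma moment_series_comm:
  assumes M: "M = 1 + sandwich \<kappa> M * M"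
  shows "M = 1 + M * sandwich \<kappa> M"
proof -
  have "sandwich \<kappa> M * M = M - 1" by (subst (3) M) (simp only: add_diff_cancel_left')
  then have "(M * sandwich \<kappa> M - (M - 1)) * M = 0" by (simp add: left_diff_distrib right_diff_distrib mult.assoc)
  moreover have "cf M [] \<noteq> 0" by (subst M) (simp add: cf_one)
  ultimately have "M * sandwich \<kappa> M - (M - 1) = 0" by (rule ncseries_cancel_right)
  then show ?thesis by (simp add: algebra_simps)
qed

context
  fixes f g :: "'k::finite list \<Rightarrow> complex" and \<kappa> :: "('k + 'k) list \<Rightarrow> complex"
  assumes f0: "f [] = 0" and g0: "g [] = 0"
  defines "\<kappa> \<equiv> joint f g"
begin

lemma joint_ends: "\<kappa> (Inr i # r @ [Inl j]) = 0"
  unfolding \<kappa>_def by (rule joint_mixed[of "Inr i" _ "Inl j"]) simp_all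

text \<open>
  The block of the first letter \<open>Inr i\<close> consists of letters of the second tuple, and each gap
  followed by the next letter of the block is a word counted by \<open>pull (\<Lambda> * zvar (Inr j))\<close>.
\<close>

lemma pull_sandwich_left:
  "pull (zvar (Inl i) * sandwich \<kappa> \<Lambda>) = zvar i * ssub (\<lambda>r. g (i # r)) (\<lambda>j. pull (\<Lambda> * zvar (Inr j)))"
proof -
  have "pull (ssub (\<lambda>r. \<kappa> (Inr i # r)) (\<lambda>y. \<Lambda> * zvar y)) =
      ssub (\<lambda>r. g (i # r)) (\<lambda>j. pull (\<Lambda> * zvar (Inr j)))"
  proof (rule pull_ssub_Inr)
    show "\<kappa> (Inr i # map Inr u) = g (i # u)" for u
      using joint_Inr[of f g "i # u"] by (simp add: \<kappa>_def f0 g0)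
    show "(\<exists>u. r = map Inr u) \<or> (\<exists>i r'. r = r' @ [Inl i])" if "\<kappa> (Inr i # r) \<noteq> 0" for r
      using joint_nonzero[OF that[unfolded \<kappa>_def]] by (auto simp: Cons_eq_map_conv)
  qed
  then have "cf (ssub (\<lambda>r. \<kappa> (Inr i # r)) (\<lambda>y. \<Lambda> * zvar y)) (dbl w) =
      cf (ssub (\<lambda>r. g (i # r)) (\<lambda>j. pull (\<Lambda> * zvar (Inr j)))) w" for w
    by (metis cf_pull)
  then show ?thesis
    by (intro ncseries_eqI, case_tac w) (auto simp: cf_sandwich_Cons)
qed

lemma pull_sandwich_right:
  "pull (sandwich \<kappa> \<Lambda> * zvar (Inr j)) = ssub (\<lambda>r. f (r @ [j])) (\<lambda>i. pull (zvar (Inl i) * \<Lambda>)) * zvar j"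
proof -
  have eq: "pull (ssub (\<lambda>r. \<kappa> (r @ [Inl j])) (\<lambda>y. zvar y * \<Lambda>)) =
      ssub (\<lambda>r. f (r @ [j])) (\<lambda>i. pull (zvar (Inl i) * \<Lambda>))"
  proof (rule pull_ssub_Inl)
    show "\<kappa> (map Inl u @ [Inl j]) = f (u @ [j])" for u
      using joint_Inl[of f g "u @ [j]"] by (simp add: \<kappa>_def)
    show "(\<exists>u. r = map Inl u) \<or> (\<exists>i r'. r = Inr i # r')" if "\<kappa> (r @ [Inl j]) \<noteq> 0" for r
      using joint_nonzero[OF that[unfolded \<kappa>_def]] by (auto simp: append_eq_map_conv)
  qed
  show ?thesis
  proof (rule ncseries_eqI)
    fix w
    show "cf (pull (sandwich \<kappa> \<Lambda> * zvar (Inr j))) w =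
        cf (ssub (\<lambda>r. f (r @ [j])) (\<lambda>i. pull (zvar (Inl i) * \<Lambda>)) * zvar j) w"
    proof (cases w rule: dbl_snoc_cases)
      case (2 v i)
      have "cf (sandwich \<kappa> \<Lambda> * zvar (Inr j)) (dbl w) = (if j = i then cf (sandwich \<kappa> \<Lambda>) (dbl v @ [Inl i]) else 0)"
        unfolding 2(2) by (subst cf_mult_zvar_snoc) simp
      also have "\<dots> = (if j = i then cf (pull (ssub (\<lambda>r. \<kappa> (r @ [Inl j])) (\<lambda>y. zvar y * \<Lambda>))) v else 0)"
        by (simp add: cf_sandwich_snoc)
      finally show ?thesis unfolding eq by (simp add: 2(1))
    qed (simp add: cf_zvar)
  qed
qed

lemma pull_ssub_joint:
  "pull (ssub \<kappa> (\<lambda>x. zvar x * \<Lambda>)) = ssub f (\<lambda>i. pull (zvar (Inl i) * \<Lambda>))"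
  "pull (ssub \<kappa> (\<lambda>x. \<Lambda> * zvar x)) = ssub g (\<lambda>j. pull (\<Lambda> * zvar (Inr j)))"
proof -
  have *: "(\<exists>u. r = map Inl u) \<or> (\<exists>u. r = map Inr u)" if "\<kappa> r \<noteq> 0" for r
    using joint_nonzero that unfolding \<kappa>_def by blast
  show "pull (ssub \<kappa> (\<lambda>x. zvar x * \<Lambda>)) = ssub f (\<lambda>i. pull (zvar (Inl i) * \<Lambda>))"
  proof (rule pull_ssub_Inl)
    show "\<kappa> (map Inl u) = f u" for u by (simp add: \<kappa>_def)
    show "(\<exists>u. r = map Inl u) \<or> (\<exists>i r'. r = Inr i # r')" if "\<kappa> r \<noteq> 0" for r
      using *[OF that]
    proof (elim disjE exE)
      fix u :: "'k list" assume "r = map Inr u"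
      then show ?thesis by (cases u) auto
    qed auto
  qed
  show "pull (ssub \<kappa> (\<lambda>x. \<Lambda> * zvar x)) = ssub g (\<lambda>j. pull (\<Lambda> * zvar (Inr j)))"
  proof (rule pull_ssub_Inr)
    show "\<kappa> (map Inr u) = g u" for u by (simp add: \<kappa>_def f0 g0)
    show "(\<exists>u. r = map Inr u) \<or> (\<exists>i r'. r = r' @ [Inl i])" if "\<kappa> r \<noteq> 0" for r
      using *[OF that]
    proof (elim disjE exE)
      fix u :: "'k list" assume "r = map Inl u"
      then show ?thesis by (cases u rule: rev_cases) auto
    qed auto
  qed
qed

text \<open>
  The hypothesis on \<open>Z\<close> says that a word counted by \<open>Z\<close> starts and ends in the same block, with words
  of the same kind in the gaps.  On alternating words the gaps of a block of either tuple begin and end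
  with letters of the other one, so that the two kinds of words \<open>b (a b) \<dots>\<close> and
  \<open>\<dots> (a b) a\<close> are expressed by each other.
\<close>

lemma cpl_series_system:
  assumes Z: "Z = sandwich \<kappa> Z"
  defines "p \<equiv> \<lambda>i. pull (zvar (Inl i) * Z)" and "q \<equiv> \<lambda>j. pull (Z * zvar (Inr j))"
  shows "p i = zvar i * ssub (\<lambda>r. g (i # r)) q"
    and "q j = ssub (\<lambda>r. f (r @ [j])) p * zvar j"
    and "pull (Z * Z) = ssub f p" and "pull (Z * Z) = ssub g q"
proof -
  show "p i = zvar i * ssub (\<lambda>r. g (i # r)) q"
    using pull_sandwich_left[of i Z] unfolding Z[symmetric] p_def q_def .
  show "q j = ssub (\<lambda>r. f (r @ [j])) p * zvar j"
    using pull_sandwich_right[of Z j] unfolding Z[symmetric] p_def q_def .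
  have "const (\<kappa> []) = (0 :: ('k + 'k) ncseries)"
    by (rule ncseries_eqI) (use joint_Inl[of f g "[]"] in \<open>simp add: \<kappa>_def f0\<close>)
  then have "ssub \<kappa> (\<lambda>x. zvar x * Z) = Z * Z" "ssub \<kappa> (\<lambda>x. Z * zvar x) = Z * Z"
    using ssub_sandwich[of \<kappa> Z] unfolding Z[symmetric] by simp_all
  then show "pull (Z * Z) = ssub f p" "pull (Z * Z) = ssub g q"
    using pull_ssub_joint[of Z] by (simp_all add: p_def q_def)
qed

text \<open>
  In contrast to the previous system, the block of the first letter need not contain the last one; the
  remaining word after that block is doubled and contributes the factor \<open>pull M\<close>.
\<close>

lemma product_moment_system:
  assumes M: "M = 1 + ssub \<kappa> (\<lambda>x. zvar x * M)"
  defines "P \<equiv> \<lambda>i. pull (zvar (Inl i) * M)" and "Q \<equiv> \<lambda>j. pull (M * zvar (Inr j))"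
  shows "P i = zvar i * ssub (\<lambda>r. g (i # r)) Q * pull M"
    and "Q j = pull M * ssub (\<lambda>r. f (r @ [j])) P * zvar j"
    and "pull M = 1 + ssub f P"
proof -
  have "const (\<kappa> []) = (0 :: ('k + 'k) ncseries)"
    by (rule ncseries_eqI) (use joint_Inl[of f g "[]"] in \<open>simp add: \<kappa>_def f0\<close>)
  then have M1: "M = 1 + sandwich \<kappa> M * M"
    using M unfolding ssub_sandwich(1) by (simp only: add_0_left)
  note M2 = moment_series_comm[OF M1]
  have ends: "cf (sandwich \<kappa> M) (Inr i # w @ [Inl j]) = 0" for i j w
    by (rule cf_sandwich_ends) (rule joint_ends)
  have "zvar (Inl i) * M = zvar (Inl i) + zvar (Inl i) * sandwich \<kappa> M * M"
    by (subst M1) (simp add: algebra_simps)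
  moreover have "pull (zvar (Inl i)) = 0"
    by (rule ncseries_eqI, case_tac w) (simp_all add: cf_zvar)
  moreover have "pull (zvar (Inl i) * sandwich \<kappa> M * M) = pull (zvar (Inl i) * sandwich \<kappa> M) * pull M"
  proof (rule pull_mult)
    fix v j w
    have "cf (zvar (Inl i) * sandwich \<kappa> M) (dbl v @ [Inl j]) = 0"
      by (cases v) (simp_all add: ends)
    then show "cf (zvar (Inl i) * sandwich \<kappa> M) (dbl v @ [Inl j]) = 0 \<or> cf M (Inr j # dbl w) = 0" ..
  qed
  ultimately show "P i = zvar i * ssub (\<lambda>r. g (i # r)) Q * pull M"
    unfolding P_def by (simp add: pull_add pull_sandwich_left Q_def mult.assoc)
  have "M * zvar (Inr j) = zvar (Inr j) + M * (sandwich \<kappa> M * zvar (Inr j))"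
    by (subst M2) (simp add: algebra_simps)
  moreover have "pull (zvar (Inr j)) = 0"
    by (rule ncseries_eqI, case_tac w) (simp_all add: cf_zvar)
  moreover have "pull (M * (sandwich \<kappa> M * zvar (Inr j))) = pull M * pull (sandwich \<kappa> M * zvar (Inr j))"
  proof (rule pull_mult)
    fix v i w
    have "cf (sandwich \<kappa> M * zvar (Inr j)) (Inr i # dbl w) = 0"
    proof (cases w rule: dbl_snoc_cases)
      case 1
      have "cf (sandwich \<kappa> M * zvar (Inr j)) ([] @ [Inr i]) = 0"
        by (subst cf_mult_zvar_snoc) simp
      with 1 show ?thesis by simp
    next
      case (2 v l)
      have "cf (sandwich \<kappa> M * zvar (Inr j)) ((Inr i # dbl v @ [Inl l]) @ [Inr l]) = 0"
        by (subst cf_mult_zvar_snoc) (simp add: ends)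
      with 2 show ?thesis by simp
    qed
    then show "cf M (dbl v @ [Inl i]) = 0 \<or> cf (sandwich \<kappa> M * zvar (Inr j)) (Inr i # dbl w) = 0" ..
  qed
  ultimately show "Q j = pull M * ssub (\<lambda>r. f (r @ [j])) P * zvar j"
    unfolding Q_def by (simp add: pull_add pull_sandwich_right P_def mult.assoc)
  have "pull (1 + ssub \<kappa> (\<lambda>x. zvar x * M)) = 1 + ssub f P"
    by (simp add: pull_add pull_ssub_joint P_def)
  with arg_cong[OF M, of pull] show "pull M = 1 + ssub f P" by (rule trans)
qed

end

text \<open>
  Combines both systems: whatever family \<open>h\<close> is computed from \<open>f\<close> and \<open>g\<close> by \<open>Z\<close> is the family of
  cumulants of the products.
\<close>

theorem product_moment_series:
  fixes f g :: "'k::finite list \<Rightarrow> complex"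
  assumes "f [] = 0" "g [] = 0" "Z = sandwich (joint f g) Z"
    and "M = 1 + ssub (joint f g) (\<lambda>x. zvar x * M)"
  shows "pull M = 1 + ssub (cf (pull (Z * Z))) (\<lambda>i. zvar i * pull M)"
proof -
  define P where "P i = pull (zvar (Inl i) * M)" for i
  define Q where "Q j = pull (M * zvar (Inr j))" for j
  define p where "p i = pull (zvar (Inl i) * Z)" for i
  define q where "q j = pull (Z * zvar (Inr j))" for j
  note M = product_moment_system[OF assms(1,2,4)] and Z = cpl_series_system[OF assms(1-3)]
  show ?thesis
  proof (rule product_cumulants[where P = P and Q = Q and p = p and q = q and f = f and g = g])
    show "P i = zvar i * ssub (\<lambda>r. g (i # r)) Q * pull M" for i
      unfolding P_def Q_def by (rule M(1))
    show "Q j = pull M * ssub (\<lambda>r. f (r @ [j])) P * zvar j" for j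
      unfolding P_def Q_def by (rule M(2))
    show "pull M = 1 + ssub f P"
      unfolding P_def by (rule M(3))
    show "p i = zvar i * ssub (\<lambda>r. g (i # r)) q" for i
      unfolding p_def q_def by (rule Z(1))
    show "q j = ssub (\<lambda>r. f (r @ [j])) p * zvar j" for j
      unfolding p_def q_def by (rule Z(2))
    show "cf (pull (Z * Z)) = cf (ssub f p)"
      unfolding p_def by (subst Z(3)) (rule refl)
  qed
qed

text \<open>
  If \<open>g\<close> is constantly 1 on non-empty words, then \<open>g (i # r) = cf 1 r + g r\<close>.  Thus
  \<open>p i = zvar i * (1 + h)\<close> with \<open>h\<close> the value of \<open>g\<close> at \<open>q\<close>, and \<open>h = f(p)\<close> becomes the functional
  equation of the moment series with cumulants \<open>f\<close>.
\<close>

theorem moment_series_boxed_const: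
  fixes f :: "'k::finite list \<Rightarrow> complex"
  defines "g \<equiv> \<lambda>u. if u = [] then 0 else 1"
  assumes f: "f [] = 0" and Z: "Z = sandwich (joint f g) Z"
  defines "M \<equiv> 1 + pull (Z * Z)"
  shows "M = 1 + ssub f (\<lambda>i. zvar i * M)"
proof -
  have g: "g [] = 0" by (simp add: g_def)
  define q where "q j = pull (Z * zvar (Inr j))" for j
  have q0: "cf (q j) [] = 0" for j by (simp add: q_def cf_zvar)
  have "ssub (\<lambda>r. g (i # r)) q = M" for i
  proof -
    have "(\<lambda>r. g (i # r)) = (\<lambda>r. cf 1 r + g r)" by (auto simp: g_def cf_one)
    then show ?thesis
      using cpl_series_system(4)[OF f g Z] by (simp add: ssub_add ssub_one q0 M_def q_def[abs_def])
  qed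
  then have "(\<lambda>i. pull (zvar (Inl i) * Z)) = (\<lambda>i. zvar i * M)"
    using cpl_series_system(1)[OF f g Z] by (simp add: q_def[abs_def])
  then show ?thesis
    using cpl_series_system(3)[OF f g Z] by (simp add: M_def)
qed

section \<open>Non-crossing partitions and their Kreweras complements\<close>

definition noncrossing :: "nat set set \<Rightarrow> bool" where
  "noncrossing \<tau> \<longleftrightarrow> (\<forall>B\<in>\<tau>. \<forall>C\<in>\<tau>. \<forall>a b c d. a < b \<and> b < c \<and> c < d \<and>
     a \<in> B \<and> c \<in> B \<and> b \<in> C \<and> d \<in> C \<longrightarrow> B = C)"

lemma NC_iff: "\<pi> \<in> NC n \<longleftrightarrow> partition_on {..<n} \<pi> \<and> noncrossing \<pi>"
  by (simp add: NC_def noncrossing_def)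

lemma noncrossingD:
  "noncrossing \<tau> \<Longrightarrow> B \<in> \<tau> \<Longrightarrow> C \<in> \<tau> \<Longrightarrow> a \<in> B \<Longrightarrow> c \<in> B \<Longrightarrow> b \<in> C \<Longrightarrow> d \<in> C \<Longrightarrow>
    a < b \<Longrightarrow> b < c \<Longrightarrow> c < d \<Longrightarrow> B = C"
  unfolding noncrossing_def by blast

lemma noncrossing_subset: "noncrossing \<tau> \<Longrightarrow> \<tau>' \<subseteq> \<tau> \<Longrightarrow> noncrossing \<tau>'"
  unfolding noncrossing_def by blast

lemma partition_on_same:
  "partition_on A \<tau> \<Longrightarrow> B \<in> \<tau> \<Longrightarrow> C \<in> \<tau> \<Longrightarrow> i \<in> B \<Longrightarrow> i \<in> C \<Longrightarrow> B = C"
  unfolding partition_on_def disjoint_def by blast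

lemma partition_on_block: "partition_on A \<tau> \<Longrightarrow> B \<in> \<tau> \<Longrightarrow> B \<subseteq> A \<and> B \<noteq> {}"
  unfolding partition_on_def by blast

lemma partition_on_finite_block: "partition_on A \<tau> \<Longrightarrow> finite A \<Longrightarrow> B \<in> \<tau> \<Longrightarrow> finite B"
  by (meson finite_subset partition_on_block)

lemma partition_on_obtain:
  assumes "partition_on A \<tau>" "i \<in> A" obtains B where "B \<in> \<tau>" "i \<in> B"
  using assms unfolding partition_on_def by blast

subsection \<open>The cyclic successor in a block\<close>

text \<open>
  The cycle of \<open>block_perm\<close> on a single block.
\<close>

definition next_in :: "nat set \<Rightarrow> nat \<Rightarrow> nat" where
  "next_in B i = (if i = Max B then Min B else Min {j \<in> B. i < j})"

lemma block_perm_next_in: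
  assumes "partition_on A \<tau>" "B \<in> \<tau>" "i \<in> B"
  shows "block_perm \<tau> i = next_in B i"
proof -
  have "(THE B. B \<in> \<tau> \<and> i \<in> B) = B"
    using assms partition_on_same[OF assms(1)] by (intro the_equality) auto
  with assms show ?thesis by (auto simp: block_perm_def next_in_def)
qed

lemma block_perm_outside: "partition_on A \<tau> \<Longrightarrow> i \<notin> A \<Longrightarrow> block_perm \<tau> i = i"
  by (auto simp: block_perm_def partition_on_def)

lemma Max_Min_mem: "finite B \<Longrightarrow> i \<in> B \<Longrightarrow> Max B \<in> B \<and> Min B \<in> B" for B :: "nat set"
  using Max_in Min_in by blast

lemma next_in_greater:
  assumes "finite B" "i \<in> B" "i \<noteq> Max B"
  shows "next_in B i \<in> B" "i < next_in B i" "\<And>j. j \<in> B \<Longrightarrow> i < j \<Longrightarrow> next_in B i \<le> j"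
proof -
  have *: "finite {j \<in> B. i < j}" "{j \<in> B. i < j} \<noteq> {}"
    using assms Max_Min_mem[OF assms(1,2)] Max_ge[OF assms(1,2)]
    by (auto intro!: exI[of _ "Max B"] simp: order_less_le)
  then show "next_in B i \<in> B" "i < next_in B i"
    using Min_in[OF *] assms by (auto simp: next_in_def)
  show "next_in B i \<le> j" if "j \<in> B" "i < j" for j
    using that assms * by (auto simp: next_in_def intro!: Min_le)
qed

lemma next_in_mem: "finite B \<Longrightarrow> i \<in> B \<Longrightarrow> next_in B i \<in> B"
  using next_in_greater(1)[of B i] Max_Min_mem[of B i] by (cases "i = Max B") (auto simp: next_in_def)

lemma next_in_Max [simp]: "next_in B (Max B) = Min B"
  by (simp add: next_in_def)

lemma next_in_inj: assumes B: "finite B" "i \<in> B" "j \<in> B" and eq: "next_in B i = next_in B j" shows "i = j"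
proof -
  have "\<not> i < j" if "i \<in> B" "j \<in> B" "next_in B i = next_in B j" for i j
  proof
    assume "i < j"
    then have i: "i \<noteq> Max B" using Max_ge[OF B(1) that(2)] by linarith
    note n = next_in_greater[OF B(1) that(1) i]
    show False
    proof (cases "j = Max B")
      case True
      then show ?thesis using n(2) that Min_le[OF B(1) that(1)] by simp
    next
      case False
      then show ?thesis using next_in_greater(2)[OF B(1) that(2)] n(3)[OF that(2) \<open>i < j\<close>] that(3) by simp
    qed
  qed
  from this[OF B(2,3) eq] this[OF B(3,2) eq[symmetric]] show ?thesis by simp
qed

lemma next_in_unique:
  assumes "finite B" "i \<in> B" "m \<in> B" "i < m" "\<And>j. j \<in> B \<Longrightarrow> i < j \<Longrightarrow> m \<le> j"
  shows "next_in B i = m"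
proof -
  have "i \<noteq> Max B" using assms(4) Max_ge[OF assms(1,3)] by linarith
  from next_in_greater[OF assms(1,2) this] assms(3-5) show ?thesis by (simp add: order_antisym)
qed

text \<open>
  Beyond its maximum \<open>S\<close> could still be continued, so it contains the maximum of \<open>B\<close>; hence also the
  minimum, and from there every element as the successor of the preceding one.
\<close>

lemma closed_under_next_in:
  assumes B: "finite B" and S: "S \<subseteq> B" "S \<noteq> {}" "\<And>i. i \<in> S \<Longrightarrow> next_in B i \<in> S"
  shows "S = B"
proof -
  have fS: "finite S" using B S finite_subset by blast
  have "Max S = Max B"
  proof (rule ccontr)
    assume *: "Max S \<noteq> Max B"
    have "Max S \<in> S" using fS S by simp
    then have "next_in B (Max S) \<in> S" "Max S < next_in B (Max S)"
      using S next_in_greater[OF B _ *] by auto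
    then show False using fS by (meson Max_ge leD)
  qed
  then have min: "Min B \<in> S" using S(3)[OF Max_in[OF fS S(2)]] by simp
  have "j \<in> S" if "j \<in> B" for j
    using that
  proof (induction j rule: less_induct)
    case (less j)
    show ?case
    proof (cases "j = Min B")
      case False
      define i where "i = Max {i \<in> B. i < j}"
      have "{i \<in> B. i < j} \<noteq> {}"
        using False less.prems B Min_le[OF B less.prems] Max_Min_mem[OF B less.prems]
        by (auto intro!: exI[of _ "Min B"] simp: order_less_le)
      then have "i \<in> {i \<in> B. i < j}" unfolding i_def using B by (intro Max_in) auto
      moreover have "l \<le> i" if "l \<in> B" "l < j" for l
        unfolding i_def using that B by (intro Max_ge) auto
      ultimately have "next_in B i = j" "i \<in> S"
        using less B by (auto intro!: next_in_unique simp: not_less[symmetric])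
      then show ?thesis using S(3) by blast
    qed (use min in simp)
  qed
  with S show ?thesis by blast
qed

lemma block_perm_determines:
  assumes "partition_on A \<rho>" "partition_on A \<rho>'" "finite A" "block_perm \<rho> = block_perm \<rho>'"
  shows "\<rho> = \<rho>'"
proof -
  have "B \<in> \<rho>'" if part: "partition_on A \<rho>" "partition_on A \<rho>'" and eq: "block_perm \<rho> = block_perm \<rho>'"
    and B: "B \<in> \<rho>" for \<rho> \<rho>' B
  proof -
    obtain i where i: "i \<in> B" "i \<in> A" using partition_on_block[OF part(1) B] by blast
    then obtain B' where B': "B' \<in> \<rho>'" "i \<in> B'" using partition_on_obtain[OF part(2)] by blast
    have fin: "finite B" "finite B'" using part B B' assms(3) by (auto intro: partition_on_finite_block)
    have same: "next_in B j = next_in B' j" if "j \<in> B \<inter> B'" for j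
      using that block_perm_next_in[OF part(1) B, of j] block_perm_next_in[OF part(2) B'(1), of j] eq by simp
    have "next_in B j \<in> B \<inter> B'" if "j \<in> B \<inter> B'" for j
      using next_in_mem[OF fin(1), of j] next_in_mem[OF fin(2), of j] same[OF that] that by simp
    note step = this
    have ne: "B \<inter> B' \<noteq> {}" using i B' by blast
    have "B \<inter> B' = B"
      by (rule closed_under_next_in[OF fin(1) Int_lower1 ne step])
    moreover have "B \<inter> B' = B'"
    proof (rule closed_under_next_in[OF fin(2) Int_lower2 ne])
      show "next_in B' j \<in> B \<inter> B'" if "j \<in> B \<inter> B'" for j
        using step[OF that] same[OF that] by simp
    qed
    ultimately have "B = B'" by simp
    with B' show ?thesis by simp
  qed
  from this[OF assms(1,2,4)] this[OF assms(2,1) assms(4)[symmetric]] show ?thesis by blast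
qed

lemma inj_block_perm:
  assumes "partition_on A \<tau>" "finite A" shows "inj (block_perm \<tau>)"
proof (rule injI)
  fix i j assume eq: "block_perm \<tau> i = block_perm \<tau> j"
  have mem: "block_perm \<tau> i \<in> B" if "B \<in> \<tau>" "i \<in> B" for i B
    using that block_perm_next_in[OF assms(1) that] next_in_mem partition_on_finite_block[OF assms] by metis
  have blk: "\<exists>B\<in>\<tau>. i \<in> B" if "i \<in> A" for i using assms(1) that by (auto simp: partition_on_def)
  have sub: "B \<in> \<tau> \<Longrightarrow> B \<subseteq> A" for B using partition_on_block[OF assms(1)] by blast
  show "i = j"
  proof (cases "i \<in> A")
    case True
    then obtain B where B: "B \<in> \<tau>" "i \<in> B" using blk by blast
    have "j \<in> A"
      using block_perm_outside[OF assms(1), of j] eq mem[OF B] sub[OF B(1)] by (cases "j \<in> A") auto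
    then obtain C where C: "C \<in> \<tau>" "j \<in> C" using blk by blast
    have "B = C" using partition_on_same[OF assms(1) B(1) C(1)] mem[OF B] mem[OF C] eq by simp
    then show ?thesis
      using B C eq block_perm_next_in[OF assms(1)] partition_on_finite_block[OF assms] next_in_inj by metis
  next
    case False
    then have "j \<notin> A"
      using block_perm_outside[OF assms(1), of i] eq blk mem sub by (metis subsetD)
    with False show ?thesis using eq block_perm_outside[OF assms(1)] by simp
  qed
qed

lemma block_perm_top:
  assumes i: "i < n" shows "block_perm {{..<n}} i = (if Suc i = n then 0 else Suc i)"
proof -
  have "partition_on {..<n} {{..<n}}" using i by (auto simp: partition_on_def disjoint_def)
  then have "block_perm {{..<n}} i = next_in {..<n} i"
    by (rule block_perm_next_in) (use i in auto)
  also have "\<dots> = (if Suc i = n then 0 else Suc i)"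
  proof (cases "Suc i = n")
    case True
    moreover have "Max {..<n} = n - 1" using i by (intro Max_eqI) auto
    moreover have "Min {..<n} = 0" using i by (intro Min_eqI) auto
    ultimately show ?thesis by (auto simp: next_in_def)
  next
    case False
    with i have "next_in {..<n} i = Suc i" by (intro next_in_unique) auto
    with False show ?thesis by simp
  qed
  finally show ?thesis .
qed

text \<open>
  Composing with the permutation of \<open>\<pi>\<close> replaces its inverse in the definition of the complement.
\<close>

lemma krewerasI:
  assumes \<pi>: "\<pi> \<in> NC n" and \<rho>: "\<rho> \<in> NC n"
    and perm: "\<And>i. i < n \<Longrightarrow> block_perm \<pi> (block_perm \<rho> i) = (if Suc i = n then 0 else Suc i)"
  shows "kreweras n \<pi> = \<rho>"
proof -
  have part: "partition_on {..<n} \<pi>" "partition_on {..<n} \<rho>" using \<pi> \<rho> by (simp_all add: NC_iff)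
  have inj: "inj (block_perm \<pi>)" by (rule inj_block_perm[OF part(1)]) simp
  have "block_perm \<rho> i = inv_into UNIV (block_perm \<pi>) (block_perm {{..<n}} i)" for i
  proof (cases "i < n")
    case True
    then have "block_perm {{..<n}} i = (if Suc i = n then 0 else Suc i)" by (rule block_perm_top)
    then show ?thesis using perm[OF True] inv_f_f[OF inj] by metis
  next
    case False
    have "block_perm {{..<n}} i = i"
      using False by (auto simp: block_perm_def)
    moreover have "block_perm \<pi> i = i" "block_perm \<rho> i = i"
      using False part by (auto intro!: block_perm_outside)
    ultimately show ?thesis using inv_f_f[OF inj] by metis
  qed
  then have eq: "block_perm \<rho> = inv_into UNIV (block_perm \<pi>) \<circ> block_perm {{..<n}}" by auto
  show ?thesis
    unfolding kreweras_def
  proof (rule the_equality)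
    show "\<rho> \<in> NC n \<and> block_perm \<rho> = inv_into UNIV (block_perm \<pi>) \<circ> block_perm {{..<n}}"
      using \<rho> eq by simp
    show "\<rho>' = \<rho>" if "\<rho>' \<in> NC n \<and> block_perm \<rho>' = inv_into UNIV (block_perm \<pi>) \<circ> block_perm {{..<n}}" for \<rho>'
      using that eq part by (intro block_perm_determines[of "{..<n}"]) (auto simp: NC_iff)
  qed
qed

subsection \<open>Complementary pairs on an interval\<close>

text \<open>
  Let the positions \<open>s, \<dots>, t\<close>, with \<open>t - s\<close> even, be coloured by parity.  \<open>cpl s B \<sigma> t\<close> says that
  \<open>B\<close> together with \<open>\<sigma>\<close> is a non-crossing partition with monochromatic blocks such that \<open>B\<close> contains
  \<open>s\<close> and \<open>t\<close> and the partition of either colour is the coarsest one that the other allows.  If \<open>Suc r\<close> is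
  the second element of \<open>B\<close>, then the positions \<open>Suc s, \<dots>, r\<close> enclosed by \<open>s\<close> and \<open>Suc r\<close> carry a
  partition of the same kind for the exchanged colours: as nothing separates \<open>Suc s\<close> from \<open>r\<close>, the
  coarsest choice puts them into one block.
\<close>

inductive cpl :: "nat \<Rightarrow> nat set \<Rightarrow> nat set set \<Rightarrow> nat \<Rightarrow> bool" where
  cpl_single: "cpl s {s} {} s"
| cpl_join: "cpl (Suc s) B1 \<sigma>1 r \<Longrightarrow> cpl (Suc r) B2 \<sigma>2 t \<Longrightarrow>
    cpl s (insert s B2) (insert B1 (\<sigma>1 \<union> \<sigma>2)) t"

lemma partition_on_union:
  assumes P: "partition_on A P" and Q: "partition_on B Q" and AB: "A \<inter> B = {}"
  shows "partition_on (A \<union> B) (P \<union> Q)"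
proof (rule partition_onI)
  have PQ: "p \<inter> q = {}" if "p \<in> P" "q \<in> Q" for p q
    using partition_on_block[OF P that(1)] partition_on_block[OF Q that(2)] AB by blast
  have PP: "p \<inter> q = {}" if "p \<in> P" "q \<in> P" "p \<noteq> q" for p q
    using partition_on_same[OF P that(1,2)] that(3) by blast
  have QQ: "p \<inter> q = {}" if "p \<in> Q" "q \<in> Q" "p \<noteq> q" for p q
    using partition_on_same[OF Q that(1,2)] that(3) by blast
  show "disjnt p q" if "p \<in> P \<union> Q" "q \<in> P \<union> Q" "p \<noteq> q" for p q
    unfolding disjnt_def using that PQ[of p q] PQ[of q p] PP[of p q] QQ[of p q] by (auto simp: Int_commute)
  show "\<Union>(P \<union> Q) = A \<union> B" using partition_onD1[OF P] partition_onD1[OF Q] by simp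
  show "{} \<notin> P \<union> Q" using partition_onD3[OF P] partition_onD3[OF Q] by simp
qed

lemma partition_on_insert_block:
  assumes "B \<notin> \<sigma>"
  shows "partition_on A (insert B \<sigma>) \<longleftrightarrow> partition_on (A - B) \<sigma> \<and> B \<subseteq> A \<and> B \<noteq> {}"
proof (cases "disjnt B (\<Union>\<sigma>)")
  case False
  then obtain C i where "C \<in> \<sigma>" "i \<in> B" "i \<in> C" by (auto simp: disjnt_def)
  then have "\<not> partition_on A (insert B \<sigma>)" "\<not> partition_on (A - B) \<sigma>"
    using partition_on_same[of A "insert B \<sigma>" B C i] partition_on_block[of "A - B" \<sigma> C] assms by auto
  then show ?thesis by simp
qed (rule partition_on_insert)

lemma cpl_partition:
  assumes "cpl s B \<sigma> t"
  shows "s \<in> B \<and> t \<in> B \<and> B \<notin> \<sigma> \<and> partition_on {s..t} (insert B \<sigma>)"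
  using assms
proof induction
  case (cpl_single s)
  then show ?case by (auto simp: partition_on_def disjoint_def)
next
  case (cpl_join s B1 \<sigma>1 r B2 \<sigma>2 t)
  have p1: "partition_on {Suc s..r} (insert B1 \<sigma>1)"
    and B: "Suc s \<in> B1" "r \<in> B1" "Suc r \<in> B2" "t \<in> B2" "B2 \<notin> \<sigma>2"
    using cpl_join.IH by blast+
  have p2: "partition_on ({Suc r..t} - B2) \<sigma>2" and B2: "B2 \<subseteq> {Suc r..t}"
    using cpl_join.IH(2) partition_on_insert_block[OF B(5)] by simp_all
  have le: "Suc s \<le> r" "Suc r \<le> t" using partition_on_block[OF p1, of B1] B B2 by auto
  have "partition_on ({Suc s..r} \<union> ({Suc r..t} - B2)) (insert B1 \<sigma>1 \<union> \<sigma>2)"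
    by (rule partition_on_union[OF p1 p2]) auto
  also have "{Suc s..r} \<union> ({Suc r..t} - B2) = {s..t} - insert s B2"
    using le B2 by auto
  finally have p: "partition_on ({s..t} - insert s B2) (insert B1 (\<sigma>1 \<union> \<sigma>2))" by simp
  moreover have new: "insert s B2 \<notin> insert B1 (\<sigma>1 \<union> \<sigma>2)"
    using partition_on_block[OF p] by blast
  moreover have "insert s B2 \<subseteq> {s..t}" using le B2 by auto
  ultimately have "partition_on {s..t} (insert (insert s B2) (insert B1 (\<sigma>1 \<union> \<sigma>2)))"
    using partition_on_insert_block[OF new] by simp
  with new B show ?case by blast
qed

lemma cpl_block_subset:
  assumes "cpl s B \<sigma> t" "C \<in> insert B \<sigma>" shows "C \<subseteq> {s..t}" "C \<noteq> {}"
  using cpl_partition[OF assms(1)] partition_on_block assms(2) by blast+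

lemma cpl_le: "cpl s B \<sigma> t \<Longrightarrow> s \<le> t"
  using cpl_partition[of s B \<sigma> t] cpl_block_subset(1)[of s B \<sigma> t B] by auto

lemma cpl_same_parity:
  assumes "cpl s B \<sigma> t" "C \<in> insert B \<sigma>" "i \<in> C" "j \<in> C" shows "even i \<longleftrightarrow> even j"
proof -
  have "\<forall>C\<in>insert B \<sigma>. \<exists>e. \<forall>i\<in>C. even i \<longleftrightarrow> e"
    using assms(1)
  proof induction
    case (cpl_join s B1 \<sigma>1 r B2 \<sigma>2 t)
    have mem: "Suc s \<in> B1" "r \<in> B1" "Suc r \<in> B2"
      using cpl_partition[OF cpl_join(1)] cpl_partition[OF cpl_join(2)] by auto
    obtain e1 where e1: "\<forall>i\<in>B1. even i \<longleftrightarrow> e1" using bspec[OF cpl_join.IH(1), of B1] by auto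
    obtain e2 where e2: "\<forall>i\<in>B2. even i \<longleftrightarrow> e2" using bspec[OF cpl_join.IH(2), of B2] by auto
    have "even s \<longleftrightarrow> e2" using bspec[OF e1 mem(1)] bspec[OF e1 mem(2)] bspec[OF e2 mem(3)] by auto
    then have "\<exists>e. \<forall>i\<in>insert s B2. even i \<longleftrightarrow> e" using e2 by (intro exI[of _ e2]) simp
    note outer = this
    show ?case
    proof (rule ballI)
      fix C assume "C \<in> insert (insert s B2) (insert B1 (\<sigma>1 \<union> \<sigma>2))"
      then consider "C = insert s B2" | "C \<in> insert B1 \<sigma>1" | "C \<in> insert B2 \<sigma>2" by blast
      then show "\<exists>e. \<forall>i\<in>C. even i \<longleftrightarrow> e"
      proof cases
        case 1 with outer show ?thesis by (simp only:)
      next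
        case 2 then show ?thesis by (rule bspec[OF cpl_join.IH(1)])
      next
        case 3 then show ?thesis by (rule bspec[OF cpl_join.IH(2)])
      qed
    qed
  qed auto
  from bspec[OF this assms(2)] obtain e where "\<forall>i\<in>C. even i \<longleftrightarrow> e" by (rule exE)
  with assms(3,4) show ?thesis by simp
qed

lemma cpl_noncrossing:
  assumes "cpl s B \<sigma> t" shows "noncrossing (insert B \<sigma>)"
  using assms
proof induction
  case (cpl_single s)
  then show ?case by (auto simp: noncrossing_def)
next
  case (cpl_join s B1 \<sigma>1 r B2 \<sigma>2 t)
  note P1 = cpl_partition[OF cpl_join(1)] and P2 = cpl_partition[OF cpl_join(2)]
  note sub1 = cpl_block_subset(1)[OF cpl_join(1)] and sub2 = cpl_block_subset(1)[OF cpl_join(2)]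
  show ?case
    unfolding noncrossing_def
  proof (intro ballI allI impI, elim conjE)
    fix C D a b c d
    assume C: "C \<in> insert (insert s B2) (insert B1 (\<sigma>1 \<union> \<sigma>2))"
      and D: "D \<in> insert (insert s B2) (insert B1 (\<sigma>1 \<union> \<sigma>2))"
      and lt: "a < b" "b < c" "c < d" and mem: "a \<in> C" "c \<in> C" "b \<in> D" "d \<in> D"
    have in2: "x \<in> {Suc r..t} \<or> x = s" if "E \<in> insert (insert s B2) \<sigma>2" "x \<in> E" for E x
      using that sub2[of E] sub2[of B2] by blast
    have in1: "x \<in> {Suc s..r}" if "E \<in> insert B1 \<sigma>1" "x \<in> E" for E x
      using that sub1[of E] by auto
    consider "C \<in> insert B1 \<sigma>1" "D \<in> insert B1 \<sigma>1" | "C \<in> insert B1 \<sigma>1" "D \<in> insert (insert s B2) \<sigma>2"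
      | "C \<in> insert (insert s B2) \<sigma>2" "D \<in> insert B1 \<sigma>1"
      | "C \<in> insert (insert s B2) \<sigma>2" "D \<in> insert (insert s B2) \<sigma>2"
      using C D by blast
    then show "C = D"
    proof cases
      case 1
      then show ?thesis using noncrossingD[OF cpl_join.IH(1)] mem lt by blast
    next
      case 2
      then show ?thesis
        using in1[OF 2(1) mem(1)] in1[OF 2(1) mem(2)] in2[OF 2(2) mem(3)] lt by auto
    next
      case 3
      then show ?thesis
        using in1[OF 3(2) mem(3)] in1[OF 3(2) mem(4)] in2[OF 3(1) mem(2)] lt by auto
    next
      case 4
      have big: "Suc r \<le> b" "Suc r \<le> c" "Suc r \<le> d"
        using in2[OF 4(2) mem(3)] in2[OF 4(2) mem(4)] in2[OF 4(1) mem(2)] in2[OF 4(1) mem(1)] lt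
          cpl_le[OF cpl_join(1)] by auto
      \<comment> \<open>A crossing that involves \<open>s\<close> is one of the second part with \<open>Suc r\<close> in place of \<open>s\<close>.\<close>
      define C' where "C' = (if C = insert s B2 then B2 else C)"
      define D' where "D' = (if D = insert s B2 then B2 else D)"
      have ne_s: "b \<noteq> s" "c \<noteq> s" "d \<noteq> s" using big cpl_le[OF cpl_join(1)] by linarith+
      have C'D': "C' \<in> insert B2 \<sigma>2" "D' \<in> insert B2 \<sigma>2" "c \<in> C'" "b \<in> D'" "d \<in> D'"
        using 4 mem ne_s by (auto simp: C'_def D'_def)
      have "C' = D'"
      proof (cases "a = s")
        case True
        then have "C = insert s B2"
          using 4(1) mem(1) subsetD[OF sub2[of C], of a] cpl_le[OF cpl_join(1)] by auto
        then have "C' = B2" by (simp add: C'_def)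
        then have "Suc r \<in> C'" using P2 by simp
        show ?thesis
        proof (cases "b = Suc r")
          case True
          then show ?thesis using C'D' partition_on_same P2 \<open>Suc r \<in> C'\<close> by metis
        next
          case False
          then have "Suc r < b" using big by simp
          then show ?thesis
            using noncrossingD[OF cpl_join.IH(2) C'D'(1,2) \<open>Suc r \<in> C'\<close> C'D'(3-5)] lt by auto
        qed
      next
        case False
        then have "a \<in> C'" using mem by (auto simp: C'_def)
        then show ?thesis using noncrossingD[OF cpl_join.IH(2) C'D'(1,2) _ C'D'(3-5)] lt by auto
      qed
      then show ?thesis
        using 4 P2 by (auto simp: C'_def D'_def split: if_splits)
    qed
  qed
qed

text \<open>
  This is the equation \<open>P\<^sub>\<pi> P\<^sub>K\<^sub>(\<^sub>\<pi>\<^sub>) = P\<^sub>1\<close> in terms of the interleaved positions: each point of one colour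
  is the right neighbour of a point of the other one.
\<close>

lemma cpl_block_perm:
  assumes "cpl s B \<sigma> t"
  defines "bp \<equiv> block_perm (insert B \<sigma>)"
  shows "bp t = s" and "\<And>j. s \<le> j \<Longrightarrow> j < t \<Longrightarrow> s < bp j \<and> bp j \<le> t \<and> bp (bp j - 1) = Suc j"
proof -
  have bp_le: "block_perm (insert B \<sigma>) j \<in> {s..t}" if h: "cpl s B \<sigma> t" "j \<in> {s..t}" for s B \<sigma> t j
  proof -
    have P: "partition_on {s..t} (insert B \<sigma>)" using cpl_partition[OF h(1)] by blast
    obtain C where C: "C \<in> insert B \<sigma>" "j \<in> C" by (rule partition_on_obtain[OF P h(2)])
    then have "block_perm (insert B \<sigma>) j \<in> C"
      unfolding block_perm_next_in[OF P C] using partition_on_finite_block[OF P _ C(1)] C(2)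
      by (intro next_in_mem) simp_all
    then show ?thesis using cpl_block_subset(1)[OF h(1) C(1)] by blast
  qed
  have "block_perm (insert B \<sigma>) t = s \<and>
      (\<forall>j. s \<le> j \<and> j < t \<longrightarrow> s < block_perm (insert B \<sigma>) j \<and>
        block_perm (insert B \<sigma>) (block_perm (insert B \<sigma>) j - 1) = Suc j)"
    using assms(1)
  proof induction
    case (cpl_single s)
    have "block_perm {{s}} s = next_in {s} s"
      by (rule block_perm_next_in[of "{s}"]) (auto simp: partition_on_def disjoint_def)
    then show ?case by (simp add: next_in_def)
  next
    case (cpl_join s B1 \<sigma>1 r B2 \<sigma>2 t)
    let ?\<tau> = "insert (insert s B2) (insert B1 (\<sigma>1 \<union> \<sigma>2))"
    note J = cpl.cpl_join[OF cpl_join(1,2)]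
    have P1: "partition_on {Suc s..r} (insert B1 \<sigma>1)" and P2: "partition_on {Suc r..t} (insert B2 \<sigma>2)"
      and P: "partition_on {s..t} ?\<tau>"
      using cpl_partition[OF cpl_join(1)] cpl_partition[OF cpl_join(2)] cpl_partition[OF J] by blast+
    have B2: "Suc r \<in> B2" "t \<in> B2" "B2 \<subseteq> {Suc r..t}" "finite B2"
      using cpl_partition[OF cpl_join(2)] cpl_block_subset(1)[OF cpl_join(2), of B2]
        partition_on_finite_block[OF P2, of B2] by auto
    note le = cpl_le[OF cpl_join(1)] cpl_le[OF cpl_join(2)]
    have max: "Max (insert s B2) = t" "Max B2 = t" and min: "Min (insert s B2) = s" "Min B2 = Suc r"
      using B2 le by (auto intro!: Max_eqI Min_eqI)
    have bp1: "block_perm ?\<tau> j = block_perm (insert B1 \<sigma>1) j" if j: "j \<in> {Suc s..r}" for j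
    proof -
      obtain C where C: "C \<in> insert B1 \<sigma>1" "j \<in> C" by (rule partition_on_obtain[OF P1 j])
      then show ?thesis
        using block_perm_next_in[OF P1 C] block_perm_next_in[OF P, of C j] by auto
    qed
    have bp2: "block_perm ?\<tau> j = block_perm (insert B2 \<sigma>2) j" if j: "j \<in> {Suc r..t}" "j \<noteq> t" for j
    proof -
      obtain C where C: "C \<in> insert B2 \<sigma>2" "j \<in> C" by (rule partition_on_obtain[OF P2 j(1)])
      show ?thesis
      proof (cases "C = B2")
        case True
        have "{i \<in> insert s B2. j < i} = {i \<in> B2. j < i}" using j le by auto
        then have "next_in (insert s B2) j = next_in B2 j"
          using j max by (simp add: next_in_def)
        then show ?thesis
          using block_perm_next_in[OF P2 C] block_perm_next_in[OF P, of "insert s B2" j] C True by auto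
      next
        case False
        then show ?thesis
          using block_perm_next_in[OF P2 C] block_perm_next_in[OF P, of C j] C by auto
      qed
    qed
    have bps: "block_perm ?\<tau> s = Suc r"
    proof -
      have "next_in (insert s B2) s = Suc r"
        using B2 le by (intro next_in_unique) auto
      then show ?thesis using block_perm_next_in[OF P, of "insert s B2" s] by simp
    qed
    have bpt: "block_perm ?\<tau> t = s"
      using block_perm_next_in[OF P, of "insert s B2" t] B2 max min next_in_Max[of "insert s B2"] by simp
    have r1: "block_perm (insert B1 \<sigma>1) r = Suc s"
      and r2: "\<And>j. Suc s \<le> j \<Longrightarrow> j < r \<Longrightarrow> Suc s < block_perm (insert B1 \<sigma>1) j \<and>
        block_perm (insert B1 \<sigma>1) (block_perm (insert B1 \<sigma>1) j - 1) = Suc j"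
      using cpl_join.IH(1) by auto
    have r3: "\<And>j. Suc r \<le> j \<Longrightarrow> j < t \<Longrightarrow> Suc r < block_perm (insert B2 \<sigma>2) j \<and>
        block_perm (insert B2 \<sigma>2) (block_perm (insert B2 \<sigma>2) j - 1) = Suc j"
      using cpl_join.IH(2) by auto
    have "s < block_perm ?\<tau> j \<and> block_perm ?\<tau> (block_perm ?\<tau> j - 1) = Suc j" if j: "s \<le> j" "j < t" for j
    proof -
      consider "j = s" | "Suc s \<le> j" "j < r" | "j = r" "Suc s \<le> r" | "Suc r \<le> j" using j by linarith
      then show ?thesis
      proof cases
        case 1
        then show ?thesis using bps bp1[of r] r1 le by simp
      next
        case 2
        define m where "m = block_perm (insert B1 \<sigma>1) j"
        have "m \<in> {Suc s..r}" unfolding m_def using bp_le[OF cpl_join(1), of j] 2 by auto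
        moreover have "block_perm ?\<tau> j = m" unfolding m_def using 2 by (intro bp1) auto
        moreover have m: "Suc s < m" "block_perm (insert B1 \<sigma>1) (m - 1) = Suc j"
          using r2[OF 2] by (simp_all add: m_def)
        moreover have "block_perm ?\<tau> (m - 1) = block_perm (insert B1 \<sigma>1) (m - 1)"
          using \<open>m \<in> {Suc s..r}\<close> m by (intro bp1) auto
        ultimately show ?thesis by simp
      next
        case 3
        then show ?thesis using bp1[of r] r1 bps by simp
      next
        case 4
        define m where "m = block_perm (insert B2 \<sigma>2) j"
        have "m \<in> {Suc r..t}" unfolding m_def using bp_le[OF cpl_join(2), of j] 4 j by auto
        moreover have "block_perm ?\<tau> j = m" unfolding m_def using 4 j by (intro bp2) auto
        moreover have m: "Suc r < m" "block_perm (insert B2 \<sigma>2) (m - 1) = Suc j"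
          using r3[OF 4 j(2)] by (simp_all add: m_def)
        moreover have "block_perm ?\<tau> (m - 1) = block_perm (insert B2 \<sigma>2) (m - 1)"
          using \<open>m \<in> {Suc r..t}\<close> m by (intro bp2) auto
        ultimately show ?thesis using le by simp
      qed
    qed
    with bpt show ?case by blast
  qed
  then show "bp t = s" and "\<And>j. s \<le> j \<Longrightarrow> j < t \<Longrightarrow> s < bp j \<and> bp j \<le> t \<and> bp (bp j - 1) = Suc j"
    using bp_le[OF assms(1)] unfolding bp_def by auto
qed

lemma noncrossing_separated:
  assumes P: "partition_on A \<theta>" and nc: "noncrossing \<theta>" and B: "B \<in> \<theta>" "x \<in> B" "y \<in> B"
    and C: "C \<in> \<theta>" "C \<noteq> B" "i \<in> C" "x < i" "i < y" "j \<in> C"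
  shows "x < j \<and> j < y"
proof -
  have ne: "j \<noteq> x" "j \<noteq> y" using partition_on_same[OF P C(1) B(1)] C B by auto
  have "\<not> j < x" using noncrossingD[OF nc C(1) B(1) \<open>j \<in> C\<close> \<open>i \<in> C\<close> \<open>x \<in> B\<close> \<open>y \<in> B\<close>] C by auto
  moreover have "\<not> y < j" using noncrossingD[OF nc B(1) C(1) \<open>x \<in> B\<close> \<open>y \<in> B\<close> \<open>i \<in> C\<close> \<open>j \<in> C\<close>] C by auto
  ultimately show ?thesis using ne by linarith
qed

lemma partition_on_subfamily:
  assumes "partition_on A \<theta>" "\<theta>' \<subseteq> \<theta>" "\<And>C i. C \<in> \<theta> \<Longrightarrow> i \<in> C \<Longrightarrow> i \<in> A' \<longleftrightarrow> C \<in> \<theta>'" "A' \<subseteq> A"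
  shows "partition_on A' \<theta>'"
proof (rule partition_onI)
  show "\<Union>\<theta>' = A'"
    using assms partition_onD1[OF assms(1)] by blast
  show "disjnt p q" if "p \<in> \<theta>'" "q \<in> \<theta>'" "p \<noteq> q" for p q
    using partition_on_same[OF assms(1)] assms(2) that by (auto simp: disjnt_def)
  show "{} \<notin> \<theta>'" using partition_onD3[OF assms(1)] assms(2) by blast
qed

text \<open>
  The partition of one colour can be prescribed: arbitrarily for the colour not occurring at the ends, and
  with \<open>s\<close> and \<open>t\<close> in one block for the other colour.  The cut is found from the given partition, namely
  after the last element of the block of \<open>Suc s\<close> or before the second element of the block of \<open>s\<close>; one
  of the two pieces then falls under the first claim and the other one under the second.
\<close>

lemma cpl_exists:
  shows "partition_on {i\<in>{s..t}. odd (i + s)} \<theta> \<Longrightarrow> noncrossing \<theta> \<Longrightarrow> s \<le> t \<Longrightarrow> even (s + t) \<Longrightarrow>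
      \<exists>B \<sigma>. cpl s B \<sigma> t \<and> {C\<in>\<sigma>. \<forall>i\<in>C. odd (i + s)} = \<theta>"
    and "partition_on {i\<in>{s..t}. even (i + s)} \<theta> \<Longrightarrow> noncrossing \<theta> \<Longrightarrow> s \<le> t \<Longrightarrow> even (s + t) \<Longrightarrow>
      B0 \<in> \<theta> \<Longrightarrow> s \<in> B0 \<Longrightarrow> t \<in> B0 \<Longrightarrow> \<exists>\<sigma>. cpl s B0 \<sigma> t \<and> {C\<in>\<sigma>. \<forall>i\<in>C. even (i + s)} = \<theta> - {B0}"
proof (induction "t - s" arbitrary: s t \<theta> B0 rule: less_induct)
  case less
  {
    case 1
    note P = 1(1) and nc = 1(2)
    show ?case
    proof (cases "s = t")
      case True
      then have "{i \<in> {s..t}. odd (i + s)} = {}" by auto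
      then have "\<theta> = {}" using P by (simp only: partition_on_empty)
      then show ?thesis using cpl_single[of s] True by fastforce
    next
      case False
      then have st: "Suc s < t" using 1(3,4) by (metis add_Suc_right even_Suc even_add le_neq_implies_less Suc_lessI add.commute)
      then have "Suc s \<in> {i\<in>{s..t}. odd (i + s)}" by simp
      then obtain B1 where B1: "B1 \<in> \<theta>" "Suc s \<in> B1" by (rule partition_on_obtain[OF P])
      have sub: "i \<in> {Suc s..t} \<and> odd (i + s)" if "C \<in> \<theta>" "i \<in> C" for C i
        using partition_on_block[OF P that(1)] that(2) by (auto intro: Suc_leI le_neq_implies_less)
      have fin: "finite B1" using partition_on_finite_block[OF P _ B1(1)] by simp
      \<comment> \<open>The block of \<open>Suc s\<close> shields the positions up to its maximum from the later ones.\<close>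
      define r where "r = Max B1"
      have r: "r \<in> B1" unfolding r_def using Max_Min_mem[OF fin B1(2)] by blast
      have r_max: "i \<in> B1 \<Longrightarrow> i \<le> r" for i unfolding r_def using fin by (rule Max_ge)
      have rs: "Suc s \<le> r" "r \<le> t" "odd (r + s)" using sub[OF B1(1) r] by auto
      have rt: "r < t" using rs 1(4) by (metis add.commute le_neq_implies_less)
      define \<theta>1 where "\<theta>1 = {C\<in>\<theta>. C \<subseteq> {..r}}"
      define \<theta>2 where "\<theta>2 = {C\<in>\<theta>. \<not> C \<subseteq> {..r}}"
      have split: "i \<le> r \<longleftrightarrow> C \<subseteq> {..r}" if C: "C \<in> \<theta>" "i \<in> C" for C i
      proof (cases "C = B1")
        case True
        then show ?thesis using r_max that by auto
      next
        case False
        have ends: "Suc s \<notin> C" "r \<notin> C"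
          using False partition_on_same[OF P C(1) B1(1)] B1(2) r by auto
        have "j \<le> r" if "j \<in> C" "i \<in> C" "i \<le> r" for i j
        proof -
          have "Suc s < i" "i < r"
            using sub[OF C(1) that(2)] that ends by (auto simp: order_less_le)
          then show ?thesis
            using noncrossing_separated[OF P nc B1 r C(1) False that(2) _ _ that(1)] by simp
        qed
        then show ?thesis using C(2) by blast
      qed
      have P1: "partition_on {i\<in>{Suc s..r}. even (i + Suc s)} \<theta>1"
      proof (rule partition_on_subfamily[OF P])
        show "i \<in> {i\<in>{Suc s..r}. even (i + Suc s)} \<longleftrightarrow> C \<in> \<theta>1" if "C \<in> \<theta>" "i \<in> C" for C i
          using split[OF that] sub[OF that] that by (simp add: \<theta>1_def)
      qed (use rs in \<open>auto simp: \<theta>1_def\<close>)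
      have P2: "partition_on {i\<in>{Suc r..t}. odd (i + Suc r)} \<theta>2"
      proof (rule partition_on_subfamily[OF P])
        show "i \<in> {i\<in>{Suc r..t}. odd (i + Suc r)} \<longleftrightarrow> C \<in> \<theta>2" if "C \<in> \<theta>" "i \<in> C" for C i
          using split[OF that] sub[OF that] that rs by (simp add: \<theta>2_def Suc_le_eq not_le) linarith
      qed (use rs in \<open>auto simp: \<theta>2_def\<close>)
      have B1': "B1 \<in> \<theta>1" using B1 r_max by (auto simp: \<theta>1_def)
      obtain \<sigma>1 where \<sigma>1: "cpl (Suc s) B1 \<sigma>1 r" "{C\<in>\<sigma>1. \<forall>i\<in>C. even (i + Suc s)} = \<theta>1 - {B1}"
      proof -
        have "r - Suc s < t - s" "even (Suc s + r)" "\<theta>1 \<subseteq> \<theta>" using rs rt by (auto simp: \<theta>1_def)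
        from less(2)[OF this(1) P1 noncrossing_subset[OF nc this(3)] rs(1) this(2) B1' B1(2) r] that
        show ?thesis by blast
      qed
      obtain B2 \<sigma>2 where \<sigma>2: "cpl (Suc r) B2 \<sigma>2 t" "{C\<in>\<sigma>2. \<forall>i\<in>C. odd (i + Suc r)} = \<theta>2"
      proof -
        have "t - Suc r < t - s" "Suc r \<le> t" "even (Suc r + t)" "\<theta>2 \<subseteq> \<theta>"
          using rs rt 1(4) by (auto simp: \<theta>2_def)
        from less(1)[OF this(1) P2 noncrossing_subset[OF nc this(4)] this(2,3)] that
        show ?thesis by blast
      qed
      have "{C\<in>\<sigma>1. \<forall>i\<in>C. odd (i + s)} = \<theta>1 - {B1}" using \<sigma>1(2) by simp
      moreover have "{C\<in>\<sigma>2. \<forall>i\<in>C. odd (i + s)} = \<theta>2"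
        using \<sigma>2(2) rs(3) by (simp add: even_add)
      moreover have "\<forall>i\<in>B1. odd (i + s)" using sub[OF B1(1)] by blast
      ultimately have "{C\<in>insert B1 (\<sigma>1 \<union> \<sigma>2). \<forall>i\<in>C. odd (i + s)} = insert B1 (\<theta>1 \<union> \<theta>2)"
        by blast
      also have "\<dots> = \<theta>" using B1 by (auto simp: \<theta>1_def \<theta>2_def)
      finally show ?thesis using cpl_join[OF \<sigma>1(1) \<sigma>2(1)] by blast
    qed
  next
    case 2
    note P = 2(1) and nc = 2(2) and B0 = 2(5-7)
    show ?case
    proof (cases "s = t")
      case True
      have "B0 = {s}" using partition_on_block[OF P B0(1)] True by auto
      moreover have "C = {s}" if "C \<in> \<theta>" for C
        using partition_on_block[OF P that] True by auto
      ultimately have "\<theta> - {B0} = {}" by blast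
      note \<open>B0 = {s}\<close>
      moreover note \<open>\<theta> - {B0} = {}\<close>
      ultimately show ?thesis using cpl_single[of s] True by auto
    next
      case False
      have fin: "finite B0" using partition_on_finite_block[OF P _ B0(1)] by simp
      have sub: "i \<in> {s..t} \<and> even (i + s)" if "C \<in> \<theta>" "i \<in> C" for C i
        using partition_on_block[OF P that(1)] that(2) by auto
      \<comment> \<open>The positions between \<open>s\<close> and its successor in \<open>B0\<close> are separated from the later ones.\<close>
      define B2 where "B2 = B0 - {s}"
      have t: "t \<in> B2" using B0 False by (simp add: B2_def)
      define m where "m = Min B2"
      have m: "m \<in> B2" unfolding m_def using Max_Min_mem[OF _ t] fin by (simp add: B2_def)
      have m_min: "i \<in> B2 \<Longrightarrow> m \<le> i" for i unfolding m_def using fin by (intro Min_le) (simp_all add: B2_def)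
      have ms: "s < m" "m \<le> t" "even (m + s)" "m \<noteq> Suc s" using sub[OF B0(1), of m] m by (auto simp: B2_def)
      obtain r where r: "m = Suc r" using ms(1) by (cases m) auto
      have rs: "Suc s \<le> r" "Suc r \<le> t" "odd (r + s)" using ms r by auto
      define \<theta>1 where "\<theta>1 = {C\<in>\<theta> - {B0}. C \<subseteq> {..r}}"
      define \<theta>2' where "\<theta>2' = {C\<in>\<theta> - {B0}. \<not> C \<subseteq> {..r}}"
      have ns: "s \<notin> C" "Suc r \<notin> C" if "C \<in> \<theta>" "C \<noteq> B0" for C
        using that partition_on_same[OF P that(1) B0(1)] B0 m r by (auto simp: B2_def)
      have split: "i \<le> r \<longleftrightarrow> C \<subseteq> {..r}" if C: "C \<in> \<theta>" "C \<noteq> B0" "i \<in> C" for C i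
      proof -
        have "j \<le> r" if "j \<in> C" "i \<in> C" "i \<le> r" for i j
        proof -
          have "s < i" "i < Suc r"
            using sub[OF C(1) that(2)] that ns[OF C(1,2)] by (auto simp: order_less_le)
          moreover have "Suc r \<in> B0" using m r by (simp add: B2_def)
          ultimately show ?thesis
            using noncrossing_separated[OF P nc B0(1,2) _ C(1,2) that(2) _ _ that(1), of "Suc r"] by simp
        qed
        then show ?thesis using C(3) by blast
      qed
      have P0: "partition_on ({i\<in>{s..t}. even (i + s)} - B0) (\<theta> - {B0})"
        by (rule partition_on_subfamily[OF P]) (use partition_on_same[OF P _ B0(1)] sub in \<open>auto\<close>)
      have gap: "i \<notin> B0" if "Suc s \<le> i" "i \<le> r" for i
        using m_min[of i] that r by (auto simp: B2_def)
      have P1: "partition_on {i\<in>{Suc s..r}. odd (i + Suc s)} \<theta>1"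
      proof (rule partition_on_subfamily[OF P0])
        show "{i\<in>{Suc s..r}. odd (i + Suc s)} \<subseteq> {i\<in>{s..t}. even (i + s)} - B0"
          using gap rs by auto
        show "i \<in> {i\<in>{Suc s..r}. odd (i + Suc s)} \<longleftrightarrow> C \<in> \<theta>1" if "C \<in> \<theta> - {B0}" "i \<in> C" for C i
          using split[of C i] sub[of C i] ns[of C] that by (auto simp: \<theta>1_def order_less_le Suc_le_eq)
      qed (auto simp: \<theta>1_def)
      have P2': "partition_on ({i\<in>{Suc r..t}. even (i + Suc r)} - B2) \<theta>2'"
      proof (rule partition_on_subfamily[OF P0])
        show "{i\<in>{Suc r..t}. even (i + Suc r)} - B2 \<subseteq> {i\<in>{s..t}. even (i + s)} - B0"
          using rs by (auto simp: B2_def)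
        show "i \<in> {i\<in>{Suc r..t}. even (i + Suc r)} - B2 \<longleftrightarrow> C \<in> \<theta>2'" if "C \<in> \<theta> - {B0}" "i \<in> C" for C i
        proof -
          have "i \<notin> B0" using that partition_on_same[OF P _ B0(1)] by blast
          then show ?thesis
            using split[of C i] sub[of C i] that rs by (auto simp: \<theta>2'_def B2_def not_le Suc_le_eq)
        qed
      qed (auto simp: \<theta>2'_def)
      have B2_sub: "B2 \<subseteq> {i\<in>{Suc r..t}. even (i + Suc r)}"
        using m_min sub[OF B0(1)] rs r by (fastforce simp: B2_def)
      have B2_new: "B2 \<inter> C = {}" if "C \<in> \<theta>2'" for C
        using that partition_on_same[OF P _ B0(1)] by (auto simp: \<theta>2'_def B2_def)
      have P2: "partition_on {i\<in>{Suc r..t}. even (i + Suc r)} (insert B2 \<theta>2')"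
        using P2' B2_sub t B2_new by (subst partition_on_insert) (auto simp: disjnt_def)
      have "noncrossing (insert B0 \<theta>2')"
        using noncrossing_subset[OF nc] B0(1) by (auto simp: \<theta>2'_def)
      note nc0 = this
      have nc2: "noncrossing (insert B2 \<theta>2')"
        unfolding noncrossing_def
      proof (intro ballI allI impI, elim conjE)
        fix C D a b c d
        assume CD: "C \<in> insert B2 \<theta>2'" "D \<in> insert B2 \<theta>2'" and lt: "a < b" "b < c" "c < d"
          and mem: "a \<in> C" "c \<in> C" "b \<in> D" "d \<in> D"
        define e where "e X = (if X = B2 then B0 else X)" for X
        have e: "e X \<in> insert B0 \<theta>2'" "X \<subseteq> e X" if "X \<in> insert B2 \<theta>2'" for X
          using that by (auto simp: e_def B2_def)
        have "e C = e D"
          using noncrossingD[OF nc0 e(1)[OF CD(1)] e(1)[OF CD(2)], of a c b d] lt mem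
            subsetD[OF e(2)[OF CD(1)]] subsetD[OF e(2)[OF CD(2)]] by simp
        then show "C = D"
          using CD by (auto simp: e_def \<theta>2'_def split: if_splits)
      qed
      obtain B1 \<sigma>1 where \<sigma>1: "cpl (Suc s) B1 \<sigma>1 r" "{C\<in>\<sigma>1. \<forall>i\<in>C. odd (i + Suc s)} = \<theta>1"
      proof -
        have "r - Suc s < t - s" "even (Suc s + r)" "\<theta>1 \<subseteq> \<theta>" using rs by (auto simp: \<theta>1_def)
        from less(1)[OF this(1) P1 noncrossing_subset[OF nc this(3)] rs(1) this(2)] that
        show ?thesis by blast
      qed
      obtain \<sigma>2 where \<sigma>2: "cpl (Suc r) B2 \<sigma>2 t" "{C\<in>\<sigma>2. \<forall>i\<in>C. even (i + Suc r)} = insert B2 \<theta>2' - {B2}"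
      proof -
        have "t - Suc r < t - s" "even (Suc r + t)" "Suc r \<in> B2"
          using rs r m 2(4) by auto
        from less(2)[OF this(1) P2 nc2 rs(2) this(2) insertI1 this(3) t] that
        show ?thesis by blast
      qed
      have "Suc s \<in> B1" using cpl_partition[OF \<sigma>1(1)] by blast
      then have "\<not> (\<forall>i\<in>B1. even (i + s))" by (auto intro!: bexI[of _ "Suc s"])
      moreover have "{C\<in>\<sigma>1. \<forall>i\<in>C. even (i + s)} = \<theta>1" using \<sigma>1(2) by simp
      moreover have "{C\<in>\<sigma>2. \<forall>i\<in>C. even (i + s)} = \<theta>2'"
        using \<sigma>2(2) rs(3) B2_new t by (auto simp: even_add)
      ultimately have "{C\<in>insert B1 (\<sigma>1 \<union> \<sigma>2). \<forall>i\<in>C. even (i + s)} = \<theta>1 \<union> \<theta>2'"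
        by blast
      also have "\<dots> = \<theta> - {B0}" by (auto simp: \<theta>1_def \<theta>2'_def)
      finally show ?thesis using cpl_join[OF \<sigma>1(1) \<sigma>2(1)] B0 by (auto simp: B2_def insert_absorb)
    qed
  }
qed

lemma next_in_image:
  assumes e: "strict_mono (e :: nat \<Rightarrow> nat)" and C: "finite C" "i \<in> C"
  shows "next_in (e ` C) (e i) = e (next_in C i)"
proof (cases "i = Max C")
  case True
  have "e (Max C) = Max (e ` C)" "e (Min C) = Min (e ` C)"
    using C strict_mono_mono[OF e] by (auto intro!: mono_Max_commute mono_Min_commute)
  with True show ?thesis by simp
next
  case False
  note n = next_in_greater[OF C False]
  show ?thesis
    using C n by (intro next_in_unique) (auto simp: strict_mono_less[OF e] strict_mono_less_eq[OF e])
qed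

lemma noncrossing_vimage:
  assumes "strict_mono (e :: nat \<Rightarrow> nat)" "noncrossing \<tau>"
  shows "noncrossing ((-`) e ` \<tau> - {{}})"
  unfolding noncrossing_def
proof (intro ballI allI impI, elim conjE)
  fix B' C' a b c d
  assume "B' \<in> (-`) e ` \<tau> - {{}}" "C' \<in> (-`) e ` \<tau> - {{}}"
    and lt: "a < b" "b < c" "c < d" and mem: "a \<in> B'" "c \<in> B'" "b \<in> C'" "d \<in> C'"
  then obtain B C where BC: "B \<in> \<tau>" "C \<in> \<tau>" "B' = e -` B" "C' = e -` C" by blast
  have "B = C"
    using noncrossingD[OF assms(2) BC(1,2), of "e a" "e c" "e b" "e d"] mem lt
    by (simp add: BC(3,4) strict_mono_less[OF assms(1)])
  then show "B' = C'" by (simp add: BC(3,4))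
qed

text \<open>
  Position \<open>i\<close> of a word becomes \<open>e1 i\<close>, and the point \<open>i'\<close> of the complement becomes its right
  neighbour \<open>e2 i\<close>.  The additional position 0 is a second copy of the last point of the complement,
  which lies to the left of all letters on the circle.
\<close>

abbreviation e1 :: "nat \<Rightarrow> nat" where "e1 i \<equiv> 2 * i + 1"
abbreviation e2 :: "nat \<Rightarrow> nat" where "e2 i \<equiv> 2 * i + 2"

lemma pos_mono: "strict_mono e1" "strict_mono e2"
  by (auto simp: strict_mono_def)

lemma pos_inj: "inj e1" "inj e2"
  by (auto simp: inj_def)

text \<open>
  Position 0 lies in the block of the last point \<open>2 * n\<close>.  Removing it from that block leaves a partition of
  the letters and one of the points of the complement, and the relation between their permutations follows
  from \<open>cpl_block_perm\<close>, in which position 0 takes the place of \<open>2 * n\<close>.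
\<close>

lemma cpl_kreweras:
  assumes cpl: "cpl 0 B \<sigma> (2 * n)" and n: "n \<noteq> 0"
  obtains \<pi> D where "\<pi> \<in> NC n" "kreweras n \<pi> \<in> NC n" "D \<in> kreweras n \<pi>" "n - 1 \<in> D"
    "B = insert 0 (e2 ` D)" "\<sigma> = (`) e1 ` \<pi> \<union> (`) e2 ` (kreweras n \<pi> - {D})"
proof -
  let ?\<tau> = "insert B \<sigma>"
  have P: "partition_on {0..2 * n} ?\<tau>" and B: "0 \<in> B" "2 * n \<in> B" "B \<notin> \<sigma>"
    using cpl_partition[OF cpl] by auto
  note sub = cpl_block_subset[OF cpl] and par = cpl_same_parity[OF cpl]
  define Od where "Od = {C\<in>\<sigma>. \<forall>i\<in>C. odd i}"
  define Ev where "Ev = {C\<in>\<sigma>. \<forall>i\<in>C. even i}"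
  have OE: "\<sigma> = Od \<union> Ev"
    using par by (auto simp: Od_def Ev_def)
  have O_im: "e1 ` (e1 -` C) = C" if "C \<in> Od" for C
    using that by (auto simp: Od_def elim!: oddE)
  have even_im: "i \<in> range e2" if "even i" "i \<noteq> 0" for i
    using that by (auto elim!: evenE intro!: image_eqI[of _ _ "i div 2 - 1"])
  have E_im: "e2 ` (e2 -` C) = C" if "C \<in> Ev" for C
  proof -
    have "0 \<notin> C" using partition_on_same[OF P, of C B 0] that B by (auto simp: Ev_def)
    then have "C \<subseteq> range e2" using that even_im by (auto simp: Ev_def)
    then show ?thesis by (auto simp: image_vimage_eq)
  qed
  define D where "D = e2 -` B"
  have B_even: "even i" if "i \<in> B" for i using par[of B i 0] that B by simp
  have B_im: "B = insert 0 (e2 ` D)"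
  proof -
    have "B - {0} \<subseteq> range e2" using even_im B_even by auto
    then have "B - {0} = e2 ` D" by (auto simp: D_def image_vimage_eq)
    with B show ?thesis by blast
  qed
  have e2_last: "e2 (n - 1) = 2 * n" using n by simp
  then have D: "n - 1 \<in> D" using B(2) by (simp only: D_def vimage_eq)
  define \<pi> where "\<pi> = (-`) e1 ` Od"
  define \<rho> where "\<rho> = insert D ((-`) e2 ` Ev)"
  have \<pi>_im: "(`) e1 ` \<pi> = Od" unfolding \<pi>_def image_image using O_im by simp
  have O_ne: "e1 -` C \<noteq> {}" if "C \<in> Od" for C
  proof
    assume "e1 -` C = {}"
    then have "C = {}" by (subst O_im[OF that, symmetric]) (simp only: image_empty)
    with sub(2)[of C] that show False by (simp add: Od_def)
  qed
  have E_ne: "e2 -` C \<noteq> {}" if "C \<in> Ev" for C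
  proof
    assume "e2 -` C = {}"
    then have "C = {}" by (subst E_im[OF that, symmetric]) (simp only: image_empty)
    with sub(2)[of C] that show False by (simp add: Ev_def)
  qed
  have vimage_split: "(-`) e ` ?\<tau> = insert (e -` B) ((-`) e ` Od \<union> (-`) e ` Ev)" for e :: "nat \<Rightarrow> nat"
    by (simp only: OE image_insert image_Un)
  have diff: "X = insert b (X \<union> Y) - {{}}" if "b = {}" "Y \<subseteq> {{}}" "{} \<notin> X"
    for X Y :: "nat set set" and b
    using that by blast
  have diff2: "Y \<subseteq> {{}} \<Longrightarrow> {} \<notin> Z \<Longrightarrow> Z = (Y \<union> Z) - {{}}" for Y Z :: "nat set set"
    by blast
  have \<pi>_vim: "\<pi> = (-`) e1 ` ?\<tau> - {{}}"
    unfolding vimage_split \<pi>_def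
  proof (rule diff)
    show "e1 -` B = {}" by (auto dest: B_even)
    show "(-`) e1 ` Ev \<subseteq> {{}}" by (auto simp: Ev_def)
    show "{} \<notin> (-`) e1 ` Od" using O_ne by auto
  qed
  have \<rho>_vim: "\<rho> = (-`) e2 ` ?\<tau> - {{}}"
  proof -
    have "e2 -` C = {}" if "C \<in> Od" for C
    proof (rule equals0I)
      fix i assume "i \<in> e2 -` C"
      with that have "odd (e2 i)" unfolding Od_def by blast
      then show False by simp
    qed
    then have vO: "(-`) e2 ` Od \<subseteq> {{}}" by (simp only: image_subset_iff singleton_iff ball_simps) blast
    have ne: "{} \<notin> \<rho>"
      unfolding \<rho>_def using E_ne D by (simp only: insert_iff image_iff) blast
    have un: "(-`) e2 ` ?\<tau> = (-`) e2 ` Od \<union> \<rho>"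
      by (simp only: vimage_split \<rho>_def D_def Un_insert_right)
    show ?thesis unfolding un by (rule diff2[OF vO ne])
  qed
  have D_new: "D \<notin> (-`) e2 ` Ev"
  proof
    assume "D \<in> (-`) e2 ` Ev"
    then obtain C where "C \<in> Ev" "D = e2 -` C" by blast
    then have "2 * n \<in> C" "C \<in> \<sigma>" using D by (simp_all only: vimage_eq e2_last) (simp add: Ev_def)
    then show False using partition_on_same[OF P, of C B "2 * n"] B by auto
  qed
  then have \<rho>_im: "(`) e2 ` (\<rho> - {D}) = Ev"
    unfolding \<rho>_def using E_im by (simp add: image_image)
  have "e1 -` {0..2 * n} = {..<n}" "e2 -` {0..2 * n} = {..<n}" by auto
  then have P\<pi>: "partition_on {..<n} \<pi>" and P\<rho>: "partition_on {..<n} \<rho>"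
    unfolding \<pi>_vim \<rho>_vim using partition_on_vimage[OF P, of e1] partition_on_vimage[OF P, of e2] by simp_all
  have "noncrossing \<pi>" unfolding \<pi>_vim
    by (rule noncrossing_vimage[OF pos_mono(1) cpl_noncrossing[OF cpl]])
  moreover have "noncrossing \<rho>" unfolding \<rho>_vim
    by (rule noncrossing_vimage[OF pos_mono(2) cpl_noncrossing[OF cpl]])
  ultimately have NC: "\<pi> \<in> NC n" "\<rho> \<in> NC n"
    using P\<pi> P\<rho> by (simp_all add: NC_iff)
  let ?bp = "block_perm ?\<tau>"
  have bp1: "?bp (e1 i) = e1 (block_perm \<pi> i)" if i: "i < n" for i
  proof -
    have "i \<in> {..<n}" using i by simp
    then obtain C where C: "C \<in> \<pi>" "i \<in> C" by (rule partition_on_obtain[OF P\<pi>])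
    have "e1 ` C \<in> ?\<tau>" using C \<pi>_im OE by blast
    then have "?bp (e1 i) = next_in (e1 ` C) (e1 i)"
      using C by (intro block_perm_next_in[OF P]) auto
    also have "\<dots> = e1 (next_in C i)"
      using C partition_on_finite_block[OF P\<pi> _ C(1)] by (intro next_in_image pos_mono) auto
    finally show ?thesis using block_perm_next_in[OF P\<pi> C] by simp
  qed
  have fD: "finite D" using partition_on_finite_block[OF P\<rho>, of D] by (simp add: \<rho>_def)
  have D_sub: "D \<subseteq> {..<n}" using partition_on_block[OF P\<rho>, of D] by (simp add: \<rho>_def)
  have maxD: "Max D = n - 1"
  proof (rule Max_eqI)
    show "i \<le> n - 1" if "i \<in> D" for i using D_sub that by force
  qed (use fD D in auto)
  have minD: "Min D \<in> D" using Max_Min_mem[OF fD D] by blast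
  have bp2: "?bp (e2 i) = e2 (block_perm \<rho> i)" if i: "i < n - 1" for i
  proof -
    have "i \<in> {..<n}" using i by simp
    then obtain C where C: "C \<in> \<rho>" "i \<in> C" by (rule partition_on_obtain[OF P\<rho>])
    have fC: "finite C" using partition_on_finite_block[OF P\<rho> _ C(1)] by simp
    have im: "next_in (e2 ` C) (e2 i) = e2 (next_in C i)"
      using C fC by (intro next_in_image pos_mono) auto
    have "?bp (e2 i) = next_in (e2 ` C) (e2 i)"
    proof (cases "C = D")
      case False
      then have "e2 ` C \<in> ?\<tau>" using C \<rho>_im OE by blast
      then show ?thesis using C by (intro block_perm_next_in[OF P]) auto
    next
      case True
      have "?bp (e2 i) = next_in B (e2 i)"
        using C True B_im by (intro block_perm_next_in[OF P]) auto
      also have "\<dots> = e2 (next_in D i)"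
      proof (rule next_in_unique)
        have ne: "i \<noteq> Max D" using i maxD by simp
        note nx = next_in_greater[OF fD _ ne]
        have iD: "i \<in> D" using C True by simp
        show "e2 i \<in> B" "e2 (next_in D i) \<in> B" "e2 i < e2 (next_in D i)" "finite B"
          using nx(1,2)[OF iD] iD B_im fD by auto
        show "e2 (next_in D i) \<le> j" if "j \<in> B" "e2 i < j" for j
          using that nx(3)[OF iD] unfolding B_im by auto
      qed
      finally show ?thesis using im True by simp
    qed
    then show ?thesis using im block_perm_next_in[OF P\<rho> C] by simp
  qed
  \<comment> \<open>Position 0 precedes all others, so its successor is that of the last point \<open>n - 1\<close> on the circle.\<close>
  have bp0: "?bp 0 = e2 (block_perm \<rho> (n - 1))"
  proof -
    have "?bp 0 = next_in B 0" using B by (intro block_perm_next_in[OF P]) auto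
    also have "\<dots> = e2 (Min D)"
    proof (rule next_in_unique)
      show "e2 (Min D) \<le> j" if "j \<in> B" "0 < j" for j
        using that fD Min_le unfolding B_im by auto
    qed (use minD fD B_im in auto)
    also have "Min D = next_in D (n - 1)" using maxD next_in_Max[of D] by simp
    finally show ?thesis using block_perm_next_in[OF P\<rho>, of D "n - 1"] D by (simp add: \<rho>_def)
  qed
  note rel = cpl_block_perm(2)[OF cpl]
  have mem: "block_perm \<rho> i < n" if i: "i < n" for i
  proof -
    have "i \<in> {..<n}" using i by simp
    then obtain C where C: "C \<in> \<rho>" "i \<in> C" by (rule partition_on_obtain[OF P\<rho>])
    have "next_in C i \<in> C" using partition_on_finite_block[OF P\<rho> _ C(1)] C by (intro next_in_mem) auto
    then show ?thesis
      using block_perm_next_in[OF P\<rho> C] partition_on_block[OF P\<rho> C(1)] by auto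
  qed
  have K: "kreweras n \<pi> = \<rho>"
  proof (rule krewerasI[OF NC])
    fix i assume i: "i < n"
    let ?l = "block_perm \<rho> i"
    show "block_perm \<pi> ?l = (if Suc i = n then 0 else Suc i)"
    proof (cases "Suc i = n")
      case True
      then have "n - 1 = i" by simp
      with bp0 have "?bp 0 = e2 ?l" by (simp only:)
      then have "?bp (e2 ?l - 1) = 1" using rel[of 0] n by simp
      then have "e1 (block_perm \<pi> ?l) = 1" using bp1[OF mem[OF i]] by simp
      with True show ?thesis by simp
    next
      case False
      then have "?bp (e2 ?l - 1) = Suc (e2 i)" using rel[of "e2 i"] bp2[of i] i by simp
      then have "e1 (block_perm \<pi> ?l) = Suc (e2 i)" using bp1[OF mem[OF i]] by simp
      with False show ?thesis by simp
    qed
  qed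
  show ?thesis
  proof (rule that[of \<pi> D])
    show "\<sigma> = (`) e1 ` \<pi> \<union> (`) e2 ` (kreweras n \<pi> - {D})"
      unfolding K \<pi>_im \<rho>_im by (rule OE)
  qed (use NC K D B_im in \<open>simp_all add: \<rho>_def\<close>)
qed

definition odd_blocks :: "nat set \<times> nat set set \<Rightarrow> nat set set" where
  "odd_blocks = (\<lambda>(B, \<sigma>). (-`) e1 ` \<sigma> - {{}})"

definition cpl_pairs :: "nat \<Rightarrow> nat \<Rightarrow> (nat set \<times> nat set set) set" where
  "cpl_pairs s t = {(B, \<sigma>). cpl s B \<sigma> t}"

lemma odd_blocks_eq:
  assumes "\<pi> \<in> NC n" "\<sigma> = (`) e1 ` \<pi> \<union> (`) e2 ` \<rho>"
  shows "odd_blocks (B, \<sigma>) = \<pi>"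
proof -
  have "e1 -` (e1 ` C) = C" for C by (rule inj_vimage_image_eq[OF pos_inj(1)])
  moreover have "e1 -` (e2 ` C) = {}" for C by (auto dest: arg_cong[where f = even])
  moreover have "{} \<notin> \<pi>" using assms(1) partition_onD3 by (auto simp: NC_iff)
  ultimately show ?thesis
    unfolding odd_blocks_def assms(2) by (auto simp: image_Un image_image)
qed

lemma cpl_of_NC:
  assumes "\<pi> \<in> NC n" "n \<noteq> 0"
  obtains B \<sigma> where "cpl 0 B \<sigma> (2 * n)" "odd_blocks (B, \<sigma>) = \<pi>" "kreweras n \<pi> \<in> NC n"
proof -
  have P: "partition_on {..<n} \<pi>" and nc: "noncrossing \<pi>" using assms by (simp_all add: NC_iff)
  have "partition_on (e1 ` {..<n}) ((`) e1 ` \<pi> - {{}})"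
    by (rule partition_on_inj_image[OF P]) (auto simp: inj_on_def)
  moreover have "e1 ` {..<n} = {i \<in> {0..2 * n}. odd (i + 0)}"
    by (auto elim!: oddE)
  moreover have "(`) e1 ` \<pi> - {{}} = (`) e1 ` \<pi>"
    using partition_onD3[OF P] by auto
  ultimately have "partition_on {i \<in> {0..2 * n}. odd (i + 0)} ((`) e1 ` \<pi>)" by simp
  moreover have "noncrossing ((`) e1 ` \<pi>)"
    unfolding noncrossing_def
  proof (intro ballI allI impI, elim conjE)
    fix B' C' a b c d
    assume "B' \<in> (`) e1 ` \<pi>" "C' \<in> (`) e1 ` \<pi>" and lt: "a < b" "b < c" "c < d"
      and mem: "a \<in> B'" "c \<in> B'" "b \<in> C'" "d \<in> C'"
    then obtain B C where BC: "B \<in> \<pi>" "C \<in> \<pi>" "B' = e1 ` B" "C' = e1 ` C" by blast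
    then obtain a' b' c' d' where "a = e1 a'" "b = e1 b'" "c = e1 c'" "d = e1 d'"
      "a' \<in> B" "c' \<in> B" "b' \<in> C" "d' \<in> C" using mem by blast
    then have "B = C" using noncrossingD[OF nc BC(1,2), of a' c' b' d'] lt by simp
    then show "B' = C'" by (simp add: BC)
  qed
  ultimately obtain B \<sigma> where cpl: "cpl 0 B \<sigma> (2 * n)" and \<sigma>: "{C\<in>\<sigma>. \<forall>i\<in>C. odd (i + 0)} = (`) e1 ` \<pi>"
    using cpl_exists(1)[of 0 "2 * n" "(`) e1 ` \<pi>"] by auto
  obtain \<pi>' D where \<pi>': "\<pi>' \<in> NC n" "kreweras n \<pi>' \<in> NC n"
    "\<sigma> = (`) e1 ` \<pi>' \<union> (`) e2 ` (kreweras n \<pi>' - {D})"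
    by (rule cpl_kreweras[OF cpl assms(2)])
  have "C \<notin> (`) e2 ` (kreweras n \<pi>' - {D})" if "C \<in> (`) e1 ` \<pi>" for C
  proof
    assume "C \<in> (`) e2 ` (kreweras n \<pi>' - {D})"
    then obtain C' where C': "C' \<in> kreweras n \<pi>'" "C = e2 ` C'" by blast
    moreover have "partition_on {..<n} (kreweras n \<pi>')" using \<pi>'(2) by (simp add: NC_iff)
    ultimately obtain i where "i \<in> C'" using partition_on_block by blast
    then have "e2 i \<in> C" using C' by blast
    with that obtain j where "e2 i = e1 j" by blast
    then show False by presburger
  qed
  note new = this
  have "(`) e1 ` \<pi> \<subseteq> (`) e1 ` \<pi>'"
  proof
    fix C assume C: "C \<in> (`) e1 ` \<pi>"
    then have "C \<in> \<sigma>" unfolding \<sigma>[symmetric] by (simp only: mem_Collect_eq)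
    then show "C \<in> (`) e1 ` \<pi>'" unfolding \<pi>'(3) using new[OF C] by (simp only: Un_iff simp_thms)
  qed
  moreover have "(`) e1 ` \<pi>' \<subseteq> (`) e1 ` \<pi>"
  proof
    fix C assume C: "C \<in> (`) e1 ` \<pi>'"
    then have "C \<in> \<sigma>" unfolding \<pi>'(3) by (simp only: Un_iff simp_thms)
    moreover have "\<forall>i\<in>C. odd (i + 0)" using C by auto
    ultimately show "C \<in> (`) e1 ` \<pi>" unfolding \<sigma>[symmetric] by (simp only: mem_Collect_eq)
  qed
  ultimately have "(`) e1 ` \<pi> = (`) e1 ` \<pi>'" by blast
  then have "\<pi> = \<pi>'"
    using inj_image_eq_iff[of "(`) e1"] pos_inj by (simp add: inj_def inj_image_eq_iff)
  then show ?thesis using that[OF cpl] \<pi>' odd_blocks_eq[OF \<pi>'(1,3)] by blast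
qed

text \<open>
  Injectivity comes from the fact that \<open>kreweras n \<pi>\<close> and the block of its last point, to which
  position 0 is added, recover the remaining blocks.
\<close>

lemma odd_blocks_bij: "n \<noteq> 0 \<Longrightarrow> bij_betw odd_blocks (cpl_pairs 0 (2 * n)) (NC n)"
proof -
  assume n: "n \<noteq> 0"
  have "inj_on odd_blocks (cpl_pairs 0 (2 * n))"
  proof (rule inj_onI, clarify)
    fix B \<sigma> B' \<sigma>' assume "(B, \<sigma>) \<in> cpl_pairs 0 (2 * n)" "(B', \<sigma>') \<in> cpl_pairs 0 (2 * n)" and eq: "odd_blocks (B, \<sigma>) = odd_blocks (B', \<sigma>')"
    then have cpl: "cpl 0 B \<sigma> (2 * n)" "cpl 0 B' \<sigma>' (2 * n)" by (simp_all add: cpl_pairs_def)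
    obtain \<pi> D where 1: "\<pi> \<in> NC n" "kreweras n \<pi> \<in> NC n" "D \<in> kreweras n \<pi>" "n - 1 \<in> D"
      "B = insert 0 (e2 ` D)" "\<sigma> = (`) e1 ` \<pi> \<union> (`) e2 ` (kreweras n \<pi> - {D})"
      by (rule cpl_kreweras[OF cpl(1) n])
    obtain \<pi>' D' where 2: "\<pi>' \<in> NC n" "kreweras n \<pi>' \<in> NC n" "D' \<in> kreweras n \<pi>'" "n - 1 \<in> D'"
      "B' = insert 0 (e2 ` D')" "\<sigma>' = (`) e1 ` \<pi>' \<union> (`) e2 ` (kreweras n \<pi>' - {D'})"
      by (rule cpl_kreweras[OF cpl(2) n])
    have "\<pi> = \<pi>'" using eq odd_blocks_eq[OF 1(1,6)] odd_blocks_eq[OF 2(1,6)] by simp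
    moreover from this have "D = D'"
      using 1(2,3,4) 2(3,4) partition_on_same[of "{..<n}" "kreweras n \<pi>" D D' "n - 1"] by (simp add: NC_iff)
    ultimately show "B = B' \<and> \<sigma> = \<sigma>'" using 1 2 by simp
  qed
  moreover have "odd_blocks x \<in> NC n" if x: "x \<in> cpl_pairs 0 (2 * n)" for x
  proof -
    obtain B \<sigma> where cpl: "x = (B, \<sigma>)" "cpl 0 B \<sigma> (2 * n)" using x by (auto simp: cpl_pairs_def)
    obtain \<pi> D where 1: "\<pi> \<in> NC n" "kreweras n \<pi> \<in> NC n" "D \<in> kreweras n \<pi>" "n - 1 \<in> D"
      "B = insert 0 (e2 ` D)" "\<sigma> = (`) e1 ` \<pi> \<union> (`) e2 ` (kreweras n \<pi> - {D})"
      by (rule cpl_kreweras[OF cpl(2) n])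
    then show ?thesis using odd_blocks_eq[OF 1(1,6)] cpl(1) by simp
  qed
  moreover have "\<pi> \<in> odd_blocks ` cpl_pairs 0 (2 * n)" if \<pi>: "\<pi> \<in> NC n" for \<pi>
  proof -
    obtain B \<sigma> where "cpl 0 B \<sigma> (2 * n)" "odd_blocks (B, \<sigma>) = \<pi>" by (rule cpl_of_NC[OF \<pi> n])
    then show ?thesis by (force simp: cpl_pairs_def)
  qed
  ultimately show ?thesis unfolding bij_betw_def by blast
qed

subsection \<open>The generating series of complementary pairs\<close>

text \<open>
  For non-empty \<open>W\<close>, the sum over \<open>cpl 0 B \<sigma> (length W - 1)\<close> of the product of \<open>k\<close> at the subword of \<open>W\<close> on \<open>B\<close> and
  \<open>\<kappa>\<close> at the subwords on the blocks in \<open>\<sigma>\<close>, computed along the decomposition that defines \<open>cpl\<close>.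
  The weight \<open>k\<close> of the block of the first position is separate in order to remember the letters of that
  block which have already been passed.
\<close>

function cpl_word_sum :: "('l list \<Rightarrow> complex) \<Rightarrow> ('l list \<Rightarrow> complex) \<Rightarrow> 'l list \<Rightarrow> complex" where
  "cpl_word_sum \<kappa> k [] = 0"
| "cpl_word_sum \<kappa> k (x # V) = (if V = [] then k [x] else 0) +
     (\<Sum>j\<le>length V. cpl_word_sum \<kappa> \<kappa> (take j V) * cpl_word_sum \<kappa> (\<lambda>v. k (x # v)) (drop j V))"
  by pat_completeness auto
termination by (relation "measure (\<lambda>(\<kappa>, k, W). length W)") auto

declare cpl_word_sum.simps(2) [simp del]

definition cpl_series :: "('l list \<Rightarrow> complex) \<Rightarrow> 'l ncseries" where
  "cpl_series \<kappa> = Series (cpl_word_sum \<kappa> \<kappa>)"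

text \<open>
  Iterating the decomposition exhausts the block of the first position, with one factor \<open>cpl_series \<kappa>\<close> for
  each of its gaps.
\<close>

lemma cpl_series_sandwich:
  fixes \<kappa> :: "'l::finite list \<Rightarrow> complex"
  shows "cpl_series \<kappa> = sandwich \<kappa> (cpl_series \<kappa>)"
proof -
  let ?Z = "cpl_series \<kappa>"
  define U where "U u = Series (cpl_word_sum \<kappa> (\<lambda>v. \<kappa> (u @ v)))" for u
  \<comment> \<open>\<open>V u\<close> counts the continuations of a block with initial word \<open>u\<close>, each starting with a gap.\<close>
  define V where "V u = const (\<kappa> u) + ?Z * U u" for u
  define S where "S x = ?Z * zvar x" for x
  have U: "U u = (\<Sum>x\<in>UNIV. zvar x * V (u @ [x]))" for u
  proof (rule ncseries_eqI)
    fix w show "cf (U u) w = cf (\<Sum>x\<in>UNIV. zvar x * V (u @ [x])) w"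
    proof (cases w)
      case (Cons a v)
      have "cf (\<Sum>x\<in>UNIV. zvar x * V (u @ [x])) w = cf (V (u @ [a])) v" by (simp add: Cons)
      also have "\<dots> = cf (U u) w"
        by (simp add: Cons U_def V_def cpl_word_sum.simps(2) cf_mult cpl_series_def)
      finally show ?thesis ..
    qed (simp add: U_def)
  qed
  have S0: "cf (S x) [] = 0" for x by (simp add: S_def)
  have "agree n (V u) (ssub (\<lambda>r. \<kappa> (u @ r)) S)" for n u
  proof (induction n arbitrary: u)
    case (Suc n)
    have "V u = const (\<kappa> u) + (\<Sum>x\<in>UNIV. S x * V (u @ [x]))"
      unfolding V_def[of u] U by (simp add: sum_distrib_left S_def mult.assoc)
    moreover have "ssub (\<lambda>r. \<kappa> (u @ r)) S = const (\<kappa> u) + (\<Sum>x\<in>UNIV. S x * ssub (\<lambda>r. \<kappa> ((u @ [x]) @ r)) S)"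
      using ssub_left[OF S0, of "\<lambda>r. \<kappa> (u @ r)"] by simp
    ultimately show ?case
      by (simp only:) (intro agree_add agree_refl agree_sum agree_mult_Suc_left S0 Suc)
  qed simp
  then have "V u = ssub (\<lambda>r. \<kappa> (u @ r)) S" for u by (intro eq_if_agree)
  moreover have "?Z = U []" by (simp add: cpl_series_def U_def)
  ultimately have "?Z = (\<Sum>x\<in>UNIV. zvar x * ssub (\<lambda>r. \<kappa> (x # r)) S)"
    by (simp add: U)
  then show ?thesis by (simp add: sandwich_def S_def[abs_def])
qed

abbreviation letters :: "(nat \<Rightarrow> 'l) \<Rightarrow> nat set \<Rightarrow> 'l list" where
  "letters l C \<equiv> map l (sorted_list_of_set C)"

definition cpl_sum :: "('l list \<Rightarrow> complex) \<Rightarrow> (nat \<Rightarrow> 'l) \<Rightarrow> ('l list \<Rightarrow> complex) \<Rightarrow> nat \<Rightarrow> nat \<Rightarrow> complex" where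
  "cpl_sum \<kappa> l k s t = (\<Sum>(B, \<sigma>)\<in>cpl_pairs s t. k (letters l B) * (\<Prod>C\<in>\<sigma>. \<kappa> (letters l C)))"

lemma finite_cpl_pairs: "finite (cpl_pairs s t)"
proof (rule finite_subset)
  show "cpl_pairs s t \<subseteq> Pow {s..t} \<times> Pow (Pow {s..t})"
    using cpl_block_subset(1) by (fastforce simp: cpl_pairs_def)
qed simp

lemma cpl_pairs_single: "cpl_pairs s s = {({s}, {})}"
proof -
  have "B = {s} \<and> \<sigma> = {}" if "cpl s B \<sigma> s" for B \<sigma>
    using that by cases (auto dest!: cpl_le)
  then show ?thesis by (auto simp: cpl_pairs_def intro: cpl_single)
qed

definition join :: "nat \<Rightarrow> nat \<times> (nat set \<times> nat set set) \<times> nat set \<times> nat set set \<Rightarrow> nat set \<times> nat set set" where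
  "join s = (\<lambda>(r, (B1, \<sigma>1), B2, \<sigma>2). (insert s B2, insert B1 (\<sigma>1 \<union> \<sigma>2)))"

lemma cpl_pairs_join:
  assumes "s < t"
  shows "cpl_pairs s t = join s ` (SIGMA r:{s<..<t}. cpl_pairs (Suc s) r \<times> cpl_pairs (Suc r) t)"
proof
  show "cpl_pairs s t \<subseteq> join s ` (SIGMA r:{s<..<t}. cpl_pairs (Suc s) r \<times> cpl_pairs (Suc r) t)"
  proof clarify
    fix B \<sigma> assume "(B, \<sigma>) \<in> cpl_pairs s t"
    then have "cpl s B \<sigma> t" by (simp add: cpl_pairs_def)
    then show "(B, \<sigma>) \<in> join s ` (SIGMA r:{s<..<t}. cpl_pairs (Suc s) r \<times> cpl_pairs (Suc r) t)"
    proof cases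
      case cpl_single
      with assms show ?thesis by simp
    next
      case (cpl_join B1 \<sigma>1 r B2 \<sigma>2)
      have "r \<in> {s<..<t}" using cpl_le[OF cpl_join(3)] cpl_le[OF cpl_join(4)] by simp
      with cpl_join show ?thesis
        by (intro image_eqI[of _ _ "(r, (B1, \<sigma>1), B2, \<sigma>2)"]) (simp_all add: join_def cpl_pairs_def)
    qed
  qed
  show "join s ` (SIGMA r:{s<..<t}. cpl_pairs (Suc s) r \<times> cpl_pairs (Suc r) t) \<subseteq> cpl_pairs s t"
    by (auto simp: join_def cpl_pairs_def intro: cpl.cpl_join)
qed

text \<open>
  The two parts of a join can be read off from it, so that the decomposition is unique.
\<close>

lemma cpl_join_parts:
  assumes "cpl (Suc s) B1 \<sigma>1 r" "cpl (Suc r) B2 \<sigma>2 t"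
  shows "s \<notin> B2" "Suc r = Min B2" "B1 = (THE C. C \<in> insert B1 (\<sigma>1 \<union> \<sigma>2) \<and> Suc s \<in> C)"
    "\<sigma>1 = {C\<in>insert B1 (\<sigma>1 \<union> \<sigma>2). C \<subseteq> {..r} \<and> C \<noteq> B1}"
    "\<sigma>2 = {C\<in>insert B1 (\<sigma>1 \<union> \<sigma>2). \<not> C \<subseteq> {..r}}" "finite B2" "B1 \<notin> \<sigma>1 \<union> \<sigma>2" "\<sigma>1 \<inter> \<sigma>2 = {}" "B2 \<subseteq> {s<..}"
proof -
  note le = cpl_le[OF assms(1)] cpl_le[OF assms(2)]
  have 1: "C \<subseteq> {..r}" if "C \<in> insert B1 \<sigma>1" for C
    using cpl_block_subset(1)[OF assms(1) that] by auto
  have 2: "\<not> C \<subseteq> {..r}" "Suc s \<notin> C" if "C \<in> insert B2 \<sigma>2" for C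
    using cpl_block_subset[OF assms(2) that] le by fastforce+
  have P1: "partition_on {Suc s..r} (insert B1 \<sigma>1)" "Suc s \<in> B1" "B1 \<notin> \<sigma>1"
    and P2: "Suc r \<in> B2" using cpl_partition[OF assms(1)] cpl_partition[OF assms(2)] by auto
  have B2: "B2 \<subseteq> {Suc r..t}" using cpl_block_subset(1)[OF assms(2)] by simp
  then show fin: "finite B2" by (rule finite_subset) simp
  show "B2 \<subseteq> {s<..}" "s \<notin> B2" using B2 le by auto
  show "Suc r = Min B2" using B2 P2 fin by (intro Min_eqI[symmetric]) auto
  define low where "low C \<longleftrightarrow> C \<subseteq> {..r}" for C
  have low1: "low C" if "C \<in> insert B1 \<sigma>1" for C unfolding low_def by (rule 1[OF that])
  have low2: "\<not> low C" if "C \<in> \<sigma>2" for C unfolding low_def using 2(1)[of C] that by simp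
  show "B1 \<notin> \<sigma>1 \<union> \<sigma>2" using P1(3) low1 low2 by blast
  show "\<sigma>1 \<inter> \<sigma>2 = {}" using low1 low2 by blast
  show "\<sigma>1 = {C\<in>insert B1 (\<sigma>1 \<union> \<sigma>2). C \<subseteq> {..r} \<and> C \<noteq> B1}"
    unfolding low_def[symmetric] using low1 low2 P1(3) by blast
  show "\<sigma>2 = {C\<in>insert B1 (\<sigma>1 \<union> \<sigma>2). \<not> C \<subseteq> {..r}}"
    unfolding low_def[symmetric] using low1 low2 by blast
  show "B1 = (THE C. C \<in> insert B1 (\<sigma>1 \<union> \<sigma>2) \<and> Suc s \<in> C)"
  proof (rule the_equality[symmetric])
    fix C assume C: "C \<in> insert B1 (\<sigma>1 \<union> \<sigma>2) \<and> Suc s \<in> C"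
    then have "C \<in> insert B1 \<sigma>1" using 2(2)[of C] by blast
    then show "C = B1" using partition_on_same[OF P1(1) _ insertI1 _ P1(2)] C by blast
  qed (use P1 in simp)
qed

lemma inj_join: "inj_on (join s) (SIGMA r:{s<..<t}. cpl_pairs (Suc s) r \<times> cpl_pairs (Suc r) t)"
proof (rule inj_onI)
  fix x y
  assume x: "x \<in> (SIGMA r:{s<..<t}. cpl_pairs (Suc s) r \<times> cpl_pairs (Suc r) t)"
    and y: "y \<in> (SIGMA r:{s<..<t}. cpl_pairs (Suc s) r \<times> cpl_pairs (Suc r) t)" and eq: "join s x = join s y"
  obtain r B1 \<sigma>1 B2 \<sigma>2 where X: "x = (r, (B1, \<sigma>1), B2, \<sigma>2)" by (metis prod.collapse)
  obtain r' B1' \<sigma>1' B2' \<sigma>2' where Y: "y = (r', (B1', \<sigma>1'), B2', \<sigma>2')" by (metis prod.collapse)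
  have c: "cpl (Suc s) B1 \<sigma>1 r" "cpl (Suc r) B2 \<sigma>2 t" "cpl (Suc s) B1' \<sigma>1' r'" "cpl (Suc r') B2' \<sigma>2' t"
    using x y by (auto simp: X Y cpl_pairs_def)
  note p = cpl_join_parts[OF c(1,2)] and p' = cpl_join_parts[OF c(3,4)]
  have e: "insert s B2 = insert s B2'" "insert B1 (\<sigma>1 \<union> \<sigma>2) = insert B1' (\<sigma>1' \<union> \<sigma>2')"
    using eq by (simp_all add: X Y join_def)
  have B2: "B2 = B2'" using e(1) p(1) p'(1) by (simp add: insert_ident)
  have r: "r = r'" using p(2) p'(2) B2 by simp
  have B1: "B1 = B1'" by (rule trans[OF p(3)]) (simp only: e(2) p'(3)[symmetric])
  have "\<sigma>1 = \<sigma>1'" by (rule trans[OF p(4)]) (subst e(2), simp only: r B1 p'(4)[symmetric])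
  moreover have "\<sigma>2 = \<sigma>2'" by (rule trans[OF p(5)]) (subst e(2), simp only: r p'(5)[symmetric])
  ultimately show "x = y" using B1 B2 r by (simp add: X Y)
qed

lemma sorted_list_of_set_insert_min:
  assumes "finite B" "B \<subseteq> {s<..}"
  shows "sorted_list_of_set (insert s B) = s # sorted_list_of_set (B :: nat set)"
proof -
  have "s \<notin> B" "\<forall>x\<in>set (sorted_list_of_set B). s \<le> x" using assms by auto
  then show ?thesis
    using assms(1) by (simp add: sorted_list_of_set_insert insort_is_Cons)
qed

lemma cpl_sum_join:
  assumes "s < t"
  shows "cpl_sum \<kappa> l k s t = (\<Sum>r\<in>{s<..<t}. cpl_sum \<kappa> l \<kappa> (Suc s) r * cpl_sum \<kappa> l (\<lambda>v. k (l s # v)) (Suc r) t)"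
proof -
  define F where "F x = (case x of (B, \<sigma>) \<Rightarrow> k (letters l B) * (\<Prod>C\<in>\<sigma>. \<kappa> (letters l C)))" for x
  define W where "W k' x = (case x of (B, \<sigma>) \<Rightarrow> k' (letters l B) * (\<Prod>C\<in>\<sigma>. \<kappa> (letters l C)))"
    for k' and x :: "nat set \<times> nat set set"
  have "cpl_sum \<kappa> l k s t = sum F (join s ` (SIGMA r:{s<..<t}. cpl_pairs (Suc s) r \<times> cpl_pairs (Suc r) t))"
    by (simp add: cpl_sum_def F_def cpl_pairs_join[OF assms])
  also have "\<dots> = (\<Sum>x\<in>(SIGMA r:{s<..<t}. cpl_pairs (Suc s) r \<times> cpl_pairs (Suc r) t). F (join s x))"
    by (simp add: sum.reindex[OF inj_join] comp_def)
  also have "\<dots> = (\<Sum>(r, x)\<in>(SIGMA r:{s<..<t}. cpl_pairs (Suc s) r \<times> cpl_pairs (Suc r) t). W \<kappa> (fst x) * W (\<lambda>v. k (l s # v)) (snd x))"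
  proof (rule sum.cong[OF refl])
    fix x assume x: "x \<in> (SIGMA r:{s<..<t}. cpl_pairs (Suc s) r \<times> cpl_pairs (Suc r) t)"
    obtain r B1 \<sigma>1 B2 \<sigma>2 where X: "x = (r, (B1, \<sigma>1), B2, \<sigma>2)" by (metis prod.collapse)
    have c: "cpl (Suc s) B1 \<sigma>1 r" "cpl (Suc r) B2 \<sigma>2 t" using x by (auto simp: X cpl_pairs_def)
    note p = cpl_join_parts[OF c]
    have fin: "finite \<sigma>1" "finite \<sigma>2"
      using finite_elements[of "{Suc s..r}" "insert B1 \<sigma>1"] finite_elements[of "{Suc r..t}" "insert B2 \<sigma>2"]
        cpl_partition[OF c(1)] cpl_partition[OF c(2)] by auto
    have "(\<Prod>C\<in>insert B1 (\<sigma>1 \<union> \<sigma>2). \<kappa> (letters l C)) =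
        \<kappa> (letters l B1) * ((\<Prod>C\<in>\<sigma>1. \<kappa> (letters l C)) * (\<Prod>C\<in>\<sigma>2. \<kappa> (letters l C)))"
      using p(7,8) fin by (subst prod.insert) (simp_all add: prod.union_disjoint)
    moreover have "letters l (insert s B2) = l s # letters l B2"
      using sorted_list_of_set_insert_min[OF p(6,9)] by simp
    ultimately show "F (join s x) = (case x of (r, x) \<Rightarrow> W \<kappa> (fst x) * W (\<lambda>v. k (l s # v)) (snd x))"
      by (simp add: X F_def W_def join_def mult_ac)
  qed
  also have "\<dots> = (\<Sum>r\<in>{s<..<t}. \<Sum>x\<in>cpl_pairs (Suc s) r \<times> cpl_pairs (Suc r) t. W \<kappa> (fst x) * W (\<lambda>v. k (l s # v)) (snd x))"
    by (subst sum.Sigma) (simp_all add: finite_cpl_pairs)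
  also have "\<dots> = (\<Sum>r\<in>{s<..<t}. cpl_sum \<kappa> l \<kappa> (Suc s) r * cpl_sum \<kappa> l (\<lambda>v. k (l s # v)) (Suc r) t)"
  proof -
    have "cpl_sum \<kappa> l k' a b = sum (W k') (cpl_pairs a b)" for k' a b
      by (simp add: cpl_sum_def W_def[abs_def])
    then show ?thesis by (simp add: sum_product sum.cartesian_product case_prod_unfold)
  qed
  finally show ?thesis .
qed

lemma cpl_sum_word_sum: "s \<le> t \<Longrightarrow> cpl_sum \<kappa> l k s t = cpl_word_sum \<kappa> k (map l [s..<Suc t])"
proof (induction "t - s" arbitrary: s t k rule: less_induct)
  case less
  show ?case
  proof (cases "s = t")
    case True
    then show ?thesis by (simp add: cpl_sum_def cpl_pairs_single cpl_word_sum.simps(2))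
  next
    case False
    with less.prems have st: "s < t" by simp
    define V where "V = map l [Suc s..<Suc t]"
    have lV: "length V = t - s" by (simp add: V_def del: upt_Suc)
    have "V \<noteq> []" using st lV by auto
    have take: "take j V = map l [Suc s..<Suc (s + j)]" if "j \<le> t - s" for j
      using that st by (simp add: V_def take_map del: upt_Suc)
    have drop: "drop j V = map l [Suc (s + j)..<Suc t]" for j
      by (simp add: V_def drop_map del: upt_Suc)
    have "cpl_word_sum \<kappa> k (map l [s..<Suc t]) = cpl_word_sum \<kappa> k (l s # V)"
      using st by (simp add: V_def upt_rec[of s] del: upt_Suc)
    also have "\<dots> = (\<Sum>j\<le>t - s. cpl_word_sum \<kappa> \<kappa> (take j V) * cpl_word_sum \<kappa> (\<lambda>v. k (l s # v)) (drop j V))"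
      using \<open>V \<noteq> []\<close> by (simp add: cpl_word_sum.simps(2) lV)
    also have "\<dots> = (\<Sum>j\<in>{0<..<t - s}. cpl_word_sum \<kappa> \<kappa> (take j V) * cpl_word_sum \<kappa> (\<lambda>v. k (l s # v)) (drop j V))"
    proof (rule sum.mono_neutral_right)
      show "\<forall>j\<in>{..t - s} - {0<..<t - s}. cpl_word_sum \<kappa> \<kappa> (take j V) * cpl_word_sum \<kappa> (\<lambda>v. k (l s # v)) (drop j V) = 0"
      proof
        fix j assume "j \<in> {..t - s} - {0<..<t - s}"
        then have "j = 0 \<or> j = t - s" by auto
        then show "cpl_word_sum \<kappa> \<kappa> (take j V) * cpl_word_sum \<kappa> (\<lambda>v. k (l s # v)) (drop j V) = 0"
          using lV by auto
      qed
    qed auto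
    also have "\<dots> = (\<Sum>r\<in>{s<..<t}. cpl_sum \<kappa> l \<kappa> (Suc s) r * cpl_sum \<kappa> l (\<lambda>v. k (l s # v)) (Suc r) t)"
    proof (rule sum.reindex_bij_witness[of _ "\<lambda>r. r - s" "\<lambda>j. s + j"])
      fix j assume j: "j \<in> {0<..<t - s}"
      show "cpl_sum \<kappa> l \<kappa> (Suc s) (s + j) * cpl_sum \<kappa> l (\<lambda>v. k (l s # v)) (Suc (s + j)) t =
          cpl_word_sum \<kappa> \<kappa> (take j V) * cpl_word_sum \<kappa> (\<lambda>v. k (l s # v)) (drop j V)"
      proof -
        have "s + j - Suc s < t - s" "Suc s \<le> s + j" "t - Suc (s + j) < t - s" "Suc (s + j) \<le> t" "j \<le> t - s"
          using j by auto
        then show ?thesis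
          by (simp only: less.hyps take drop)
      qed
    qed auto
    finally show ?thesis using cpl_sum_join[OF st, of \<kappa> l k] by simp
  qed
qed

lemma sorted_list_of_set_image:
  assumes "strict_mono (e :: nat \<Rightarrow> nat)" "finite D"
  shows "sorted_list_of_set (e ` D) = map e (sorted_list_of_set D)"
proof (rule strict_sorted_equal)
  show "sorted_wrt (<) (map e (sorted_list_of_set D))"
    using strict_sorted_list_of_set[of D]
    by (simp add: sorted_wrt_map strict_mono_less[OF assms(1)])
qed (use assms in auto)

lemma nths_letters:
  assumes "D \<subseteq> {..<length w}"
  shows "nths w D = letters ((!) w) D"
proof -
  have "nths w D = map ((!) w) (filter (\<lambda>i. i \<in> D) [0..<length w])"
  proof -
    have "zip w [0..<length w] = map (\<lambda>i. (w ! i, i)) [0..<length w]"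
      by (rule nth_equalityI) auto
    then show ?thesis by (simp add: nths_def filter_map comp_def)
  qed
  also have "filter (\<lambda>i. i \<in> D) [0..<length w] = sorted_list_of_set D"
    using assms finite_subset[OF assms]
    by (intro strict_sorted_equal) (auto simp: sorted_wrt_filter)
  finally show ?thesis .
qed

lemma dbl_nth: "i < length w \<Longrightarrow> dbl w ! (2 * i) = Inl (w ! i) \<and> dbl w ! Suc (2 * i) = Inr (w ! i)"
proof (induction w arbitrary: i)
  case (Cons x w)
  then show ?case by (cases i) simp_all
qed simp

text \<open>
  The boxed convolution of Nica and Speicher.
\<close>

definition boxed :: "('k list \<Rightarrow> complex) \<Rightarrow> ('k list \<Rightarrow> complex) \<Rightarrow> 'k list \<Rightarrow> complex" where
  "boxed f g w = (\<Sum>\<pi>\<in>NC (length w). (\<Prod>B\<in>\<pi>. f (nths w B)) * (\<Prod>C\<in>kreweras (length w) \<pi>. g (nths w C)))"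

text \<open>
  Among the pairs on the positions \<open>0, \<dots>, 2 * n\<close>, each \<open>\<pi>\<close> occurs once, and the weight of the block
  of 0 must ignore the letter at 0.  The first cut of the decomposition then leaves two blocks of ordinary
  weight, one in each piece; hence the square.
\<close>

theorem boxed_eq_cf:
  fixes f g :: "'k list \<Rightarrow> complex"
  assumes f0: "f [] = 0" and g0: "g [] = 0" and w: "w \<noteq> []"
  defines "Z \<equiv> cpl_series (joint f g)"
  shows "boxed f g w = cf (Z * Z) (dbl w)"
proof -
  define n where "n = length w"
  define L where "L = dbl w"
  define \<kappa> where "\<kappa> = joint f g"
  define l where "l j = L ! (j - 1)" for j
  have n: "n \<noteq> 0" using w by (simp add: n_def)
  have lL: "length L = 2 * n" by (simp add: L_def n_def)
  have l_seg: "map l [Suc i..<Suc j] = take (j - i) (drop i L)" if "j \<le> 2 * n" for i j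
    using that lL by (intro nth_equalityI) (auto simp: l_def simp del: upt_Suc)
  define F where "F \<pi> = (\<Prod>B\<in>\<pi>. f (nths w B)) * (\<Prod>C\<in>kreweras n \<pi>. g (nths w C))" for \<pi>
  have "boxed f g w = sum F (NC n)" by (simp add: boxed_def F_def n_def)
  also have "\<dots> = (\<Sum>x\<in>cpl_pairs 0 (2 * n). F (odd_blocks x))"
    by (rule sum.reindex_bij_betw[OF odd_blocks_bij[OF n], symmetric])
  also have "\<dots> = cpl_sum \<kappa> l (\<lambda>v. \<kappa> (tl v)) 0 (2 * n)"
    unfolding cpl_sum_def
  proof (rule sum.cong[OF refl], clarify)
    fix B \<sigma> assume "(B, \<sigma>) \<in> cpl_pairs 0 (2 * n)"
    then have cpl: "cpl 0 B \<sigma> (2 * n)" by (simp add: cpl_pairs_def)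
    obtain \<pi> D where *: "\<pi> \<in> NC n" "kreweras n \<pi> \<in> NC n" "D \<in> kreweras n \<pi>" "n - 1 \<in> D"
      "B = insert 0 (e2 ` D)" "\<sigma> = (`) e1 ` \<pi> \<union> (`) e2 ` (kreweras n \<pi> - {D})"
      by (rule cpl_kreweras[OF cpl n])
    have P: "partition_on {..<n} \<pi>" "partition_on {..<n} (kreweras n \<pi>)" using * by (simp_all add: NC_iff)
    have fin: "finite \<pi>" "finite (kreweras n \<pi>)" using finite_elements P by blast+
    have sub: "C \<subseteq> {..<n}" "finite C" if "C \<in> \<pi> \<or> C \<in> kreweras n \<pi>" for C
      using partition_on_block[OF P(1)] partition_on_block[OF P(2)] that finite_subset[of C "{..<n}"] by blast+
    have k1: "\<kappa> (letters l (e1 ` C)) = f (nths w C)" if C: "C \<in> \<pi>" for C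
    proof -
      have "letters l (e1 ` C) = map Inl (letters ((!) w) C)"
      proof -
        have "letters l (e1 ` C) = map (\<lambda>i. l (e1 i)) (sorted_list_of_set C)"
          using sub(2)[of C] C by (simp only: sorted_list_of_set_image[OF pos_mono(1)] map_map comp_def simp_thms)
        also have "\<dots> = map (\<lambda>i. Inl (w ! i)) (sorted_list_of_set C)"
        proof (rule map_cong[OF refl])
          fix i assume "i \<in> set (sorted_list_of_set C)"
          then have "i < length w" using sub[of C] C by (auto simp: n_def)
          then show "l (e1 i) = Inl (w ! i)" using dbl_nth[of i w] by (simp add: l_def L_def)
        qed
        finally show ?thesis by simp
      qed
      then show ?thesis using sub[of C] C by (simp add: nths_letters n_def \<kappa>_def joint_Inl del: map_map)
    qed
    have k2: "\<kappa> (letters l (e2 ` C)) = g (nths w C)" if C: "C \<in> kreweras n \<pi>" for C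
    proof -
      have "letters l (e2 ` C) = map Inr (letters ((!) w) C)"
      proof -
        have "letters l (e2 ` C) = map (\<lambda>i. l (e2 i)) (sorted_list_of_set C)"
          using sub(2)[of C] C by (simp only: sorted_list_of_set_image[OF pos_mono(2)] map_map comp_def simp_thms)
        also have "\<dots> = map (\<lambda>i. Inr (w ! i)) (sorted_list_of_set C)"
        proof (rule map_cong[OF refl])
          fix i assume "i \<in> set (sorted_list_of_set C)"
          then have "i < length w" using sub[of C] C by (auto simp: n_def)
          then show "l (e2 i) = Inr (w ! i)" using dbl_nth[of i w] by (simp add: l_def L_def)
        qed
        finally show ?thesis by simp
      qed
      then show ?thesis using sub[of C] C by (simp add: nths_letters n_def \<kappa>_def f0 g0 del: map_map)
    qed
    have inj: "inj_on ((`) e1) A" "inj_on ((`) e2) A" for A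
      using inj_image_eq_iff[OF pos_inj(1)] inj_image_eq_iff[OF pos_inj(2)] by (auto simp: inj_on_def)
    have disj: "(`) e1 ` \<pi> \<inter> (`) e2 ` (kreweras n \<pi> - {D}) = {}"
    proof -
      have "e1 ` C \<noteq> e2 ` C'" if C: "C \<in> \<pi>" for C C'
      proof
        assume eq: "e1 ` C = e2 ` C'"
        obtain i where "i \<in> C" using partition_on_block[OF P(1) C] by blast
        then have "e1 i \<in> e2 ` C'" using eq by blast
        then obtain j where "e1 i = e2 j" by blast
        then show False by presburger
      qed
      then show ?thesis by blast
    qed
    have p1: "(\<Prod>C\<in>(`) e1 ` \<pi>. \<kappa> (letters l C)) = (\<Prod>C\<in>\<pi>. f (nths w C))"
      unfolding prod.reindex[OF inj(1)] comp_def by (rule prod.cong[OF refl k1])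
    have p2: "(\<Prod>C\<in>(`) e2 ` (kreweras n \<pi> - {D}). \<kappa> (letters l C)) =
        (\<Prod>C\<in>kreweras n \<pi> - {D}. g (nths w C))"
      unfolding prod.reindex[OF inj(2)] comp_def by (rule prod.cong[OF refl k2]) simp
    have "(\<Prod>C\<in>\<sigma>. \<kappa> (letters l C)) =
        (\<Prod>C\<in>\<pi>. f (nths w C)) * (\<Prod>C\<in>kreweras n \<pi> - {D}. g (nths w C))"
      unfolding *(6) p1[symmetric] p2[symmetric]
      by (rule prod.union_disjoint[OF _ _ disj]) (simp_all add: fin)
    moreover have "tl (letters l B) = letters l (e2 ` D)"
      unfolding *(5) using sub[of D] *(3) by (subst sorted_list_of_set_insert_min) auto
    moreover have "(\<Prod>C\<in>kreweras n \<pi>. g (nths w C)) = g (nths w D) * (\<Prod>C\<in>kreweras n \<pi> - {D}. g (nths w C))"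
      using fin(2) *(3) by (rule prod.remove)
    ultimately show "F (odd_blocks (B, \<sigma>)) = \<kappa> (tl (letters l B)) * (\<Prod>C\<in>\<sigma>. \<kappa> (letters l C))"
      using k2[OF *(3)] odd_blocks_eq[OF *(1,6)] by (simp add: F_def mult_ac)
  qed
  also have "\<dots> = (\<Sum>r\<in>{0<..<2 * n}. cpl_sum \<kappa> l \<kappa> 1 r * cpl_sum \<kappa> l \<kappa> (Suc r) (2 * n))"
    using n by (subst cpl_sum_join) simp_all
  also have "\<dots> = (\<Sum>r\<in>{0<..<2 * n}. cf Z (take r L) * cf Z (drop r L))"
  proof (rule sum.cong[OF refl])
    fix r assume r: "r \<in> {0<..<2 * n}"
    then have "cpl_sum \<kappa> l \<kappa> 1 r = cpl_word_sum \<kappa> \<kappa> (take r L)"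
      using cpl_sum_word_sum[of 1 r \<kappa> l \<kappa>] l_seg[of r 0] by (simp del: upt_Suc)
    moreover have "cpl_sum \<kappa> l \<kappa> (Suc r) (2 * n) = cpl_word_sum \<kappa> \<kappa> (drop r L)"
      using r cpl_sum_word_sum[of "Suc r" "2 * n" \<kappa> l \<kappa>] l_seg[of "2 * n" r] lL by (simp del: upt_Suc)
    ultimately show "cpl_sum \<kappa> l \<kappa> 1 r * cpl_sum \<kappa> l \<kappa> (Suc r) (2 * n) = cf Z (take r L) * cf Z (drop r L)"
      by (simp add: Z_def cpl_series_def \<kappa>_def)
  qed
  also have "\<dots> = cf (Z * Z) L"
    unfolding cf_mult
  proof (rule sum.mono_neutral_left)
    show "\<forall>r\<in>{..length L} - {0<..<2 * n}. cf Z (take r L) * cf Z (drop r L) = 0"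
    proof
      fix r assume "r \<in> {..length L} - {0<..<2 * n}"
      then have "r = 0 \<or> r = length L" using lL by auto
      then show "cf Z (take r L) * cf Z (drop r L) = 0" by (auto simp: Z_def cpl_series_def)
    qed
  qed (use lL in auto)
  finally show ?thesis by (simp add: L_def)
qed

section \<open>Moments and cumulants\<close>

definition moment :: "('k list \<Rightarrow> complex) \<Rightarrow> 'k list \<Rightarrow> complex" where
  "moment f w = (\<Sum>\<pi>\<in>NC (length w). \<Prod>B\<in>\<pi>. f (nths w B))"

lemma nths_nonempty:
  assumes "partition_on {..<length w} \<pi>" "B \<in> \<pi>" shows "nths w B \<noteq> []"
proof -
  have B: "B \<subseteq> {..<length w}" "B \<noteq> {}" using partition_on_block[OF assms] by auto
  then have "finite B" using finite_subset by blast
  with B show ?thesis by (simp add: nths_letters)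
qed

lemma NC_0: "NC 0 = {{}}"
  by (auto simp: NC_iff partition_on_empty noncrossing_def)

lemma moment_Nil [simp]: "moment f [] = 1"
  by (simp add: moment_def NC_0)

text \<open>
  With constant cumulants for the second tuple the complement contributes only factors 1.
\<close>

lemma moment_boxed:
  assumes "w \<noteq> []"
  shows "moment f w = boxed f (\<lambda>u. if u = [] then 0 else 1) w"
  unfolding moment_def boxed_def
proof (rule sum.cong[OF refl])
  fix \<pi> assume \<pi>: "\<pi> \<in> NC (length w)"
  have n: "length w \<noteq> 0" using assms by simp
  obtain B \<sigma> where "kreweras (length w) \<pi> \<in> NC (length w)" by (rule cpl_of_NC[OF \<pi> n])
  then have "nths w C \<noteq> []" if "C \<in> kreweras (length w) \<pi>" for C
    using nths_nonempty that by (auto simp: NC_iff)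
  then have "(\<Prod>C\<in>kreweras (length w) \<pi>. if nths w C = [] then 0 else 1) = (1 :: complex)"
    by (intro prod.neutral) simp
  then show "(\<Prod>B\<in>\<pi>. f (nths w B)) =
      (\<Prod>B\<in>\<pi>. f (nths w B)) * (\<Prod>C\<in>kreweras (length w) \<pi>. if nths w C = [] then 0 else 1)"
    by simp
qed

theorem moment_series:
  fixes f :: "'k::finite list \<Rightarrow> complex"
  assumes "f [] = 0"
  shows "Series (moment f) = 1 + ssub f (\<lambda>x. zvar x * Series (moment f))"
proof -
  define g :: "'k list \<Rightarrow> complex" where "g u = (if u = [] then 0 else 1)" for u
  define Z where "Z = cpl_series (joint f g)"
  have "Series (moment f) = 1 + pull (Z * Z)"
  proof (rule ncseries_eqI)
    fix w show "cf (Series (moment f)) w = cf (1 + pull (Z * Z)) w"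
    proof (cases "w = []")
      case False
      have "boxed f g w = cf (Z * Z) (dbl w)"
        unfolding Z_def by (rule boxed_eq_cf) (use assms False in \<open>simp_all add: g_def\<close>)
      then show ?thesis using False by (simp add: moment_boxed g_def[abs_def] cf_one)
    qed (simp add: cf_one Z_def cpl_series_def)
  qed
  moreover have "Z = sandwich (joint f (\<lambda>u. if u = [] then 0 else 1)) Z"
    unfolding Z_def g_def[abs_def] by (rule cpl_series_sandwich)
  ultimately show ?thesis using moment_series_boxed_const[where f = f and Z = Z, OF assms] by simp
qed

text \<open>
  Families of cumulants vanish at the empty word, for which the sum over partitions has a different value.
\<close>

definition boxed0 :: "('k list \<Rightarrow> complex) \<Rightarrow> ('k list \<Rightarrow> complex) \<Rightarrow> 'k list \<Rightarrow> complex" where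
  "boxed0 f g w = (if w = [] then 0 else boxed f g w)"

theorem moment_dbl:
  fixes f g :: "'k::finite list \<Rightarrow> complex"
  assumes f: "f [] = 0" and g: "g [] = 0"
  shows "moment (joint f g) (dbl w) = moment (boxed0 f g) w"
proof -
  define Z where "Z = cpl_series (joint f g)"
  have \<kappa>: "joint f g [] = 0" using joint_Inl[of f g "[]"] f by simp
  have "boxed0 f g = cf (pull (Z * Z))"
    using boxed_eq_cf[where f = f and g = g, OF f g] by (auto simp: boxed0_def Z_def cpl_series_def)
  then have "pull (Series (moment (joint f g))) =
      1 + ssub (boxed0 f g) (\<lambda>i. zvar i * pull (Series (moment (joint f g))))"
    using product_moment_series[where f = f and g = g and Z = Z, OF f g _ moment_series[where f = "joint f g", OF \<kappa>]] cpl_series_sandwich[of "joint f g"]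
    by (simp add: Z_def)
  moreover have "boxed0 f g [] = 0" by (simp add: boxed0_def)
  ultimately have "pull (Series (moment (joint f g))) = Series (moment (boxed0 f g))"
    using moment_series[where f = "boxed0 f g"] moment_series_unique[where f = "boxed0 f g"] by blast
  from arg_cong[OF this, of "\<lambda>F. cf F w"] show ?thesis by simp
qed

section \<open>A Fock space model of free tuples\<close>

lemma linear_pm_iff:
  "Vector_Spaces.linear pm_scale pm_scale F \<longleftrightarrow>
     (\<forall>x y. F (x + y) = F x + F y) \<and> (\<forall>c x. F (pm_scale c x) = pm_scale c (F x))"
  by (auto simp: Vector_Spaces.linear_def module_hom_def module_hom_axioms_def module_iff_vector_space
      vector_space_pm_scale)

text \<open>
  The letter \<open>x\<close> acts on the basis vector \<open>u\<close> of the Fock space by creation of \<open>x\<close> and by annihilation of an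
  arbitrary initial segment of \<open>u\<close>.  Words are processed from right to left, so the removed segment consists
  of the later letters of a block whose first letter is \<open>x\<close>.  The space is the free algebra itself, which makes
  the splitting of words by colour a product.
\<close>

definition fock_step :: "('l list \<Rightarrow> complex) \<Rightarrow> 'l \<Rightarrow> 'l ncpoly \<Rightarrow> 'l ncpoly" where
  "fock_step \<kappa> x = lin_ext pm_scale (\<lambda>u. Poly_Mapping.single (x # u) 1 +
     (\<Sum>j\<le>length u. Poly_Mapping.single (drop j u) (\<kappa> (x # take j u))))"

definition fock_act :: "('l list \<Rightarrow> complex) \<Rightarrow> 'l ncpoly \<Rightarrow> 'l ncpoly \<Rightarrow> 'l ncpoly" where
  "fock_act \<kappa> p v = lin_ext pm_scale (\<lambda>w. foldr (fock_step \<kappa>) w v) p"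

definition fock :: "('l list \<Rightarrow> complex) \<Rightarrow> 'l ncpoly \<Rightarrow> complex" where
  "fock \<kappa> p = Poly_Mapping.lookup (fock_act \<kappa> p 1) []"

lemma linear_fock_step: "Vector_Spaces.linear pm_scale pm_scale (fock_step \<kappa> x)"
  unfolding fock_step_def by (rule linear_lin_ext[OF vector_space_pm_scale])

lemma linear_fock_word: "Vector_Spaces.linear pm_scale pm_scale (foldr (fock_step \<kappa>) w)"
proof (induction w)
  case (Cons x w)
  then show ?case using linear_fock_step[of \<kappa> x] by (simp add: linear_pm_iff)
qed (simp add: linear_pm_iff)

lemma linear_fock_act: "Vector_Spaces.linear pm_scale pm_scale (\<lambda>p. fock_act \<kappa> p v)"
  unfolding fock_act_def by (rule linear_lin_ext[OF vector_space_pm_scale])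

lemma fock_act_single [simp]:
  "fock_act \<kappa> (Poly_Mapping.single w c) v = pm_scale c (foldr (fock_step \<kappa>) w v)"
  unfolding fock_act_def by (rule lin_ext_single[OF vector_space_pm_scale])

lemma pm_scale_1 [simp]: "pm_scale 1 p = p"
  by (rule poly_mapping_eqI) simp

lemma fock_act_mult: "fock_act \<kappa> (p * q) v = fock_act \<kappa> p (fock_act \<kappa> q v)"
proof -
  interpret A: complex_algebra "pm_scale :: complex \<Rightarrow> 'a ncpoly \<Rightarrow> _" by (rule complex_algebra_pm_scale)
  have add: "fock_act \<kappa> (p + q) v = fock_act \<kappa> p v + fock_act \<kappa> q v"
    and scale: "fock_act \<kappa> (pm_scale c p) v = pm_scale c (fock_act \<kappa> p v)" for p q v c
    using linear_fock_act[of \<kappa> v] by (simp_all add: linear_pm_iff)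
  have single: "fock_act \<kappa> (Poly_Mapping.single w 1 * q) v = foldr (fock_step \<kappa>) w (fock_act \<kappa> q v)" for w q
  proof -
    have "(\<lambda>q. fock_act \<kappa> (Poly_Mapping.single w 1 * q) v) = (\<lambda>q. foldr (fock_step \<kappa>) w (fock_act \<kappa> q v))"
    proof (rule linear_pm_eqI)
      show "Vector_Spaces.linear pm_scale pm_scale (\<lambda>q. fock_act \<kappa> (Poly_Mapping.single w 1 * q) v)"
        by (simp add: linear_pm_iff distrib_left add scale A.scale_mult_right)
      show "Vector_Spaces.linear pm_scale pm_scale (\<lambda>q. foldr (fock_step \<kappa>) w (fock_act \<kappa> q v))"
        using linear_fock_word[of \<kappa> w] by (simp add: linear_pm_iff add scale)
    qed (simp add: mult_single plus_list_def)
    then show ?thesis by (rule fun_cong)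
  qed
  have "(\<lambda>p. fock_act \<kappa> (p * q) v) = (\<lambda>p. fock_act \<kappa> p (fock_act \<kappa> q v))"
  proof (rule linear_pm_eqI)
    show "Vector_Spaces.linear pm_scale pm_scale (\<lambda>p. fock_act \<kappa> (p * q) v)"
      by (simp add: linear_pm_iff distrib_right add scale A.scale_mult_left)
    show "Vector_Spaces.linear pm_scale pm_scale (\<lambda>p. fock_act \<kappa> p (fock_act \<kappa> q v))"
      by (rule linear_fock_act)
  qed (simp add: single)
  then show ?thesis by (rule fun_cong)
qed

lemma fock_act_one [simp]: "fock_act \<kappa> 1 v = (v :: 'l ncpoly)"
proof -
  have "(1 :: 'l ncpoly) = Poly_Mapping.single [] 1" by (simp only: single_one[symmetric] zero_list_def)
  then have "fock_act \<kappa> 1 v = fock_act \<kappa> (Poly_Mapping.single [] 1) v" by (rule arg_cong)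
  then show ?thesis by simp
qed

lemma nc_prob_space_fock: "nc_prob_space pm_scale (fock \<kappa>)"
proof -
  have "Vector_Spaces.linear pm_scale (*) (fock \<kappa>)"
    using linear_fock_act[of \<kappa> 1] vector_space_pm_scale complex_algebra.axioms(1)[OF complex_algebra_complex]
    by (auto simp: fock_def[abs_def] linear_pm_iff Vector_Spaces.linear_def module_hom_def
        module_hom_axioms_def module_iff_vector_space lookup_add)
  moreover have "fock \<kappa> 1 = 1"
    by (simp add: fock_def lookup_one zero_list_def)
  ultimately show ?thesis
    by (simp add: nc_prob_space_def nc_prob_space_axioms_def complex_algebra_pm_scale)
qed

subsection \<open>Moments\<close>

lemma keys_fock_word:
  "u \<in> Poly_Mapping.keys (foldr (fock_step \<kappa>) w 1) \<Longrightarrow> length u \<le> length w"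
proof (induction w arbitrary: u)
  case Nil
  then show ?case by (simp add: zero_list_def)
next
  case (Cons x w)
  let ?y = "foldr (fock_step \<kappa>) w 1"
  have "(\<Sum>s\<in>Poly_Mapping.keys ?y. Poly_Mapping.lookup ?y s * Poly_Mapping.lookup (Poly_Mapping.single (x # s) 1 +
     (\<Sum>j\<le>length s. Poly_Mapping.single (drop j s) (\<kappa> (x # take j s)))) u) \<noteq> 0"
    using Cons.prems by (simp add: fock_step_def[of \<kappa> x] lin_ext_def in_keys_iff lookup_sum)
  then obtain s where s: "s \<in> Poly_Mapping.keys ?y" "Poly_Mapping.lookup (Poly_Mapping.single (x # s) (1::complex) +
     (\<Sum>j\<le>length s. Poly_Mapping.single (drop j s) (\<kappa> (x # take j s)))) u \<noteq> 0"
    by (elim sum.not_neutral_contains_not_neutral) auto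
  have "u = x # s \<or> (\<exists>j. drop j s = u)"
  proof (rule ccontr)
    assume "\<not> ?thesis"
    then have "x # s \<noteq> u" "drop j s \<noteq> u" for j by auto
    then show False using s(2) by (simp add: lookup_add lookup_single lookup_sum when_def)
  qed
  with Cons.IH[OF s(1)] show ?case by auto
qed

text \<open>
  The segment removed from a basis vector in order to arrive at \<open>u\<close> is arbitrary, hence the sum over
  words \<open>r\<close>; the bound \<open>N\<close> only serves to make it finite.
\<close>

lemma lookup_fock_step:
  fixes \<kappa> :: "'l::finite list \<Rightarrow> complex"
  assumes N: "\<And>s. s \<in> Poly_Mapping.keys y \<Longrightarrow> length s \<le> N"
  shows "Poly_Mapping.lookup (fock_step \<kappa> x y) u =
    (if u \<noteq> [] \<and> hd u = x then Poly_Mapping.lookup y (tl u) else 0) +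
    (\<Sum>r | length r \<le> N. \<kappa> (x # r) * Poly_Mapping.lookup y (r @ u))"
proof -
  let ?K = "Poly_Mapping.keys y" and ?l = "Poly_Mapping.lookup y"
  have pick: "(\<Sum>s\<in>?K. if s = a then ?l s else 0) = ?l a" for a
    by (cases "a \<in> ?K") (simp_all add: in_keys_iff)
  have inner: "(\<Sum>j\<le>length s. if drop j s = u then \<kappa> (x # take j s) else 0) =
      (\<Sum>r | length r \<le> N. if s = r @ u then \<kappa> (x # r) else 0)" if s: "s \<in> ?K" for s
  proof -
    have "(\<Sum>j\<le>length s. if drop j s = u then \<kappa> (x # take j s) else 0) =
        (\<Sum>j\<in>{j\<in>{..length s}. drop j s = u}. \<kappa> (x # take j s))"
      by (subst sum.inter_filter) simp_all
    also have "\<dots> = (\<Sum>r\<in>{r\<in>{r. length r \<le> N}. s = r @ u}. \<kappa> (x # r))"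
      using N[OF s] by (intro sum.reindex_bij_witness[of _ length "\<lambda>j. take j s"]) auto
    also have "\<dots> = (\<Sum>r | length r \<le> N. if s = r @ u then \<kappa> (x # r) else 0)"
      by (subst sum.inter_filter) (simp_all add: finite_words)
    finally show ?thesis .
  qed
  have "Poly_Mapping.lookup (fock_step \<kappa> x y) u = (\<Sum>s\<in>?K. ?l s * ((if u = x # s then 1 else 0) +
      (\<Sum>j\<le>length s. if drop j s = u then \<kappa> (x # take j s) else 0)))"
    by (auto simp: fock_step_def lin_ext_def lookup_sum lookup_add lookup_single when_def eq_commute
        intro!: sum.cong)
  also have "\<dots> = (\<Sum>s\<in>?K. if u = x # s then ?l s else 0) +
      (\<Sum>s\<in>?K. ?l s * (\<Sum>r | length r \<le> N. if s = r @ u then \<kappa> (x # r) else 0))"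
    unfolding sum.distrib[symmetric] by (intro sum.cong refl) (simp add: inner algebra_simps)
  also have "(\<Sum>s\<in>?K. if u = x # s then ?l s else 0) =
      (if u \<noteq> [] \<and> hd u = x then Poly_Mapping.lookup y (tl u) else 0)"
  proof (cases u)
    case (Cons a v)
    then show ?thesis using pick[of v] by (auto simp: eq_commute[of v])
  qed simp
  also have "(\<Sum>s\<in>?K. ?l s * (\<Sum>r | length r \<le> N. if s = r @ u then \<kappa> (x # r) else 0)) =
      (\<Sum>r | length r \<le> N. \<kappa> (x # r) * (\<Sum>s\<in>?K. if s = r @ u then ?l s else 0))"
    unfolding sum_distrib_left by (subst sum.swap) (auto intro!: sum.cong)
  finally show ?thesis by (simp add: pick)
qed

definition fock_series :: "('l list \<Rightarrow> complex) \<Rightarrow> 'l list \<Rightarrow> 'l ncseries" where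
  "fock_series \<kappa> u = Series (\<lambda>W. Poly_Mapping.lookup (foldr (fock_step \<kappa>) W 1) u)"

lemma cf_fock_series_Nil [simp]: "cf (fock_series \<kappa> u) [] = (if u = [] then 1 else 0)"
  by (simp add: fock_series_def lookup_one zero_list_def when_def)

lemma cf_fock_series_Cons:
  fixes \<kappa> :: "'l::finite list \<Rightarrow> complex"
  assumes "length W \<le> N"
  shows "cf (fock_series \<kappa> u) (x # W) =
    (if u \<noteq> [] \<and> hd u = x then cf (fock_series \<kappa> (tl u)) W else 0) +
    (\<Sum>r | length r \<le> N. \<kappa> (x # r) * cf (fock_series \<kappa> (r @ u)) W)"
proof -
  have "length s \<le> N" if "s \<in> Poly_Mapping.keys (foldr (fock_step \<kappa>) W 1)" for s
    using keys_fock_word[OF that] assms by simp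
  from lookup_fock_step[where \<kappa> = \<kappa> and x = x and u = u, OF this] show ?thesis
    by (simp add: fock_series_def)
qed

text \<open>
  Consider the moment at which the letter \<open>y\<close> is created for good.  Before, on the right, the
  vector \<open>u\<close> has been produced from the vacuum; afterwards \<open>y\<close> and \<open>u\<close> are not touched any more, and \<open>v\<close> is
  produced in front of them as if from the vacuum.
\<close>

lemma fock_series_append:
  fixes \<kappa> :: "'l::finite list \<Rightarrow> complex"
  shows "fock_series \<kappa> (v @ y # u) = fock_series \<kappa> v * (zvar y * fock_series \<kappa> u)"
proof (rule ncseries_eqI)
  let ?K = "fock_series \<kappa>"
  fix W show "cf (?K (v @ y # u)) W = cf (?K v * (zvar y * ?K u)) W"
  proof (induction W arbitrary: v u)
    case (Cons x W)
    let ?R = "zvar y * ?K u"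
    define N where "N = length W"
    define T where "T = (if v \<noteq> [] \<and> hd v = x then ?K (tl v) else 0)"
    have "cf (lder x (?K v) * ?R) W =
        cf ((T + (\<Sum>r | length r \<le> N. const (\<kappa> (x # r)) * ?K (r @ v))) * ?R) W"
      unfolding cf_mult
      by (intro sum.cong refl) (auto simp: cf_fock_series_Cons[of _ N] N_def T_def)
    also have "\<dots> = cf (T * ?R) W + (\<Sum>r | length r \<le> N. \<kappa> (x # r) * cf (?K (r @ v) * ?R) W)"
      by (simp add: distrib_right sum_distrib_right mult.assoc)
    also have "\<dots> = cf (T * ?R) W + (\<Sum>r | length r \<le> N. \<kappa> (x # r) * cf (?K (r @ v @ y # u)) W)"
      using Cons.IH[symmetric] by simp
    finally have "cf (?K v * ?R) (x # W) = cf (?K v) [] * cf ?R (x # W) + cf (T * ?R) W +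
        (\<Sum>r | length r \<le> N. \<kappa> (x # r) * cf (?K (r @ v @ y # u)) W)"
      by (simp add: cf_mult_Cons)
    moreover have "cf (?K v) [] * cf ?R (x # W) + cf (T * ?R) W =
        (if hd (v @ [y]) = x then cf (?K (tl (v @ y # u))) W else 0)"
      using Cons.IH by (cases v) (simp_all add: T_def)
    moreover have "hd (v @ y # u) = hd (v @ [y])" by (cases v) simp_all
    ultimately show ?case
      using cf_fock_series_Cons[of W N \<kappa> "v @ y # u" x] by (simp add: N_def)
  qed simp
qed

text \<open>
  For a word \<open>u = y\<^sub>1 y\<^sub>2 \<dots>\<close> the previous lemma gives \<open>M z\<^sub>y\<^sub>1 M z\<^sub>y\<^sub>2 \<dots> M\<close> with \<open>M\<close> the series of vacuum
  moments.  As the leftmost letter of a nonempty word has to annihilate all that is left, \<open>M\<close> satisfies the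
  equation of a moment series.
\<close>

theorem fock_moment:
  fixes \<kappa> :: "'l::finite list \<Rightarrow> complex"
  assumes \<kappa>: "\<kappa> [] = 0"
  shows "fock \<kappa> (ncmon W) = moment \<kappa> W"
proof -
  define M where "M = fock_series \<kappa> []"
  define S where "S y = M * zvar y" for y
  have S0: "cf (S y) [] = 0" for y by (simp add: S_def)
  \<comment> \<open>The letters of \<open>u\<close> are created for good one after the other.\<close>
  have K: "fock_series \<kappa> u = smon S u * M" for u
  proof (induction u)
    case (Cons y u)
    then show ?case using fock_series_append[of \<kappa> "[]" y u] by (simp add: M_def S_def mult.assoc)
  qed (simp add: M_def)
  have "M = 1 + sandwich \<kappa> M * M"
  proof (rule ncseries_eqI)
    fix W show "cf M W = cf (1 + sandwich \<kappa> M * M) W"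
    proof (cases W)
      case (Cons x V)
      have "lder x (sandwich \<kappa> M) = ssub (\<lambda>r. \<kappa> (x # r)) S"
        by (rule ncseries_eqI) (simp add: cf_sandwich_Cons S_def[abs_def])
      then have "cf (sandwich \<kappa> M * M) W = (\<Sum>r | length r \<le> length V. \<kappa> (x # r) * cf (smon S r * M) V)"
        by (simp add: Cons cf_mult_Cons cf_sum_mult_words_right S0)
      also have "\<dots> = cf M W"
        using cf_fock_series_Cons[of V "length V" \<kappa> "[]" x] by (simp add: Cons K[symmetric] M_def[symmetric])
      finally show ?thesis by (simp add: Cons cf_one)
    qed (simp add: M_def cf_one)
  qed
  moreover have "const 0 = (0 :: 'l ncseries)" by (rule ncseries_eqI) simp
  ultimately have "M = 1 + ssub \<kappa> (\<lambda>x. zvar x * M)"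
    unfolding ssub_sandwich(1) \<kappa> by (simp only: add_0_left)
  then have "M = Series (moment \<kappa>)"
    using moment_series[where f = \<kappa>, OF \<kappa>] by (rule moment_series_unique)
  then have "cf M W = moment \<kappa> W" by simp
  then show ?thesis
    by (simp add: fock_def ncmon_single M_def fock_series_def)
qed

subsection \<open>Freeness\<close>

definition colour_alg :: "('l \<Rightarrow> bool) \<Rightarrow> bool \<Rightarrow> 'l ncpoly set" where
  "colour_alg c b = {p. \<forall>w\<in>Poly_Mapping.keys p. \<forall>x\<in>set w. c x = b}"

text \<open>
  Vectors in front of which colour \<open>b\<close> acts as on the vacuum.
\<close>

definition off_colour :: "('l \<Rightarrow> bool) \<Rightarrow> bool \<Rightarrow> 'l ncpoly set" where
  "off_colour c b = {p. \<forall>w\<in>Poly_Mapping.keys p. w = [] \<or> c (hd w) \<noteq> b}"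

lemma colour_alg_add: "p \<in> colour_alg c b \<Longrightarrow> q \<in> colour_alg c b \<Longrightarrow> p + q \<in> colour_alg c b"
  using keys_add[of p q] by (auto simp: colour_alg_def)

lemma colour_alg_scale: "p \<in> colour_alg c b \<Longrightarrow> pm_scale d p \<in> colour_alg c b"
  by (auto simp: colour_alg_def in_keys_iff)

lemma colour_alg_zero: "0 \<in> colour_alg c b" by (simp add: colour_alg_def)

lemma colour_alg_sum: "(\<And>i. i \<in> I \<Longrightarrow> h i \<in> colour_alg c b) \<Longrightarrow> sum h I \<in> colour_alg c b"
  by (induction I rule: infinite_finite_induct) (auto intro: colour_alg_add colour_alg_zero)

lemma colour_alg_single: "(\<And>x. x \<in> set w \<Longrightarrow> c x = b) \<Longrightarrow> Poly_Mapping.single w d \<in> colour_alg c b"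
  by (auto simp: colour_alg_def)

lemma colour_alg_mult:
  assumes "p \<in> colour_alg c b" "q \<in> colour_alg c b" shows "p * q \<in> colour_alg c b"
  using keys_mult[of p q] assms by (fastforce simp: colour_alg_def plus_list_def)

lemma unital_subalgebra_colour_alg: "unital_subalgebra pm_scale (colour_alg c b)"
proof -
  interpret vector_space "pm_scale :: complex \<Rightarrow> 'a ncpoly \<Rightarrow> _" by (rule vector_space_pm_scale)
  have "1 \<in> colour_alg c b" by (simp add: colour_alg_def zero_list_def)
  then show ?thesis
    unfolding unital_subalgebra_def
    by (auto simp: subspace_def colour_alg_zero intro: colour_alg_add colour_alg_scale colour_alg_mult)
qed

context
  fixes \<kappa> :: "'l list \<Rightarrow> complex" and c :: "'l \<Rightarrow> bool"
  assumes mixed: "\<And>W x y. x \<in> set W \<Longrightarrow> y \<in> set W \<Longrightarrow> c x \<noteq> c y \<Longrightarrow> \<kappa> W = 0"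
begin

lemma fock_step_single:
  "fock_step \<kappa> x (Poly_Mapping.single u 1) = Poly_Mapping.single (x # u) 1 +
     (\<Sum>j\<le>length u. Poly_Mapping.single (drop j u) (\<kappa> (x # take j u)))"
  by (simp add: fock_step_def lin_ext_single[OF vector_space_pm_scale])

text \<open>
  A segment reaching beyond \<open>s\<close> contains a letter of the other colour, so its cumulant vanishes.
\<close>

lemma fock_step_append:
  assumes x: "c x = b" and s: "\<And>y. y \<in> set s \<Longrightarrow> c y = b" and u: "u = [] \<or> c (hd u) \<noteq> b"
  shows "fock_step \<kappa> x (Poly_Mapping.single (s @ u) 1) =
    fock_step \<kappa> x (Poly_Mapping.single s 1) * Poly_Mapping.single u 1"
proof -
  have "(\<Sum>j\<le>length (s @ u). Poly_Mapping.single (drop j (s @ u)) (\<kappa> (x # take j (s @ u)))) =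
      (\<Sum>j\<le>length s. Poly_Mapping.single (drop j (s @ u)) (\<kappa> (x # take j (s @ u))))"
  proof (rule sum.mono_neutral_right)
    show "\<forall>j\<in>{..length (s @ u)} - {..length s}. Poly_Mapping.single (drop j (s @ u)) (\<kappa> (x # take j (s @ u))) = 0"
    proof
      fix j assume j: "j \<in> {..length (s @ u)} - {..length s}"
      then obtain y v where "u = y # v" by (cases u) auto
      then have "\<kappa> (x # take j (s @ u)) = 0"
        using j x u by (intro mixed[of x _ y]) (auto simp: take_Cons')
      then show "Poly_Mapping.single (drop j (s @ u)) (\<kappa> (x # take j (s @ u))) = 0" by simp
    qed
  qed auto
  also have "\<dots> = (\<Sum>j\<le>length s. Poly_Mapping.single (drop j s @ u) (\<kappa> (x # take j s)))"
    by (intro sum.cong) auto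
  finally show ?thesis
    by (simp add: fock_step_single distrib_right sum_distrib_right mult_single plus_list_def)
qed

lemma fock_step_mult:
  assumes x: "c x = b" and y: "y \<in> colour_alg c b" and v: "v \<in> off_colour c b"
  shows "fock_step \<kappa> x (y * v) = fock_step \<kappa> x y * v" and "fock_step \<kappa> x y \<in> colour_alg c b"
proof -
  interpret A: complex_algebra "pm_scale :: complex \<Rightarrow> 'l ncpoly \<Rightarrow> _" by (rule complex_algebra_pm_scale)
  interpret L: Vector_Spaces.linear pm_scale pm_scale "fock_step \<kappa> x" by (rule linear_fock_step)
  have commute: "pm_scale d (pm_scale e p) = pm_scale e (pm_scale d p)" for d e and p :: "'l ncpoly"
    by (rule poly_mapping_eqI) simp
  have expand: "p = (\<Sum>s\<in>Poly_Mapping.keys p. pm_scale (Poly_Mapping.lookup p s) (Poly_Mapping.single s 1))"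
    for p :: "'l ncpoly" by (simp add: pm_scale_single pm_sum_singles)
  let ?e = "\<lambda>s. Poly_Mapping.single s (1 :: complex)"
  have step: "fock_step \<kappa> x (?e s * ?e u) = fock_step \<kappa> x (?e s) * ?e u"
    if "s \<in> Poly_Mapping.keys y" "u \<in> Poly_Mapping.keys v" for s u
    using fock_step_append[of x b s u] that assms
    by (auto simp: mult_single plus_list_def colour_alg_def off_colour_def)
  have "fock_step \<kappa> x (y * v) = (\<Sum>s\<in>Poly_Mapping.keys y. \<Sum>u\<in>Poly_Mapping.keys v.
      pm_scale (Poly_Mapping.lookup y s) (pm_scale (Poly_Mapping.lookup v u) (fock_step \<kappa> x (?e s * ?e u))))"
    by (subst (1) expand[of y], subst (1) expand[of v])
      (simp only: sum_product L.sum L.scale A.scale_mult_left A.scale_mult_right, simp only: commute)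
  also have "\<dots> = (\<Sum>s\<in>Poly_Mapping.keys y. \<Sum>u\<in>Poly_Mapping.keys v.
      pm_scale (Poly_Mapping.lookup y s) (pm_scale (Poly_Mapping.lookup v u) (fock_step \<kappa> x (?e s) * ?e u)))"
    by (intro sum.cong refl) (simp only: step)
  also have "\<dots> = fock_step \<kappa> x y * v"
    by (subst (3) expand[of y], subst (2) expand[of v])
      (simp only: sum_product L.sum L.scale A.scale_mult_left A.scale_mult_right, simp only: commute)
  finally show "fock_step \<kappa> x (y * v) = fock_step \<kappa> x y * v" .
  have "fock_step \<kappa> x (?e s) \<in> colour_alg c b" if "s \<in> Poly_Mapping.keys y" for s
    unfolding fock_step_single using that x y
    by (intro colour_alg_add colour_alg_sum colour_alg_single)
      (auto simp: colour_alg_def dest: in_set_dropD)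
  then show "fock_step \<kappa> x y \<in> colour_alg c b"
    by (subst expand[of y]) (simp only: L.sum L.scale, intro colour_alg_sum colour_alg_scale)
qed

lemma one_colour: "1 \<in> colour_alg c b" "1 \<in> off_colour c b"
  using unital_subalgebra_colour_alg by (auto simp: unital_subalgebra_def off_colour_def zero_list_def)

lemma fock_word_mult:
  assumes v: "v \<in> off_colour c b" and w: "\<And>x. x \<in> set w \<Longrightarrow> c x = b"
  shows "foldr (fock_step \<kappa>) w v = foldr (fock_step \<kappa>) w 1 * v \<and> foldr (fock_step \<kappa>) w 1 \<in> colour_alg c b"
  using w
proof (induction w)
  case Nil
  then show ?case by (simp add: one_colour)
next
  case (Cons x w)
  then show ?case using fock_step_mult[of x b "foldr (fock_step \<kappa>) w 1" v] v by simp
qed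

lemma fock_act_colour:
  assumes p: "p \<in> colour_alg c b" and v: "v \<in> off_colour c b"
  shows "fock_act \<kappa> p v = fock_act \<kappa> p 1 * v" and "fock_act \<kappa> p 1 \<in> colour_alg c b"
proof -
  interpret A: complex_algebra "pm_scale :: complex \<Rightarrow> 'l ncpoly \<Rightarrow> _" by (rule complex_algebra_pm_scale)
  have w: "foldr (fock_step \<kappa>) w v = foldr (fock_step \<kappa>) w 1 * v" "foldr (fock_step \<kappa>) w 1 \<in> colour_alg c b"
    if "w \<in> Poly_Mapping.keys p" for w
    using fock_word_mult[OF v, of w] that p by (auto simp: colour_alg_def)
  show "fock_act \<kappa> p v = fock_act \<kappa> p 1 * v"
    by (simp add: fock_act_def lin_ext_def sum_distrib_right A.scale_mult_left w(1))
  show "fock_act \<kappa> p 1 \<in> colour_alg c b"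
    unfolding fock_act_def lin_ext_def by (intro colour_alg_sum colour_alg_scale w)
qed

text \<open>
  By induction from the right: the factor \<open>p\<close> meets a vector \<open>v\<close> that does not start with its colour, so it
  produces the product of \<open>p\<close> applied to the vacuum and \<open>v\<close>; since \<open>p\<close> is centred, the first factor has no vacuum
  component.
\<close>

lemma fock_alternating:
  assumes "ps \<noteq> []" "distinct_adj (map fst ps)"
    and "\<And>b p. (b, p) \<in> set ps \<Longrightarrow> p \<in> colour_alg c b \<and> fock \<kappa> p = 0"
    and "u \<in> Poly_Mapping.keys (fock_act \<kappa> (prod_list (map snd ps)) 1)"
  shows "u \<noteq> [] \<and> c (hd u) = fst (hd ps)"
  using assms
proof (induction ps arbitrary: u)
  case (Cons bp ps)
  obtain b p where bp: "bp = (b, p)" by force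
  define v where "v = fock_act \<kappa> (prod_list (map snd ps)) 1"
  have p: "p \<in> colour_alg c b" "fock \<kappa> p = 0" using Cons.prems(3)[of b p] by (simp_all add: bp)
  have v: "v \<in> off_colour c b"
  proof (cases "ps = []")
    case True
    then show ?thesis by (simp add: v_def one_colour)
  next
    case False
    then have "fst (hd ps) \<noteq> b" "distinct_adj (map fst ps)"
      using Cons.prems(2) by (cases ps; simp add: bp)+
    then show ?thesis
      using Cons.IH[OF False] Cons.prems(3) by (auto simp: off_colour_def v_def)
  qed
  have "u \<in> Poly_Mapping.keys (fock_act \<kappa> p 1 * v)"
    using Cons.prems(4) fock_act_colour(1)[OF p(1) v] by (simp add: bp fock_act_mult v_def)
  then obtain s t where st: "u = s @ t" "s \<in> Poly_Mapping.keys (fock_act \<kappa> p 1)"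
    using keys_mult[of "fock_act \<kappa> p 1" v] by (auto simp: plus_list_def)
  have "s \<noteq> []" using st(2) p(2) by (auto simp: fock_def in_keys_iff)
  moreover have "\<forall>x\<in>set s. c x = b"
    using fock_act_colour(2)[OF p(1) v] st(2) by (auto simp: colour_alg_def)
  ultimately show ?case by (simp add: st(1) bp)
qed simp

text \<open>
  An alternating product of centred elements maps the vacuum to a vector without vacuum component.
\<close>

theorem fock_free:
  assumes "S \<subseteq> colour_alg c True" "T \<subseteq> colour_alg c False"
  shows "freely_independent pm_scale (fock \<kappa>) S T"
  unfolding freely_independent_def freely_independent_subalgebras_def
proof (intro allI impI)
  fix n :: nat and d :: "nat \<Rightarrow> 'l ncpoly" and i :: "nat \<Rightarrow> bool"
  assume n: "1 \<le> n" and d: "\<forall>j<n. d j \<in> (if i j then unital_subalgebra pm_scale hull S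
      else unital_subalgebra pm_scale hull T) \<and> fock \<kappa> (d j) = 0"
    and i: "\<forall>j. Suc j < n \<longrightarrow> i j \<noteq> i (Suc j)"
  have hull: "unital_subalgebra pm_scale hull S \<subseteq> colour_alg c True"
    "unital_subalgebra pm_scale hull T \<subseteq> colour_alg c False"
    by (intro hull_minimal assms unital_subalgebra_colour_alg)+
  define ps where "ps = map (\<lambda>j. (i j, d j)) [0..<n]"
  have "ps \<noteq> []" using n by (simp add: ps_def)
  moreover have "distinct_adj (map fst ps)"
    using i by (auto simp: distinct_adj_conv_nth ps_def)
  moreover have "p \<in> colour_alg c b \<and> fock \<kappa> p = 0" if bp: "(b, p) \<in> set ps" for b p
  proof -
    obtain j where j: "j < n" "b = i j" "p = d j" using bp by (auto simp: ps_def)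
    have dj: "d j \<in> (if i j then unital_subalgebra pm_scale hull S else unital_subalgebra pm_scale hull T)"
      "fock \<kappa> (d j) = 0"
      using d j(1) by blast+
    then have "d j \<in> colour_alg c (i j)"
      using subsetD[OF hull(1), of "d j"] subsetD[OF hull(2), of "d j"] by (cases "i j") simp_all
    with dj j show ?thesis by simp
  qed
  ultimately have "u \<noteq> []" if "u \<in> Poly_Mapping.keys (fock_act \<kappa> (prod_list (map snd ps)) 1)" for u
    using fock_alternating[of ps u] that by blast
  then have "fock \<kappa> (prod_list (map snd ps)) = 0"
    unfolding fock_def by (metis in_keys_iff)
  then show "fock \<kappa> (prod_list (map d [0..<n])) = 0"
    by (simp add: ps_def comp_def)
qed

end

section \<open>The R-transform\<close>

lemma finite_NC [simp]: "finite (NC n)"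
proof (rule finite_subset)
  show "NC n \<subseteq> Pow (Pow {..<n})"
    using partition_on_block by (force simp: NC_iff)
qed simp

lemma top_NC: "n \<noteq> 0 \<Longrightarrow> {{..<n}} \<in> NC n"
  by (auto simp: NC_iff partition_on_def disjoint_def noncrossing_def)

lemma NC_not_top_block:
  assumes "\<pi> \<in> NC n" "\<pi> \<noteq> {{..<n}}" "B \<in> \<pi>"
  shows "B \<subset> {..<n}"
proof -
  have P: "partition_on {..<n} \<pi>" using assms by (simp add: NC_iff)
  have "B \<noteq> {..<n}"
  proof
    assume B: "B = {..<n}"
    have "C = B" if "C \<in> \<pi>" for C
      using partition_on_block[OF P that] partition_on_same[OF P that assms(3)] B by blast
    with assms(2,3) B show False by blast
  qed
  then show ?thesis using partition_on_block[OF P assms(3)] by blast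
qed

text \<open>
  Together with the preceding lemma this makes the partition with a single block the leading term of sums
  over non-crossing partitions, which are therefore triangular in the length of words.
\<close>

lemma length_nths_less:
  assumes "B \<subset> {..<length w}" shows "length (nths w B) < length w"
proof -
  have "length (nths w B) = card B"
    using assms by (auto simp: length_nths intro!: arg_cong[where f = card])
  also have "\<dots> < card {..<length w}" using assms by (intro psubset_card_mono) auto
  finally show ?thesis by simp
qed

lemma nths_top [simp]: "nths w {..<length w} = w"
  by (rule nths_all) simp

text \<open>
  The form in which triangular systems are solved, both for the cumulants of a distribution and for the
  cumulants of an inverse.
\<close>

lemma unique_length_recursion:
  fixes G :: "('k list \<Rightarrow> complex) \<Rightarrow> 'k list \<Rightarrow> complex"
  assumes G: "\<And>f g w. (\<And>v. length v < length w \<Longrightarrow> f v = g v) \<Longrightarrow> G f w = G g w"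
  shows "\<exists>!f. \<forall>w. f w = G f w"
proof (rule ex_ex1I)
  have "adm_wf (measure length) G"
    unfolding adm_wf_def by (auto intro: G)
  then have "wfrec (measure length) G = G (wfrec (measure length) G)"
    by (intro wfrec_fixpoint) simp
  then show "\<exists>f. \<forall>w. f w = G f w" by metis
next
  fix f g assume fg: "\<forall>w. f w = G f w" "\<forall>w. g w = G g w"
  have "f w = g w" for w
  proof (induction w rule: length_induct)
    case (1 w)
    then have "G f w = G g w" by (intro G) blast
    with fg show ?case by metis
  qed
  then show "f = g" by (rule ext)
qed

lemma moment_top:
  assumes "w \<noteq> []"
  shows "moment f w = f w + (\<Sum>\<pi>\<in>NC (length w) - {{{..<length w}}}. \<Prod>B\<in>\<pi>. f (nths w B))"
proof -
  have "{{..<length w}} \<in> NC (length w)" using assms by (intro top_NC) simp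
  then show ?thesis by (simp add: moment_def sum.remove)
qed

lemma
  fixes \<mu> :: "'k ncpoly \<Rightarrow> complex"
  shows R_transform_props: "R_transform \<mu> [] = 0" "w \<noteq> [] \<Longrightarrow> \<mu> (ncmon w) = moment (R_transform \<mu>) w"
  and R_transform_eqI: "f [] = 0 \<Longrightarrow> (\<And>w. w \<noteq> [] \<Longrightarrow> \<mu> (ncmon w) = moment f w) \<Longrightarrow> R_transform \<mu> = f"
proof -
  define G where "G f w = (if w = [] then 0 else
    \<mu> (ncmon w) - (\<Sum>\<pi>\<in>NC (length w) - {{{..<length w}}}. \<Prod>B\<in>\<pi>. f (nths w B)))" for f w
  have "\<exists>!f. \<forall>w. f w = G f w"
  proof (rule unique_length_recursion)
    fix f g :: "'k list \<Rightarrow> complex" and w :: "'k list"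
    assume "\<And>v. length v < length w \<Longrightarrow> f v = g v"
    then have "(\<Prod>B\<in>\<pi>. f (nths w B)) = (\<Prod>B\<in>\<pi>. g (nths w B))"
      if "\<pi> \<in> NC (length w) - {{{..<length w}}}" for \<pi>
      using NC_not_top_block[of \<pi> "length w"] that by (intro prod.cong) (auto intro: length_nths_less)
    then show "G f w = G g w" by (simp add: G_def)
  qed
  moreover have "(\<forall>w. f w = G f w) \<longleftrightarrow> f [] = 0 \<and> (\<forall>w. w \<noteq> [] \<longrightarrow> \<mu> (ncmon w) = moment f w)" for f
    by (auto simp: G_def moment_top)
  ultimately have ex1: "\<exists>!f. f [] = 0 \<and> (\<forall>w. w \<noteq> [] \<longrightarrow> \<mu> (ncmon w) = moment f w)" by simp
  have R: "R_transform \<mu> = (THE f. f [] = 0 \<and> (\<forall>w. w \<noteq> [] \<longrightarrow> \<mu> (ncmon w) = moment f w))"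
    by (simp add: R_transform_def moment_def)
  show "R_transform \<mu> [] = 0" "w \<noteq> [] \<Longrightarrow> \<mu> (ncmon w) = moment (R_transform \<mu>) w"
    using theI'[OF ex1] unfolding R by blast+
  show "f [] = 0 \<Longrightarrow> (\<And>w. w \<noteq> [] \<Longrightarrow> \<mu> (ncmon w) = moment f w) \<Longrightarrow> R_transform \<mu> = f"
    unfolding R using ex1 by (intro the1_equality) auto
qed

definition moment_functional :: "('k list \<Rightarrow> complex) \<Rightarrow> 'k ncpoly \<Rightarrow> complex" where
  "moment_functional m = lin_ext (*) m"

lemma vector_space_complex: "vector_space ((*) :: complex \<Rightarrow> _)"
  using complex_algebra_complex by (rule complex_algebra.axioms(1))

lemma linear_moment_functional: "Vector_Spaces.linear pm_scale (*) (moment_functional m)"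
  unfolding moment_functional_def by (rule linear_lin_ext[OF vector_space_complex])

lemma moment_functional_ncmon [simp]: "moment_functional m (ncmon w) = m w"
  by (simp add: moment_functional_def ncmon_single lin_ext_single[OF vector_space_complex])

lemma has_distribution_moment_functional:
  "has_distribution \<phi> a (moment_functional (\<lambda>w. \<phi> (prod_list (map a w))))"
  by (simp add: has_distribution_def linear_moment_functional)

lemma ncmon_Nil [simp]: "ncmon [] = 1"
  by (simp add: ncmon_def)

lemma D_alg_iff: "\<mu> \<in> D_alg \<longleftrightarrow> Vector_Spaces.linear pm_scale (*) \<mu> \<and> \<mu> (ncmon []) = 1"
  by (simp add: D_alg_def)

lemma D_alg_moments: "\<mu> \<in> D_alg \<Longrightarrow> \<mu> (ncmon w) = moment (R_transform \<mu>) w"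
  by (cases "w = []") (auto simp: D_alg_iff intro: R_transform_props(2))

lemma linear_ncmon_eqI:
  assumes "Vector_Spaces.linear pm_scale (*) \<mu>" "Vector_Spaces.linear pm_scale (*) \<nu>"
    and "\<And>w. \<mu> (ncmon w) = \<nu> (ncmon w)"
  shows "\<mu> = \<nu>"
  using assms by (intro linear_pm_eqI) (simp_all add: ncmon_single)

lemma D_alg_eq_moment_functional: "\<mu> \<in> D_alg \<Longrightarrow> \<mu> = moment_functional (moment (R_transform \<mu>))"
  by (intro linear_ncmon_eqI linear_moment_functional) (auto simp: D_alg_moments D_alg_iff)

lemma R_transform_moment_functional:
  "f [] = 0 \<Longrightarrow> R_transform (moment_functional (moment f)) = f"
  by (rule R_transform_eqI) simp_all

lemma moment_functional_D_alg: "moment_functional (moment f) \<in> D_alg"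
  using moment_functional_ncmon[of "moment f" "[]"] by (simp add: D_alg_iff linear_moment_functional)

lemma NC_1: "NC 1 = {{{..<1}}}"
proof -
  have "\<pi> = {{..<1}}" if "\<pi> \<in> NC 1" for \<pi>
  proof (rule ccontr)
    assume *: "\<pi> \<noteq> {{..<1}}"
    have P: "partition_on {..<1} \<pi>" using that by (simp add: NC_iff)
    obtain B where "B \<in> \<pi>" "0 \<in> B" by (rule partition_on_obtain[OF P, of 0]) simp_all
    then show False using NC_not_top_block[OF that *, of B] by auto
  qed
  moreover have "{{..<1}} \<in> NC 1" by (rule top_NC) simp
  ultimately show ?thesis by blast
qed

lemma moment_singleton [simp]: "moment f [i] = f [i]"
  using nths_top[of "[i]"] by (simp add: moment_def NC_1[unfolded One_nat_def])

subsection \<open>Kreweras complement of the partition with one block\<close>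

definition bottom :: "nat \<Rightarrow> nat set set" where
  "bottom n = (\<lambda>i. {i}) ` {..<n}"

lemma bottom_NC: "bottom n \<in> NC n"
  using partition_on_singletons[of "{..<n}"] by (auto simp: NC_iff bottom_def noncrossing_def)

lemma kreweras_top:
  assumes "n \<noteq> 0" shows "kreweras n {{..<n}} = bottom n"
proof (rule krewerasI[OF top_NC[OF assms] bottom_NC])
  fix i assume i: "i < n"
  have "block_perm (bottom n) i = next_in {i} i"
    using i bottom_NC[of n] by (intro block_perm_next_in[of "{..<n}"]) (auto simp: NC_iff bottom_def)
  then show "block_perm {{..<n}} (block_perm (bottom n) i) = (if Suc i = n then 0 else Suc i)"
    using i by (simp add: next_in_def block_perm_top)
qed

lemma nths_single: "i < length w \<Longrightarrow> nths w {i} = [w ! i]"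
  by (subst nths_letters) auto

lemma prod_bottom: "(\<Prod>C\<in>bottom (length w). g (nths w C)) = (\<Prod>i<length w. g [w ! i])"
  unfolding bottom_def by (subst prod.reindex) (auto simp: inj_on_def nths_single intro!: prod.cong)

lemma boxed_top:
  assumes "w \<noteq> []" "\<And>i. g [i] = 1"
  shows "boxed f g w = f w + (\<Sum>\<pi>\<in>NC (length w) - {{{..<length w}}}.
    (\<Prod>B\<in>\<pi>. f (nths w B)) * (\<Prod>C\<in>kreweras (length w) \<pi>. g (nths w C)))"
proof -
  have "{{..<length w}} \<in> NC (length w)" using assms by (intro top_NC) simp
  then show ?thesis
    using assms by (simp add: boxed_def sum.remove kreweras_top prod_bottom)
qed

lemma boxed_singleton: "(\<And>i. g [i] = 1) \<Longrightarrow> boxed f g [i] = f [i]"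
  using boxed_top[of "[i]" g f] by (simp add: NC_1[unfolded One_nat_def])

section \<open>Free multiplicative convolution\<close>

lemma prod_list_ncX: "prod_list (map (\<lambda>i. ncX (\<iota> i)) w) = ncmon (map \<iota> w)"
  by (simp add: ncmon_def comp_def)

lemma moment_map: "moment \<kappa> (map \<iota> w) = moment (\<lambda>u. \<kappa> (map \<iota> u)) w"
  by (simp add: moment_def nths_map)

lemma fock_distribution:
  fixes \<kappa> :: "'l::finite list \<Rightarrow> complex" and \<iota> :: "'k \<Rightarrow> 'l"
  assumes \<mu>: "\<mu> \<in> D_alg" and \<kappa>: "\<kappa> [] = 0" "\<And>u. \<kappa> (map \<iota> u) = R_transform \<mu> u"
  shows "has_distribution (fock \<kappa>) (\<lambda>i. ncX (\<iota> i)) \<mu>"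
  using \<mu> by (simp add: has_distribution_def D_alg_iff prod_list_ncX fock_moment \<kappa> moment_map D_alg_moments)

lemma ncX_colour_alg: "c x = b \<Longrightarrow> ncX x \<in> colour_alg c b"
  unfolding ncX_def by (rule colour_alg_single) simp

text \<open>
  The two tuples are the generators of the Fock space with the joint cumulants, and the moments of their
  products are the moments at doubled words.
\<close>

theorem free_mult_conv_boxed:
  fixes \<mu> \<nu> :: "'k::finite ncpoly \<Rightarrow> complex"
  assumes \<mu>: "\<mu> \<in> D_alg" and \<nu>: "\<nu> \<in> D_alg"
  shows "\<mu> \<boxtimes> \<nu> = moment_functional (moment (boxed0 (R_transform \<mu>) (R_transform \<nu>)))"
proof -
  define \<kappa> where "\<kappa> = joint (R_transform \<mu>) (R_transform \<nu>)"
  note R0 = R_transform_props(1)[of \<mu>] R_transform_props(1)[of \<nu>]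
  have \<kappa>0: "\<kappa> [] = 0" using joint_Inl[of "R_transform \<mu>" "R_transform \<nu>" "[]"] R0 by (simp add: \<kappa>_def)
  have dbl: "prod_list (map (\<lambda>i. ncX (Inl i) * ncX (Inr i)) w) = ncmon (dbl w)" for w :: "'k list"
    by (induction w) (simp_all add: ncmon_def mult.assoc)
  have "free_product_distribution pm_scale (fock \<kappa>) (\<lambda>i. ncX (Inl i)) (\<lambda>i. ncX (Inr i)) \<mu> \<nu>
      (moment_functional (moment (boxed0 (R_transform \<mu>) (R_transform \<nu>))))"
    unfolding free_product_distribution_def
  proof (intro conjI)
    show "freely_independent pm_scale (fock \<kappa>) (range (\<lambda>i. ncX (Inl i))) (range (\<lambda>i. ncX (Inr i)))"
      by (rule fock_free[where c = isl]) (auto simp: \<kappa>_def intro: joint_mixed ncX_colour_alg)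
    show "has_distribution (fock \<kappa>) (\<lambda>i. ncX (Inl i) * ncX (Inr i))
        (moment_functional (moment (boxed0 (R_transform \<mu>) (R_transform \<nu>))))"
      by (simp add: has_distribution_def linear_moment_functional dbl fock_moment[where \<kappa> = \<kappa>, OF \<kappa>0])
        (simp add: \<kappa>_def moment_dbl R0)
  qed (use \<mu> \<nu> \<kappa>0 in \<open>auto simp: \<kappa>_def R0 intro: nc_prob_space_fock fock_distribution\<close>)
  then show ?thesis by (rule free_mult_conv_eqI)
qed

lemma R_transform_free_mult_conv:
  fixes \<mu> \<nu> :: "'k::finite ncpoly \<Rightarrow> complex"
  assumes "\<mu> \<in> D_alg" "\<nu> \<in> D_alg"
  shows "R_transform (\<mu> \<boxtimes> \<nu>) = boxed0 (R_transform \<mu>) (R_transform \<nu>)"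
  by (simp add: free_mult_conv_boxed[OF assms] R_transform_moment_functional boxed0_def)

lemma free_mult_conv_D_alg:
  fixes \<mu> \<nu> :: "'k::finite ncpoly \<Rightarrow> complex"
  assumes "\<mu> \<in> D_alg" "\<nu> \<in> D_alg" shows "\<mu> \<boxtimes> \<nu> \<in> D_alg"
  by (simp add: free_mult_conv_boxed[OF assms] moment_functional_D_alg)

text \<open>
  Three free tuples \<open>a\<close>, \<open>b\<close>, \<open>d\<close> in one Fock space.  Two colourings of the letters are used: \<open>isl\<close>
  separates \<open>a\<close> from \<open>b\<close> and \<open>d\<close>, and \<open>left\<close> separates \<open>a\<close> and \<open>b\<close> from \<open>d\<close>.  Mixed cumulants vanish with
  respect to both of them, which yields all instances of freeness that occur in the two iterated convolutions.
\<close>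

theorem free_mult_conv_assoc:
  fixes \<mu> \<nu> \<rho> :: "'k::finite ncpoly \<Rightarrow> complex"
  assumes D: "\<mu> \<in> D_alg" "\<nu> \<in> D_alg" "\<rho> \<in> D_alg"
  shows "(\<mu> \<boxtimes> \<nu>) \<boxtimes> \<rho> = \<mu> \<boxtimes> (\<nu> \<boxtimes> \<rho>)"
proof -
  define \<kappa>2 where "\<kappa>2 = joint (R_transform \<nu>) (R_transform \<rho>)"
  define \<kappa> where "\<kappa> = joint (R_transform \<mu>) \<kappa>2"
  define left :: "'k + 'k + 'k \<Rightarrow> bool" where "left x = (case x of Inl i \<Rightarrow> True | Inr y \<Rightarrow> isl y)" for x
  note R0 = R_transform_props(1)[of \<mu>] R_transform_props(1)[of \<nu>] R_transform_props(1)[of \<rho>]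
  have \<kappa>20: "\<kappa>2 [] = 0" using joint_Inl[of "R_transform \<nu>" "R_transform \<rho>" "[]"] R0 by (simp add: \<kappa>2_def)
  have \<kappa>0: "\<kappa> [] = 0" using joint_Inl[of "R_transform \<mu>" \<kappa>2 "[]"] R0 by (simp add: \<kappa>_def)
  have mixed1: "\<kappa> W = 0" if "x \<in> set W" "y \<in> set W" "isl x \<noteq> isl y" for W x y
    unfolding \<kappa>_def using that by (rule joint_mixed)
  \<comment> \<open>A nonzero cumulant belongs to the first tuple alone or is one of \<open>\<kappa>2\<close>, where \<open>left\<close> agrees with \<open>isl\<close>.\<close>
  have mixed2: "\<kappa> W = 0" if "x \<in> set W" "y \<in> set W" "left x \<noteq> left y" for W x y
  proof (cases "\<exists>u. W = map Inr u")
    case True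
    then obtain u where u: "W = map Inr u" by blast
    then obtain x' y' where "x = Inr x'" "y = Inr y'" "x' \<in> set u" "y' \<in> set u" using \<open>x \<in> set W\<close> \<open>y \<in> set W\<close> by auto
    then have "\<kappa>2 u = 0" using that(3) unfolding \<kappa>2_def by (intro joint_mixed[of x' _ y']) (auto simp: left_def)
    then show ?thesis by (simp add: \<kappa>_def u R0 \<kappa>20)
  next
    case False
    show ?thesis
    proof (rule ccontr)
      assume "\<kappa> W \<noteq> 0"
      then obtain u where "W = map Inl u" using joint_nonzero False unfolding \<kappa>_def by blast
      with that show False by (auto simp: left_def)
    qed
  qed
  define a b d :: "'k \<Rightarrow> ('k + 'k + 'k) ncpoly" where "a i = ncX (Inl i)"
    and "b i = ncX (Inr (Inl i))" and "d i = ncX (Inr (Inr i))" for i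
  have col: "a i \<in> colour_alg isl True" "b i \<in> colour_alg isl False" "d i \<in> colour_alg isl False"
    "a i \<in> colour_alg left True" "b i \<in> colour_alg left True" "d i \<in> colour_alg left False" for i
    by (auto simp: a_def b_def d_def left_def intro: ncX_colour_alg)
  have map2: "\<kappa> (map (\<lambda>i. Inr (Inl i)) u) = R_transform \<nu> u" "\<kappa> (map (\<lambda>i. Inr (Inr i)) u) = R_transform \<rho> u" for u
    using joint_Inr[of "R_transform \<mu>" \<kappa>2 "map Inl u"] joint_Inr[of "R_transform \<mu>" \<kappa>2 "map Inr u"]
    by (simp_all add: \<kappa>_def R0 \<kappa>20 comp_def) (simp_all add: \<kappa>2_def R0)
  have dist: "has_distribution (fock \<kappa>) a \<mu>" "has_distribution (fock \<kappa>) b \<nu>" "has_distribution (fock \<kappa>) d \<rho>"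
  proof -
    show "has_distribution (fock \<kappa>) a \<mu>"
      unfolding a_def by (rule fock_distribution[where \<kappa> = \<kappa>, OF D(1) \<kappa>0]) (simp add: \<kappa>_def)
    show "has_distribution (fock \<kappa>) b \<nu>" "has_distribution (fock \<kappa>) d \<rho>"
      unfolding b_def d_def
      by (rule fock_distribution[where \<kappa> = \<kappa>, OF D(2) \<kappa>0 map2(1)]
          fock_distribution[where \<kappa> = \<kappa>, OF D(3) \<kappa>0 map2(2)])+
  qed
  define law where "law e = moment_functional (\<lambda>w. fock \<kappa> (prod_list (map e w)))" for e :: "'k \<Rightarrow> ('k + 'k + 'k) ncpoly"
  have law: "has_distribution (fock \<kappa>) e (law e)" for e
    unfolding law_def by (rule has_distribution_moment_functional)
  have conv: "\<mu>1 \<boxtimes> \<mu>2 = law (\<lambda>i. e1 i * e2 i)"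
    if "has_distribution (fock \<kappa>) e1 \<mu>1" "has_distribution (fock \<kappa>) e2 \<mu>2"
      "freely_independent pm_scale (fock \<kappa>) (range e1) (range e2)" for e1 e2 \<mu>1 \<mu>2
    by (rule free_mult_conv_eqI[where s = pm_scale and \<phi> = "fock \<kappa>" and a = e1 and b = e2])
      (use that law in \<open>simp add: free_product_distribution_def nc_prob_space_fock\<close>)
  have "\<mu> \<boxtimes> \<nu> = law (\<lambda>i. a i * b i)"
    using dist by (intro conv fock_free[where c = isl] mixed1) (auto intro: col)
  moreover have "law (\<lambda>i. a i * b i) \<boxtimes> \<rho> = law (\<lambda>i. a i * b i * d i)"
    using dist by (intro conv law fock_free[where c = left] mixed2) (auto intro: col colour_alg_mult)
  moreover have "\<nu> \<boxtimes> \<rho> = law (\<lambda>i. b i * d i)"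
    using dist by (intro conv fock_free[where c = left] mixed2) (auto intro: col)
  moreover have "\<mu> \<boxtimes> law (\<lambda>i. b i * d i) = law (\<lambda>i. a i * (b i * d i))"
    using dist by (intro conv law fock_free[where c = isl] mixed1) (auto intro: col colour_alg_mult)
  ultimately show ?thesis by (simp add: mult.assoc)
qed

section \<open>The two groups\<close>

lemma carrier_G: "\<mu> \<in> carrier G_group \<longleftrightarrow> \<mu> \<in> D_alg \<and> (\<forall>i. R_transform \<mu> [i] = 1)"
proof -
  have "\<mu> (ncX i) = R_transform \<mu> [i]" for i
    using R_transform_props(2)[of "[i]" \<mu>] by (simp add: ncmon_def)
  then show ?thesis by (simp add: G_group_def)
qed

text \<open>
  The cumulants of the constant tuple \<open>1\<close>.
\<close>

definition one_cumulant :: "'k list \<Rightarrow> complex" where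
  "one_cumulant u = (if length u = 1 then 1 else 0)"

lemma G_unit_eq: "(G_unit :: 'k::finite ncpoly \<Rightarrow> complex) = moment_functional (moment one_cumulant)"
proof (rule linear_ncmon_eqI)
  have G: "(G_unit :: 'k ncpoly \<Rightarrow> complex) = moment_functional (\<lambda>w. 1)"
    by (rule ext) (simp add: G_unit_def moment_functional_def lin_ext_def)
  show "Vector_Spaces.linear pm_scale (*) (G_unit :: 'k ncpoly \<Rightarrow> complex)"
    unfolding G by (rule linear_moment_functional)
  \<comment> \<open>The sum of all words is the moment series for these cumulants, since \<open>M = 1 + (\<Sum>x. z\<^sub>x M)\<close>.\<close>
  define M :: "'k ncseries" where "M = Series (\<lambda>w. 1)"
  have "(\<lambda>u. one_cumulant (x # u)) = cf 1" for x :: 'k by (auto simp: one_cumulant_def cf_one)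
  then have "ssub one_cumulant (\<lambda>x. zvar x * M) = const 0 + (\<Sum>x\<in>UNIV. zvar x * M)"
    by (subst ssub_left) (simp_all add: ssub_one one_cumulant_def)
  then have "M = 1 + ssub one_cumulant (\<lambda>x. zvar x * M)"
    by (intro ncseries_eqI, case_tac w) (simp_all add: M_def cf_one)
  then have "M = Series (moment one_cumulant)"
    by (rule moment_series_unique) (rule moment_series, simp add: one_cumulant_def)
  then have "moment one_cumulant w = 1" for w :: "'k list"
    by (metis M_def cf_Series)
  then show "G_unit (ncmon w) = moment_functional (moment one_cumulant) (ncmon w)" for w :: "'k list"
    by (simp add: G)
qed (rule linear_moment_functional)

lemma R_transform_G_unit: "R_transform (G_unit :: 'k::finite ncpoly \<Rightarrow> complex) = one_cumulant"
  unfolding G_unit_eq by (rule R_transform_moment_functional) (simp add: one_cumulant_def)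

text \<open>
  The tuple \<open>1\<close> is free from every tuple, because the only centred scalar is 0: an alternating product of
  centred elements either contains a factor 0 or has just one factor.
\<close>

lemma G_unit_left:
  fixes \<mu> :: "'k::finite ncpoly \<Rightarrow> complex"
  assumes \<mu>: "\<mu> \<in> D_alg" shows "G_unit \<boxtimes> \<mu> = \<mu>"
proof (rule free_mult_conv_eqI)
  have lin: "Vector_Spaces.linear pm_scale (*) \<mu>" and one: "\<mu> 1 = 1" using \<mu> by (simp_all add: D_alg_def)
  interpret N: nc_prob_space pm_scale \<mu>
    by (simp add: nc_prob_space_def nc_prob_space_axioms_def complex_algebra_pm_scale lin one)
  interpret L: Vector_Spaces.linear pm_scale "(*)" \<mu> by (rule lin)
  have ones: "prod_list (map (\<lambda>i. 1 :: 'k ncpoly) w) = 1" for w :: "'k list" by (induction w) simp_all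
  define S where "S = range (\<lambda>c. pm_scale c (1 :: 'k ncpoly))"
  have "unital_subalgebra pm_scale S"
    unfolding unital_subalgebra_def
  proof (intro conjI ballI)
    show "N.subspace S"
      unfolding N.subspace_def S_def
      by (auto simp: N.scale_left_distrib[symmetric] intro: range_eqI[of _ _ 0])
    show "1 \<in> S" unfolding S_def by (rule range_eqI[of _ _ 1]) simp
    show "x * y \<in> S" if "x \<in> S" "y \<in> S" for x y
      using that by (auto simp: S_def N.scale_mult_left)
  qed
  then have hull: "unital_subalgebra pm_scale hull (range (\<lambda>i :: 'k. 1)) \<subseteq> S"
    by (intro hull_minimal) (auto simp: S_def intro: range_eqI[of _ _ 1])
  have scalar: "x = 0" if x: "x \<in> unital_subalgebra pm_scale hull (range (\<lambda>i :: 'k. 1))" "\<mu> x = 0" for x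
  proof -
    obtain c where "x = pm_scale c 1" using x(1) hull by (auto simp: S_def)
    then show ?thesis using x(2) by (simp add: L.scale one)
  qed
  have "freely_independent pm_scale \<mu> (range (\<lambda>i :: 'k. 1)) (range ncX)"
    unfolding freely_independent_def freely_independent_subalgebras_def
  proof (intro allI impI)
    fix n :: nat and d :: "nat \<Rightarrow> 'k ncpoly" and i :: "nat \<Rightarrow> bool"
    assume n: "1 \<le> n" and d: "\<forall>j<n. d j \<in> (if i j then unital_subalgebra pm_scale hull (range (\<lambda>i :: 'k. 1))
        else unital_subalgebra pm_scale hull (range ncX)) \<and> \<mu> (d j) = 0"
      and i: "\<forall>j. Suc j < n \<longrightarrow> i j \<noteq> i (Suc j)"
    show "\<mu> (prod_list (map d [0..<n])) = 0"
    proof (cases "\<exists>j<n. i j")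
      case True
      then obtain j where j: "j < n" "i j" by blast
      have "d j \<in> (if i j then unital_subalgebra pm_scale hull (range (\<lambda>i :: 'k. 1))
          else unital_subalgebra pm_scale hull (range ncX))" "\<mu> (d j) = 0"
        using d j(1) by blast+
      then have "d j = 0" using j(2) by (intro scalar) (simp_all only: if_True)
      then have "0 \<in> set (map d [0..<n])" using j by force
      then have "prod_list (map d [0..<n]) = 0"
        by (metis split_list prod_list.append prod_list.Cons mult_zero_left mult_zero_right)
      then show ?thesis by (simp add: L.zero)
    next
      case False
      have "n = 1"
      proof (rule ccontr)
        assume "n \<noteq> 1"
        with n have "0 < n" "Suc 0 < n" by auto
        then have "\<not> i 0" "\<not> i (Suc 0)" "i 0 \<noteq> i (Suc 0)" using False i by blast+
        then show False by simp
      qed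
      then show ?thesis using d by simp
    qed
  qed
  moreover have linear_G_unit: "Vector_Spaces.linear pm_scale (*) (G_unit :: 'k ncpoly \<Rightarrow> complex)"
    unfolding G_unit_eq by (rule linear_moment_functional)
  moreover have G_unit_ncmon: "G_unit (ncmon w) = 1" for w :: "'k list"
    by (simp add: G_unit_def ncmon_single)
  ultimately show "free_product_distribution pm_scale \<mu> (\<lambda>i. 1) ncX G_unit \<mu> \<mu>"
    using lin one
    by (simp add: free_product_distribution_def N.nc_prob_space_axioms has_distribution_def ncmon_def[symmetric]
        linear_G_unit G_unit_ncmon ones)
qed

text \<open>
  The cumulants \<open>f\<close> of the inverse are found by recursion on the length of words: by \<open>boxed_top\<close> the
  coefficient of \<open>f w\<close> in \<open>boxed f g w\<close> is a product of values \<open>g [i] = 1\<close>.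
\<close>

lemma left_inverse_exists:
  fixes \<mu> :: "'k::finite ncpoly \<Rightarrow> complex"
  assumes \<mu>: "\<mu> \<in> carrier G_group"
  shows "\<exists>\<nu>\<in>carrier G_group. \<nu> \<boxtimes> \<mu> = G_unit"
proof -
  define g where "g = R_transform \<mu>"
  have g: "g [i] = 1" for i using \<mu> by (simp add: carrier_G g_def)
  define rest where "rest f w = (\<Sum>\<pi>\<in>NC (length w) - {{{..<length w}}}.
    (\<Prod>B\<in>\<pi>. f (nths w B)) * (\<Prod>C\<in>kreweras (length w) \<pi>. g (nths w C)))" for f w
  define G where "G f w = (if w = [] then 0 else one_cumulant w - rest f w)" for f w
  have "\<exists>!f. \<forall>w. f w = G f w"
  proof (rule unique_length_recursion)
    fix f f' :: "'k list \<Rightarrow> complex" and w :: "'k list"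
    assume "\<And>v. length v < length w \<Longrightarrow> f v = f' v"
    then have "(\<Prod>B\<in>\<pi>. f (nths w B)) = (\<Prod>B\<in>\<pi>. f' (nths w B))"
      if "\<pi> \<in> NC (length w) - {{{..<length w}}}" for \<pi>
      using NC_not_top_block[of \<pi> "length w"] that by (intro prod.cong) (auto intro: length_nths_less)
    then show "G f w = G f' w" by (simp add: G_def rest_def)
  qed
  then obtain f where f: "\<And>w. f w = G f w" by blast
  have f0: "f [] = 0" using f[of "[]"] by (simp add: G_def)
  have boxed: "boxed f g w = one_cumulant w" if "w \<noteq> []" for w
    using boxed_top[where w = w and g = g and f = f, OF that g] f[of w] that by (simp add: G_def rest_def)
  have f1: "f [i] = 1" for i
    using boxed[of "[i]"] boxed_singleton[where g = g and f = f and i = i, OF g] by (simp add: one_cumulant_def)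
  define \<nu> where "\<nu> = moment_functional (moment f)"
  have R: "R_transform \<nu> = f" unfolding \<nu>_def by (rule R_transform_moment_functional) (rule f0)
  have \<nu>: "\<nu> \<in> carrier G_group" using R f1 by (simp add: carrier_G \<nu>_def moment_functional_D_alg)
  have "boxed0 f g = one_cumulant"
    using boxed by (auto simp: boxed0_def one_cumulant_def)
  then have "\<nu> \<boxtimes> \<mu> = G_unit"
    using free_mult_conv_boxed[of \<nu> \<mu>] \<mu> \<nu> by (simp add: carrier_G R g_def[symmetric] G_unit_eq)
  with \<nu> show ?thesis by blast
qed

lemma R_transform_free_mult_conv_singleton:
  assumes "\<mu> \<in> carrier G_group" "\<nu> \<in> carrier (G_group :: ('k::finite ncpoly \<Rightarrow> complex) monoid)"
  shows "R_transform (\<mu> \<boxtimes> \<nu>) [i] = 1"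
  using assms boxed_singleton[of "R_transform \<nu>" "R_transform \<mu>" i]
  by (simp add: carrier_G R_transform_free_mult_conv boxed0_def)

theorem group_G: "group (G_group :: ('k::finite ncpoly \<Rightarrow> complex) monoid)"
proof (rule groupI)
  let ?G = "G_group :: ('k ncpoly \<Rightarrow> complex) monoid"
  have mult: "x \<otimes>\<^bsub>?G\<^esub> y = x \<boxtimes> y" and one: "\<one>\<^bsub>?G\<^esub> = G_unit" for x y by (simp_all add: G_group_def)
  show "x \<otimes>\<^bsub>?G\<^esub> y \<in> carrier ?G" if "x \<in> carrier ?G" "y \<in> carrier ?G" for x y
    using that R_transform_free_mult_conv_singleton[OF that]
    by (simp add: mult carrier_G free_mult_conv_D_alg)
  show "\<one>\<^bsub>?G\<^esub> \<in> carrier ?G"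
    by (simp add: one carrier_G R_transform_G_unit one_cumulant_def)
      (simp add: G_unit_eq moment_functional_D_alg)
  show "x \<otimes>\<^bsub>?G\<^esub> y \<otimes>\<^bsub>?G\<^esub> z = x \<otimes>\<^bsub>?G\<^esub> (y \<otimes>\<^bsub>?G\<^esub> z)"
    if "x \<in> carrier ?G" "y \<in> carrier ?G" "z \<in> carrier ?G" for x y z
    using that by (simp add: mult carrier_G free_mult_conv_assoc)
  show "\<one>\<^bsub>?G\<^esub> \<otimes>\<^bsub>?G\<^esub> x = x" if "x \<in> carrier ?G" for x
    using that by (simp add: mult one carrier_G G_unit_left)
  show "\<exists>y\<in>carrier ?G. y \<otimes>\<^bsub>?G\<^esub> x = \<one>\<^bsub>?G\<^esub>" if "x \<in> carrier ?G" for x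
    using left_inverse_exists[OF that] by (simp add: mult one)
qed

subsection \<open>Convolution of characters\<close>

lemma unital_alg_hom_comp:
  assumes "unital_alg_hom s1 s2 f" "unital_alg_hom s2 s3 g" shows "unital_alg_hom s1 s3 (g \<circ> f)"
  using assms Vector_Spaces.linear_compose[OF unital_alg_hom_linear[OF assms(1)] unital_alg_hom_linear[OF assms(2)]]
  by (simp add: unital_alg_hom_def)

lemma unital_alg_hom_prod:
  assumes "unital_alg_hom s1 s2 f" shows "f (\<Prod>i\<in>I. h i) = (\<Prod>i\<in>I. f (h i))"
  using assms by (induction I rule: infinite_finite_induct) (simp_all add: unital_alg_hom_def)

lemma tensor_functional_hom:
  assumes "unital_alg_hom pm_scale (*) \<xi>" "unital_alg_hom pm_scale (*) \<eta>"
  shows "unital_alg_hom pm_scale (*) (tensor_functional \<xi> \<eta>)"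
  unfolding tensor_functional_conv
proof (rule unital_alg_hom_lin_ext[OF complex_algebra_complex])
  have \<xi>: "\<xi> 1 = 1" "\<xi> (x * y) = \<xi> x * \<xi> y" and \<eta>: "\<eta> 1 = 1" "\<eta> (x * y) = \<eta> x * \<eta> y" for x y
    using assms by (simp_all add: unital_alg_hom_def)
  show "(case 0 of (m, n) \<Rightarrow> \<xi> (Poly_Mapping.single m 1) * \<eta> (Poly_Mapping.single n 1)) = 1"
    by (simp add: zero_prod_def \<xi> \<eta>)
  fix x y :: "'a ymon \<times> 'a ymon"
  have "Poly_Mapping.single (m + n) (1 :: complex) = Poly_Mapping.single m 1 * Poly_Mapping.single n 1"
    for m n :: "'a ymon" by (simp add: mult_single)
  then show "(case x + y of (m, n) \<Rightarrow> \<xi> (Poly_Mapping.single m 1) * \<eta> (Poly_Mapping.single n 1)) =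
      (case x of (m, n) \<Rightarrow> \<xi> (Poly_Mapping.single m 1) * \<eta> (Poly_Mapping.single n 1)) *
      (case y of (m, n) \<Rightarrow> \<xi> (Poly_Mapping.single m 1) * \<eta> (Poly_Mapping.single n 1))"
    by (cases x; cases y) (simp add: \<xi> \<eta> mult_ac)
qed

lemma conv_hom:
  assumes "unital_alg_hom pm_scale (*) \<xi>" "unital_alg_hom pm_scale (*) \<eta>"
  shows "unital_alg_hom pm_scale (*) (conv \<xi> \<eta>)"
  unfolding conv_def by (rule unital_alg_hom_comp[OF comult_hom tensor_functional_hom[OF assms]])

text \<open>
  On generators the comultiplication is the boxed convolution by definition; the convention \<open>Y [i] = 1\<close>
  is why \<open>f\<close> and \<open>g\<close> have to be 1 at words of length 1.
\<close>

lemma conv_Y: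
  assumes \<xi>: "unital_alg_hom pm_scale (*) \<xi>" and \<eta>: "unital_alg_hom pm_scale (*) \<eta>"
    and f: "\<And>u. u \<noteq> [] \<Longrightarrow> \<xi> (Y u) = f u" and g: "\<And>u. u \<noteq> [] \<Longrightarrow> \<eta> (Y u) = g u"
    and w: "length w \<ge> 2"
  shows "conv \<xi> \<eta> (Y w) = boxed f g w"
proof -
  interpret T: Vector_Spaces.linear pm_scale "(*)" "tensor_functional \<xi> \<eta>"
    by (rule linear_tensor_functional)
  have n: "length w \<noteq> 0" using w by auto
  have part: "\<xi> (Y_part w \<pi>) = (\<Prod>B\<in>\<pi>. f (nths w B))" "\<eta> (Y_part w \<pi>) = (\<Prod>B\<in>\<pi>. g (nths w B))"
    if "\<pi> \<in> NC (length w)" for \<pi>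
    using that nths_nonempty[of w \<pi>]
    by (auto simp: Y_part_def unital_alg_hom_prod[OF \<xi>] unital_alg_hom_prod[OF \<eta>] NC_iff f g intro!: prod.cong)
  have "conv \<xi> \<eta> (Y w) = (\<Sum>\<pi>\<in>NC (length w). \<xi> (Y_part w \<pi>) * \<eta> (Y_part w (kreweras (length w) \<pi>)))"
    using w by (simp add: conv_def comult_Y T.sum
        tensor_functional_tensor[OF unital_alg_hom_linear[OF \<xi>] unital_alg_hom_linear[OF \<eta>]])
  also have "\<dots> = boxed f g w"
    unfolding boxed_def
  proof (rule sum.cong[OF refl])
    fix \<pi> assume \<pi>: "\<pi> \<in> NC (length w)"
    obtain B \<sigma> where "kreweras (length w) \<pi> \<in> NC (length w)" by (rule cpl_of_NC[OF \<pi> n])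
    then show "\<xi> (Y_part w \<pi>) * \<eta> (Y_part w (kreweras (length w) \<pi>)) =
        (\<Prod>B\<in>\<pi>. f (nths w B)) * (\<Prod>C\<in>kreweras (length w) \<pi>. g (nths w C))"
      using \<pi> by (simp add: part)
  qed
  finally show ?thesis .
qed

lemma character_eqI:
  assumes "unital_alg_hom pm_scale (*) \<xi>" "unital_alg_hom pm_scale (*) \<eta>"
    and "\<And>w. length w \<ge> 2 \<Longrightarrow> \<xi> (Y w) = \<eta> (Y w)"
  shows "\<xi> = \<eta>"
  using ex1_unital_alg_hom_Y[OF complex_algebra_complex, of "\<lambda>w. \<eta> (Y w)"] assms by blast

lemma length_ge_2_iff: "u \<noteq> [] \<Longrightarrow> length u \<ge> 2 \<or> (\<exists>i. u = [i])"
  by (cases u; cases "tl u") auto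

lemma character_Y_singleton: "unital_alg_hom s1 s2 \<xi> \<Longrightarrow> \<xi> (Y [i]) = 1"
  by (simp add: Y_def unital_alg_hom_def)

lemma chi_Y_G: "\<mu> \<in> carrier G_group \<Longrightarrow> u \<noteq> [] \<Longrightarrow> chi \<mu> (Y u) = R_transform \<mu> u"
  using length_ge_2_iff[of u] chi_Y[of u \<mu>] character_Y_singleton[OF chi_hom[of \<mu>]]
  by (auto simp: carrier_G)

lemma chi_mult:
  fixes \<mu> \<nu> :: "'k::finite ncpoly \<Rightarrow> complex"
  assumes \<mu>: "\<mu> \<in> carrier G_group" and \<nu>: "\<nu> \<in> carrier G_group"
  shows "chi (\<mu> \<boxtimes> \<nu>) = conv (chi \<mu>) (chi \<nu>)"
proof (rule character_eqI[OF chi_hom conv_hom[OF chi_hom chi_hom]])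
  fix w :: "'k list" assume w: "length w \<ge> 2"
  have "chi (\<mu> \<boxtimes> \<nu>) (Y w) = boxed0 (R_transform \<mu>) (R_transform \<nu>) w"
    using w \<mu> \<nu> by (simp add: chi_Y carrier_G R_transform_free_mult_conv)
  also have "\<dots> = conv (chi \<mu>) (chi \<nu>) (Y w)"
    using w conv_Y[OF chi_hom chi_hom chi_Y_G[OF \<mu>] chi_Y_G[OF \<nu>] w] by (auto simp: boxed0_def)
  finally show "chi (\<mu> \<boxtimes> \<nu>) (Y w) = conv (chi \<mu>) (chi \<nu>) (Y w)" .
qed

text \<open>
  A preimage of a character has its values on the generators as cumulants.
\<close>

lemma chi_bij: "bij_betw chi (carrier G_group) {\<chi> :: 'k::finite yalg \<Rightarrow> complex. unital_alg_hom pm_scale (*) \<chi>}"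
  unfolding bij_betw_def
proof
  show "inj_on chi (carrier G_group :: ('k ncpoly \<Rightarrow> complex) set)"
  proof (rule inj_onI)
    fix \<mu> \<nu> :: "'k ncpoly \<Rightarrow> complex"
    assume \<mu>: "\<mu> \<in> carrier G_group" and \<nu>: "\<nu> \<in> carrier G_group" and eq: "chi \<mu> = chi \<nu>"
    have "R_transform \<mu> u = R_transform \<nu> u" for u
      using chi_Y_G[OF \<mu>, of u] chi_Y_G[OF \<nu>, of u] eq R_transform_props(1)[of \<mu>] R_transform_props(1)[of \<nu>]
      by (cases "u = []") auto
    then have "R_transform \<mu> = R_transform \<nu>" by (rule ext)
    then show "\<mu> = \<nu>" using \<mu> \<nu> D_alg_eq_moment_functional unfolding carrier_G by metis
  qed
  show "chi ` carrier G_group = {\<chi> :: 'k yalg \<Rightarrow> complex. unital_alg_hom pm_scale (*) \<chi>}"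
  proof
    show "{\<chi> :: 'k yalg \<Rightarrow> complex. unital_alg_hom pm_scale (*) \<chi>} \<subseteq> chi ` carrier G_group"
    proof
      fix \<chi> :: "'k yalg \<Rightarrow> complex" assume "\<chi> \<in> {\<chi>. unital_alg_hom pm_scale (*) \<chi>}"
      then have \<chi>: "unital_alg_hom pm_scale (*) \<chi>" by simp
      define f where "f u = (if u = [] then 0 else \<chi> (Y u))" for u
      define \<mu> where "\<mu> = moment_functional (moment f)"
      have R: "R_transform \<mu> = f" unfolding \<mu>_def by (rule R_transform_moment_functional) (simp add: f_def)
      have "\<mu> \<in> carrier G_group"
        by (simp add: carrier_G R) (simp add: \<mu>_def moment_functional_D_alg f_def character_Y_singleton[OF \<chi>])
      moreover have "chi \<mu> = \<chi>"
        by (rule character_eqI[OF chi_hom \<chi>]) (auto simp: chi_Y R f_def)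
      ultimately show "\<chi> \<in> chi ` carrier G_group" by blast
    qed
  qed (auto intro: chi_hom)
qed

theorem theorem1p2:
  shows "group (G_group :: ('k::finite ncpoly \<Rightarrow> complex) monoid) \<and>
    group (character_group :: ('k yalg \<Rightarrow> complex) monoid) \<and>
    (chi :: ('k ncpoly \<Rightarrow> complex) \<Rightarrow> ('k yalg \<Rightarrow> complex)) \<in> iso G_group character_group"
proof -
  let ?G = "G_group :: ('k ncpoly \<Rightarrow> complex) monoid"
  let ?X = "character_group :: ('k yalg \<Rightarrow> complex) monoid"
  have G: "group ?G" by (rule group_G)
  have iso: "chi \<in> iso ?G ?X"
  proof (rule isoI)
    show "chi \<in> hom ?G ?X"
    proof (rule homI)
      show "chi (\<mu> \<otimes>\<^bsub>?G\<^esub> \<nu>) = chi \<mu> \<otimes>\<^bsub>?X\<^esub> chi \<nu>" if "\<mu> \<in> carrier ?G" "\<nu> \<in> carrier ?G" for \<mu> \<nu>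
        using chi_mult[OF that] by (simp add: G_group_def character_group_def)
    qed (simp add: character_group_def chi_hom)
    show "bij_betw chi (carrier ?G) (carrier ?X)"
      using chi_bij by (simp add: character_group_def)
  qed
  have "chi \<one>\<^bsub>?G\<^esub> = (counit :: 'k yalg \<Rightarrow> complex)"
    by (rule character_eqI[OF chi_hom counit_hom])
      (simp add: chi_Y counit_Y G_group_def R_transform_G_unit one_cumulant_def)
  then have "?X\<lparr>one := chi \<one>\<^bsub>?G\<^esub>\<rparr> = ?X" by (simp add: character_group_def)
  then have "group ?X" using group.iso_imp_img_group[OF G iso] by simp
  with G iso show ?thesis by blast
qed

end
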